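(* Let $G$ be a connected real Lie group of dimension $n\ge 2$ equipped with a left invariant Riemannian metric $\mathsf{h}$ that is Einstein with Einstein scalar $\sigma$. Suppose that $W$ is a right invariant vector field on $G$ such that $\|W\|_{\mathsf{h}}=1$. Then the Kropina metric corresponding to the navigation data $(\mathsf{h},W)$ is a non-Riemannian Einstein Finsler metric with the same Einstein scalar $\sigma$. Moreover, if $n\ge 3$, then this Kropina metric is Ricci constant.
   Context: A Kropina metric on a smooth manifold $M$ is a (singular, conic) Finsler metric $F=\alpha^2/\beta$, where $\alpha(x,y)=\sqrt{\mathsf{a}(y,y)}$ for a Riemannian metric $\mathsf{a}$ and $\beta$ is a nowhere vanishing 1-form; it is considered on the domain $\{(x,y)\in TM : \beta(y)>0\}$. Given a Riemannian metric $\mathsf{h}$ and a vector field $W$ on $M$ with $\|W\|_{\mathsf{h}}=\sqrt{\mathsf{h}(W,W)}=1$, the Kropina metric corresponding to the navigation data $(\mathsf{h},W)$ is $F(x,y)=\dfrac{\mathsf{h}(y,y)}{2\,\mathsf{h}(W(x),y)}$, on the domain $\mathsf{h}(W(x),y)>0$. For a Finsler metric $F$, $\mathrm{Ric}_F(x,y)$ denotes its Ricci curvature (the trace of the Riemann curvature operator $R_y$; for a Riemannian metric it is the Ricci tensor evaluated on $(y,y)$). $F$ is Einstein with Einstein scalar $\sigma$ if $\mathrm{Ric}_F=\sigma F^2$ for a scalar function $\sigma=\sigma(x)$ on $M$; it is Ricci constant if this holds with $\sigma$ constant. For a Riemannian metric $\mathsf{h}$ the same convention is used with $F^2=\mathsf{h}(y,y)$.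 *)

theory Defs
  imports "HOL-Analysis.Analysis" "HOL-Algebra.Group"
begin

section \<open>Smooth maps between Euclidean spaces\<close>

text \<open>
  \<open>Ck k S f\<close> and \<open>smooth_on S f\<close> are meant for open \<open>S\<close> only.
\<close>

fun Ck :: "nat \<Rightarrow> 'a::euclidean_space set \<Rightarrow> ('a \<Rightarrow> 'b::real_normed_vector) \<Rightarrow> bool" where
  "Ck 0 S f \<longleftrightarrow> continuous_on S f"
| "Ck (Suc k) S f \<longleftrightarrow>
     (\<forall>x\<in>S. f differentiable (at x)) \<and> (\<forall>v. Ck k S (\<lambda>x. frechet_derivative f (at x) v))"

definition smooth_on :: "'a::euclidean_space set \<Rightarrow> ('a \<Rightarrow> 'b::real_normed_vector) \<Rightarrow> bool" where
  "smooth_on S f \<longleftrightarrow> (\<forall>k. Ck k S f)"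

section \<open>Smooth manifolds\<close>

text \<open>
  The points of a manifold are all elements of a topological type \<open>'m\<close>, and its dimension is
  \<open>CARD('n)\<close>.  A chart is a pair of an open set and a map that is only relevant on that set.
\<close>

type_synonym ('m, 'n) chart = "'m set \<times> ('m \<Rightarrow> real ^ 'n)"

definition chart_inv :: "('m, 'n) chart \<Rightarrow> real ^ 'n \<Rightarrow> 'm" where
  "chart_inv c = inv_into (fst c) (snd c)"

definition chart_image :: "('m, 'n) chart \<Rightarrow> (real ^ 'n) set" where
  "chart_image c = snd c ` fst c"

definition is_chart :: "('m::topological_space, 'n::finite) chart \<Rightarrow> bool" where
  "is_chart c \<longleftrightarrow> open (fst c) \<and> open (chart_image c) \<and>
     homeomorphism (fst c) (chart_image c) (snd c) (chart_inv c)"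

definition transition :: "('m, 'n) chart \<Rightarrow> ('m, 'n) chart \<Rightarrow> real ^ 'n \<Rightarrow> real ^ 'n" where
  "transition c d = snd d \<circ> chart_inv c"

definition compatible :: "('m, 'n::finite) chart \<Rightarrow> ('m, 'n) chart \<Rightarrow> bool" where
  "compatible c d \<longleftrightarrow>
     smooth_on (snd c ` (fst c \<inter> fst d)) (transition c d) \<and>
     smooth_on (snd d ` (fst c \<inter> fst d)) (transition d c)"

text \<open>A smooth structure is a maximal atlas.\<close>

definition smooth_structure ::
    "('m::{t2_space, second_countable_topology}, 'n::finite) chart set \<Rightarrow> bool" where
  "smooth_structure A \<longleftrightarrow>
     (\<forall>c\<in>A. is_chart c) \<and> (\<Union>c\<in>A. fst c) = UNIV \<and> (\<forall>c\<in>A. \<forall>d\<in>A. compatible c d) \<and>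
     (\<forall>c. is_chart c \<and> (\<forall>d\<in>A. compatible c d) \<longrightarrow> c \<in> A)"

definition charts_at :: "('m, 'n) chart set \<Rightarrow> 'm \<Rightarrow> ('m, 'n) chart set" where
  "charts_at A p = {c \<in> A. p \<in> fst c}"

section \<open>Tangent vectors\<close>

text \<open>
  A tangent vector at \<open>p\<close> assigns to every chart around \<open>p\<close> a component vector, such that
  component vectors in different charts are related by the differential of the transition map.
  Charts not containing \<open>p\<close> get the value \<open>0\<close>, so that equality of tangent vectors
  is equality of functions.
\<close>

type_synonym ('m, 'n) tvec = "('m, 'n) chart \<Rightarrow> real ^ 'n"

definition tangent_space :: "('m, 'n::finite) chart set \<Rightarrow> 'm \<Rightarrow> ('m, 'n) tvec set" where
  "tangent_space A p = {v.
     (\<forall>c. c \<notin> charts_at A p \<longrightarrow> v c = 0) \<and>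
     (\<forall>c\<in>charts_at A p. \<forall>d\<in>charts_at A p.
        v d = frechet_derivative (transition c d) (at (snd c p)) (v c))}"

text \<open>The tangent vector at \<open>p\<close> with components \<open>y\<close> in the chart \<open>c\<close>.\<close>

definition tvec_of :: "('m, 'n::finite) chart set \<Rightarrow> ('m, 'n) chart \<Rightarrow> 'm \<Rightarrow> real ^ 'n \<Rightarrow> ('m, 'n) tvec" where
  "tvec_of A c p y = (\<lambda>d.
     if d \<in> charts_at A p then frechet_derivative (transition c d) (at (snd c p)) y else 0)"

text \<open>
  The differential at \<open>p\<close> of a smooth self-map of the manifold.  By the chain rule it does not
  depend on the chart \<open>c\<close> chosen at \<open>p\<close>.
\<close>

definition tangent_map ::
    "('m, 'n::finite) chart set \<Rightarrow> ('m \<Rightarrow> 'm) \<Rightarrow> 'm \<Rightarrow> ('m, 'n) tvec \<Rightarrow> ('m, 'n) tvec" where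
  "tangent_map A f p v = (let c = (SOME c. c \<in> charts_at A p) in
     (\<lambda>d. if d \<in> charts_at A (f p)
          then frechet_derivative (snd d \<circ> f \<circ> chart_inv c) (at (snd c p)) (v c) else 0))"

definition smooth_vector_field ::
    "('m, 'n::finite) chart set \<Rightarrow> ('m \<Rightarrow> ('m, 'n) tvec) \<Rightarrow> bool" where
  "smooth_vector_field A W \<longleftrightarrow> (\<forall>p. W p \<in> tangent_space A p) \<and>
     (\<forall>c\<in>A. smooth_on (chart_image c) (\<lambda>x. W (chart_inv c x) c))"

section \<open>Riemannian metrics\<close>

definition local_metric ::
    "('m, 'n::finite) chart set \<Rightarrow> ('m \<Rightarrow> ('m, 'n) tvec \<Rightarrow> ('m, 'n) tvec \<Rightarrow> real) \<Rightarrow> ('m, 'n) chart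
      \<Rightarrow> real ^ 'n \<Rightarrow> real ^ 'n \<Rightarrow> real ^ 'n \<Rightarrow> real" where
  "local_metric A h c x u v =
     h (chart_inv c x) (tvec_of A c (chart_inv c x) u) (tvec_of A c (chart_inv c x) v)"

definition riemannian_metric ::
    "('m, 'n::finite) chart set \<Rightarrow> ('m \<Rightarrow> ('m, 'n) tvec \<Rightarrow> ('m, 'n) tvec \<Rightarrow> real) \<Rightarrow> bool" where
  "riemannian_metric A h \<longleftrightarrow> (\<forall>c\<in>A.
     (\<forall>x\<in>chart_image c.
        bilinear (local_metric A h c x) \<and>
        (\<forall>u v. local_metric A h c x u v = local_metric A h c x v u) \<and>
        (\<forall>u. u \<noteq> 0 \<longrightarrow> local_metric A h c x u u > 0)) \<and>
     (\<forall>u v. smooth_on (chart_image c) (\<lambda>x. local_metric A h c x u v)))"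

section \<open>Spray, Riemann curvature and Ricci curvature in coordinates\<close>

text \<open>
  Functions of \<open>z = (x, y)\<close>, where \<open>x\<close> are coordinates on the base and \<open>y\<close> are the induced fibre
  coordinates of the tangent bundle; \<open>dx i\<close> and \<open>dy i\<close> are the partial derivatives.
\<close>

definition dx :: "'n::finite \<Rightarrow> ((real ^ 'n) \<times> (real ^ 'n) \<Rightarrow> real) \<Rightarrow> (real ^ 'n) \<times> (real ^ 'n) \<Rightarrow> real" where
  "dx i f z = frechet_derivative f (at z) (axis i 1, 0)"

definition dy :: "'n::finite \<Rightarrow> ((real ^ 'n) \<times> (real ^ 'n) \<Rightarrow> real) \<Rightarrow> (real ^ 'n) \<times> (real ^ 'n) \<Rightarrow> real" where
  "dy i f z = frechet_derivative f (at z) (0, axis i 1)"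

definition fundamental_tensor ::
    "((real ^ 'n::finite) \<times> (real ^ 'n) \<Rightarrow> real) \<Rightarrow> (real ^ 'n) \<times> (real ^ 'n) \<Rightarrow> real ^ 'n ^ 'n" where
  "fundamental_tensor F z = (\<chi> i j. 1/2 * dy i (dy j (\<lambda>w. (F w)\<^sup>2)) z)"

text \<open>Normalised so that geodesics satisfy \<open>x'' + 2 G(x, x') = 0\<close>.\<close>

definition spray_coeff ::
    "((real ^ 'n::finite) \<times> (real ^ 'n) \<Rightarrow> real) \<Rightarrow> 'n \<Rightarrow> (real ^ 'n) \<times> (real ^ 'n) \<Rightarrow> real" where
  "spray_coeff F i z = 1/4 * (\<Sum>l\<in>UNIV. matrix_inv (fundamental_tensor F z) $ i $ l *
     ((\<Sum>k\<in>UNIV. dx k (dy l (\<lambda>w. (F w)\<^sup>2)) z * snd z $ k) - dx l (\<lambda>w. (F w)\<^sup>2) z))"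

text \<open>The components \<open>R\<^sup>i\<^sub>k\<close> of the Riemann curvature operator \<open>R\<^sub>y\<close>.\<close>

definition riemann_curvature ::
    "((real ^ 'n::finite) \<times> (real ^ 'n) \<Rightarrow> real) \<Rightarrow> (real ^ 'n) \<times> (real ^ 'n) \<Rightarrow> real ^ 'n ^ 'n" where
  "riemann_curvature F z = (\<chi> i k. 2 * dx k (spray_coeff F i) z
     - (\<Sum>j\<in>UNIV. snd z $ j * dx j (dy k (spray_coeff F i)) z)
     + 2 * (\<Sum>j\<in>UNIV. spray_coeff F j z * dy j (dy k (spray_coeff F i)) z)
     - (\<Sum>j\<in>UNIV. dy j (spray_coeff F i) z * dy k (spray_coeff F j) z))"

definition ricci_curvature ::
    "((real ^ 'n::finite) \<times> (real ^ 'n) \<Rightarrow> real) \<Rightarrow> (real ^ 'n) \<times> (real ^ 'n) \<Rightarrow> real" where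
  "ricci_curvature F z = trace (riemann_curvature F z)"

section \<open>Conic Finsler metrics on manifolds\<close>

definition tangent_point ::
    "('m, 'n::finite) chart set \<Rightarrow> ('m, 'n) chart \<Rightarrow> (real ^ 'n) \<times> (real ^ 'n) \<Rightarrow> 'm \<times> ('m, 'n) tvec" where
  "tangent_point A c z = (chart_inv c (fst z), tvec_of A c (chart_inv c (fst z)) (snd z))"

definition local_domain ::
    "('m, 'n::finite) chart set \<Rightarrow> ('m \<times> ('m, 'n) tvec) set \<Rightarrow> ('m, 'n) chart
      \<Rightarrow> ((real ^ 'n) \<times> (real ^ 'n)) set" where
  "local_domain A D c = {z. fst z \<in> chart_image c \<and> tangent_point A c z \<in> D}"

definition local_finsler ::
    "('m, 'n::finite) chart set \<Rightarrow> ('m \<Rightarrow> ('m, 'n) tvec \<Rightarrow> real) \<Rightarrow> ('m, 'n) chart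
      \<Rightarrow> (real ^ 'n) \<times> (real ^ 'n) \<Rightarrow> real" where
  "local_finsler A F c z = case_prod F (tangent_point A c z)"

text \<open>
  \<open>D\<close> is an open conic subset of the tangent bundle that meets every tangent space.  Homogeneity and
  positivity force the zero vectors to be outside \<open>D\<close>.
\<close>

definition conic_finsler_metric ::
    "('m, 'n::finite) chart set \<Rightarrow> ('m \<times> ('m, 'n) tvec) set \<Rightarrow> ('m \<Rightarrow> ('m, 'n) tvec \<Rightarrow> real) \<Rightarrow> bool"
  where
  "conic_finsler_metric A D F \<longleftrightarrow>
     D \<subseteq> (SIGMA p:UNIV. tangent_space A p) \<and>
     (\<forall>p. \<exists>v. (p, v) \<in> D) \<and>
     (\<forall>(p, v)\<in>D. F p v > 0 \<and>
        (\<forall>t>0. (p, \<lambda>c. t *\<^sub>R v c) \<in> D \<and> F p (\<lambda>c. t *\<^sub>R v c) = t * F p v)) \<and>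
     (\<forall>c\<in>A. open (local_domain A D c) \<and>
        smooth_on (local_domain A D c) (local_finsler A F c) \<and>
        (\<forall>z\<in>local_domain A D c. \<forall>u. u \<noteq> 0 \<longrightarrow>
           u \<bullet> (fundamental_tensor (local_finsler A F c) z *v u) > 0))"

definition einstein ::
    "('m, 'n::finite) chart set \<Rightarrow> ('m \<times> ('m, 'n) tvec) set \<Rightarrow> ('m \<Rightarrow> ('m, 'n) tvec \<Rightarrow> real)
      \<Rightarrow> ('m \<Rightarrow> real) \<Rightarrow> bool" where
  "einstein A D F \<sigma> \<longleftrightarrow> (\<forall>c\<in>A. \<forall>z\<in>local_domain A D c.
     ricci_curvature (local_finsler A F c) z =
       \<sigma> (chart_inv c (fst z)) * (local_finsler A F c z)\<^sup>2)"

definition ricci_constant ::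
    "('m, 'n::finite) chart set \<Rightarrow> ('m \<times> ('m, 'n) tvec) set \<Rightarrow> ('m \<Rightarrow> ('m, 'n) tvec \<Rightarrow> real) \<Rightarrow> bool"
  where
  "ricci_constant A D F \<longleftrightarrow> (\<exists>k. einstein A D F (\<lambda>_. k))"

definition norm_of ::
    "('m \<Rightarrow> ('m, 'n) tvec \<Rightarrow> ('m, 'n) tvec \<Rightarrow> real) \<Rightarrow> 'm \<Rightarrow> ('m, 'n) tvec \<Rightarrow> real" where
  "norm_of h p v = sqrt (h p v v)"

definition slit_tangent_bundle :: "('m, 'n::finite) chart set \<Rightarrow> ('m \<times> ('m, 'n) tvec) set" where
  "slit_tangent_bundle A = (SIGMA p:UNIV. tangent_space A p - {\<lambda>_. 0})"

text \<open>
  A Riemannian metric \<open>h\<close> is treated as the Finsler metric with \<open>F\<^sup>2 = h(y, y)\<close>; its \<open>Ric(x, y)\<close> is then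
  the Ricci tensor evaluated on \<open>(y, y)\<close>.
\<close>

definition riemannian_einstein ::
    "('m, 'n::finite) chart set \<Rightarrow> ('m \<Rightarrow> ('m, 'n) tvec \<Rightarrow> ('m, 'n) tvec \<Rightarrow> real)
      \<Rightarrow> ('m \<Rightarrow> real) \<Rightarrow> bool" where
  "riemannian_einstein A h \<sigma> \<longleftrightarrow> einstein A (slit_tangent_bundle A) (norm_of h) \<sigma>"

definition is_riemannian ::
    "('m, 'n::finite) chart set \<Rightarrow> ('m \<times> ('m, 'n) tvec) set \<Rightarrow> ('m \<Rightarrow> ('m, 'n) tvec \<Rightarrow> real) \<Rightarrow> bool"
  where
  "is_riemannian A D F \<longleftrightarrow>
     (\<exists>a. riemannian_metric A a \<and> (\<forall>(p, v)\<in>D. F p v = norm_of a p v))"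

text \<open>The Kropina metric with navigation data \<open>(h, W)\<close>, and the cone on which it is defined.\<close>

definition kropina ::
    "('m \<Rightarrow> ('m, 'n) tvec \<Rightarrow> ('m, 'n) tvec \<Rightarrow> real) \<Rightarrow> ('m \<Rightarrow> ('m, 'n) tvec)
      \<Rightarrow> 'm \<Rightarrow> ('m, 'n) tvec \<Rightarrow> real" where
  "kropina h W p v = h p v v / (2 * h p (W p) v)"

definition kropina_domain ::
    "('m, 'n::finite) chart set \<Rightarrow> ('m \<Rightarrow> ('m, 'n) tvec \<Rightarrow> ('m, 'n) tvec \<Rightarrow> real)
      \<Rightarrow> ('m \<Rightarrow> ('m, 'n) tvec) \<Rightarrow> ('m \<times> ('m, 'n) tvec) set" where
  "kropina_domain A h W = {(p, v). v \<in> tangent_space A p \<and> h p (W p) v > 0}"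

section \<open>Lie groups\<close>

text \<open>The last two conjuncts express smoothness of multiplication and inversion in charts.\<close>

definition lie_group ::
    "'g::{t2_space, second_countable_topology} monoid \<Rightarrow> ('g, 'n::finite) chart set \<Rightarrow> bool" where
  "lie_group G A \<longleftrightarrow>
     group G \<and> carrier G = UNIV \<and> smooth_structure A \<and>
     continuous_on UNIV (\<lambda>(p, q). p \<otimes>\<^bsub>G\<^esub> q) \<and> continuous_on UNIV (m_inv G) \<and>
     (\<forall>a\<in>A. \<forall>b\<in>A. \<forall>c\<in>A.
        smooth_on
          {(x, y). x \<in> chart_image a \<and> y \<in> chart_image b \<and>
                   chart_inv a x \<otimes>\<^bsub>G\<^esub> chart_inv b y \<in> fst c}
          (\<lambda>(x, y). snd c (chart_inv a x \<otimes>\<^bsub>G\<^esub> chart_inv b y))) \<and>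
     (\<forall>a\<in>A. \<forall>c\<in>A.
        smooth_on {x \<in> chart_image a. m_inv G (chart_inv a x) \<in> fst c}
          (\<lambda>x. snd c (m_inv G (chart_inv a x))))"

definition left_invariant_metric ::
    "'g monoid \<Rightarrow> ('g, 'n::finite) chart set
      \<Rightarrow> ('g \<Rightarrow> ('g, 'n) tvec \<Rightarrow> ('g, 'n) tvec \<Rightarrow> real) \<Rightarrow> bool" where
  "left_invariant_metric G A h \<longleftrightarrow>
     (\<forall>g p. \<forall>u\<in>tangent_space A p. \<forall>v\<in>tangent_space A p.
        h (g \<otimes>\<^bsub>G\<^esub> p) (tangent_map A (\<lambda>q. g \<otimes>\<^bsub>G\<^esub> q) p u) (tangent_map A (\<lambda>q. g \<otimes>\<^bsub>G\<^esub> q) p v)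
          = h p u v)"

definition right_invariant_field ::
    "'g monoid \<Rightarrow> ('g, 'n::finite) chart set \<Rightarrow> ('g \<Rightarrow> ('g, 'n) tvec) \<Rightarrow> bool" where
  "right_invariant_field G A W \<longleftrightarrow>
     (\<forall>g p. W (p \<otimes>\<^bsub>G\<^esub> g) = tangent_map A (\<lambda>q. q \<otimes>\<^bsub>G\<^esub> g) p (W p))"

end

theory Submission
  imports Defs
begin

text \<open>
  Let \<open>\<nabla>\<close> be the Levi-Civita connection of \<open>h\<close> and \<open>S = \<nabla>W\<close>.  Right invariant fields generate left translations,
  which are isometries, so \<open>W\<close> is a Killing field and \<open>S\<close> is skew; since \<open>W\<close> has constant length, \<open>S W = 0\<close>.
  In a chart the spray of the Kropina metric \<open>F\<close> is that of \<open>h\<close> minus \<open>F S y\<close>.  Inserting this into the formula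
  for the Ricci curvature, and using that the divergence of \<open>S\<close> is the Ricci tensor applied to \<open>W\<close>, all terms except
  \<open>- F\<^sup>2 tr (S\<^sup>2)\<close> cancel when \<open>Ric = \<sigma> h\<close>; taking the divergence of \<open>S W = 0\<close> gives \<open>tr (S\<^sup>2) = - \<sigma>\<close>.
  The scalar \<open>\<sigma>\<close> is constant because composing a chart with a left translation gives a chart with the
  same coordinate expression of \<open>h\<close>.
\<close>

section \<open>Calculus of \<open>Ck\<close> maps\<close>

text \<open>The correction \<open>- F S y\<close> is what navigation along a Killing field predicts.
  The equation \<open>h (y/F - W, y/F - W) = 1\<close> puts the indicatrix of \<open>F\<close> on
  the unit sphere of \<open>h\<close> shifted by \<open>W\<close>, so carrying a unit speed geodesic
  \<open>c\<close> of \<open>h\<close> along the flow of \<open>W\<close> should give a geodesic of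
  \<open>F\<close>. Its velocity is \<open>y = u + W\<close>, where \<open>u\<close> is the
  transported velocity of \<open>c\<close>, and its covariant acceleration is \<open>2 S u\<close>,
  which is \<open>2 S y\<close> because \<open>S W = 0\<close>. No flow is constructed: the
  predicted spray is checked against the linear system behind the spray coefficients, whose solution
  is unique because the fundamental tensor is positive definite. The delicate point is that the
  Einstein condition gives the Ricci tensor only on pairs \<open>(y, y)\<close>, while the
  divergence of \<open>S\<close> calls for its value on \<open>(y, W)\<close>. Polarization
  therefore requires the symmetry of a trace formula that is not symmetric in appearance.\<close>

lemma frechet_derivative_eq:
  "(f has_derivative f') (at x) \<Longrightarrow> frechet_derivative f (at x) = f'"
  by (metis frechet_derivative_at)

lemma has_derivative_frechet:
  "f differentiable (at x) \<Longrightarrow> (f has_derivative frechet_derivative f (at x)) (at x)"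
  by (simp add: frechet_derivative_works)

text \<open>The derivatives in \<open>Ck\<close> are taken in the whole space, so it is agreement on
  an open set that carries over to all orders.\<close>

lemma Ck_cong:
  assumes "open S" "\<And>x. x \<in> S \<Longrightarrow> f x = g x" "Ck k S f"
  shows "Ck k S g"
  using assms(2,3)
proof (induction k arbitrary: f g)
  case 0
  then show ?case using continuous_on_cong by (metis Ck.simps(1))
next
  case (Suc k)
  have d: "f differentiable (at x)" if "x \<in> S" for x using Suc.prems that by simp
  have fd: "frechet_derivative f (at x) = frechet_derivative g (at x)" if "x \<in> S" for x
    by (rule frechet_derivative_transform_within_open[OF d[OF that] \<open>open S\<close> that]) (rule Suc.prems)
  have "g differentiable (at x)" if "x \<in> S" for x
    using d[OF that] assms(1) that Suc.prems(1)
    by (meson differentiable_def has_derivative_transform_within_open)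
  moreover have "Ck k S (\<lambda>x. frechet_derivative g (at x) v)" for v
    by (rule Suc.IH[of "\<lambda>x. frechet_derivative f (at x) v"]) (use fd Suc.prems in auto)
  ultimately show ?case by simp
qed

lemma Ck_Suc_imp: "Ck (Suc k) S f \<Longrightarrow> Ck k S f"
proof (induction k arbitrary: f)
  case 0
  then show ?case
    by (simp add: continuous_at_imp_continuous_on differentiable_imp_continuous_within)
next
  case (Suc k)
  then show ?case by (metis Ck.simps(2))
qed

text \<open>Lets the derivative be supplied as a formula; the closure rules below are inductions on
  \<open>k\<close> through this rule.\<close>

lemma Ck_SucI:
  assumes "open S" "\<And>x. x \<in> S \<Longrightarrow> (f has_derivative f' x) (at x)"
    and "\<And>v. Ck k S (\<lambda>x. f' x v)"
  shows "Ck (Suc k) S f"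
proof -
  have "frechet_derivative f (at x) = f' x" if "x \<in> S" for x
    using assms(2)[OF that] frechet_derivative_eq by blast
  then have "Ck k S (\<lambda>x. frechet_derivative f (at x) v)" for v
    by (intro Ck_cong[OF assms(1) _ assms(3)[of v]]) auto
  then show ?thesis using assms(2) by (auto simp: differentiable_def)
qed

lemma Ck_Suc_has_derivative:
  "Ck (Suc k) S f \<Longrightarrow> x \<in> S \<Longrightarrow> (f has_derivative frechet_derivative f (at x)) (at x)"
  by (simp add: has_derivative_frechet)

lemma Ck_const: "open S \<Longrightarrow> Ck k S (\<lambda>_. c)"
  by (induction k arbitrary: c) auto

lemma Ck_bounded_linear:
  assumes "open S" "bounded_linear L" "Ck k S f"
  shows "Ck k S (\<lambda>x. L (f x))"
  using assms(3)
proof (induction k arbitrary: f)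
  case 0
  then show ?case using assms(2) by (simp add: bounded_linear.continuous_on)
next
  case (Suc k)
  show ?case
  proof (rule Ck_SucI[OF assms(1)])
    show "((\<lambda>x. L (f x)) has_derivative (\<lambda>v. L (frechet_derivative f (at x) v))) (at x)"
      if "x \<in> S" for x
      by (rule bounded_linear.has_derivative[OF assms(2) Ck_Suc_has_derivative[OF Suc.prems that]])
  qed (use Suc in auto)
qed

lemma Ck_add:
  assumes "open S" "Ck k S f" "Ck k S g"
  shows "Ck k S (\<lambda>x. f x + g x)"
  using assms(2,3)
proof (induction k arbitrary: f g)
  case 0
  then show ?case by (simp add: continuous_on_add)
next
  case (Suc k)
  show ?case
  proof (rule Ck_SucI[OF assms(1)])
    show "((\<lambda>x. f x + g x) has_derivative
        (\<lambda>v. frechet_derivative f (at x) v + frechet_derivative g (at x) v)) (at x)"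
      if "x \<in> S" for x
      using Suc.prems that by (intro has_derivative_add Ck_Suc_has_derivative)
  qed (use Suc in auto)
qed

lemma Ck_sum:
  assumes "open S" "\<And>i. i \<in> I \<Longrightarrow> Ck k S (f i)"
  shows "Ck k S (\<lambda>x. \<Sum>i\<in>I. f i x)"
  using assms(2) by (induction I rule: infinite_finite_induct) (auto intro: Ck_const Ck_add assms(1))

lemma Ck_bilinear:
  assumes "open S" "bounded_bilinear p" "Ck k S f" "Ck k S g"
  shows "Ck k S (\<lambda>x. p (f x) (g x))"
  using assms(3,4)
proof (induction k arbitrary: f g)
  case 0
  then show ?case using assms(2) by (simp add: bounded_bilinear.continuous_on)
next
  case (Suc k)
  show ?case
  proof (rule Ck_SucI[OF assms(1)])
    show "((\<lambda>x. p (f x) (g x)) has_derivative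
        (\<lambda>v. p (f x) (frechet_derivative g (at x) v) + p (frechet_derivative f (at x) v) (g x))) (at x)"
      if "x \<in> S" for x
      by (rule bounded_bilinear.FDERIV[OF assms(2)]) (use that Suc.prems Ck_Suc_has_derivative in auto)
    show "Ck k S (\<lambda>x. p (f x) (frechet_derivative g (at x) v) + p (frechet_derivative f (at x) v) (g x))" for v
      using Suc.prems Ck_Suc_imp[OF Suc.prems(1)] Ck_Suc_imp[OF Suc.prems(2)]
      by (intro Ck_add Suc.IH assms(1)) auto
  qed
qed

lemmas Ck_mult = Ck_bilinear[OF _ bounded_bilinear_mult]

text \<open>The derivative is a product of \<open>inverse (f x)\<close> and a derivative of
  \<open>f\<close>, both available at the lower order, so the induction closes.\<close>

lemma Ck_inverse:
  fixes f :: "'a::euclidean_space \<Rightarrow> real"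
  assumes "open S" "Ck k S f" "\<And>x. x \<in> S \<Longrightarrow> f x \<noteq> 0"
  shows "Ck k S (\<lambda>x. inverse (f x))"
  using assms(2)
proof (induction k)
  case 0
  then show ?case using assms(3) by (simp add: continuous_on_inverse)
next
  case (Suc k)
  show ?case
  proof (rule Ck_SucI[OF assms(1)])
    show "((\<lambda>x. inverse (f x)) has_derivative
        (\<lambda>v. (-1) * (inverse (f x) * frechet_derivative f (at x) v * inverse (f x)))) (at x)"
      if "x \<in> S" for x
      using Deriv.has_derivative_inverse[OF assms(3)[OF that] Ck_Suc_has_derivative[OF Suc.prems that]] by simp
    show "Ck k S (\<lambda>x. (-1) * (inverse (f x) * frechet_derivative f (at x) v * inverse (f x)))" for v
      using Suc.prems Suc.IH[OF Ck_Suc_imp[OF Suc.prems]] by (intro Ck_mult Ck_const assms(1)) auto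
  qed
qed

text \<open>Affine substitutions cover the uses made here: coordinate projections, and freezing one
  factor of the group multiplication. Their derivative \<open>L\<close> is constant, which keeps the
  induction within the same form.\<close>

lemma Ck_affine_compose:
  fixes f :: "'b::euclidean_space \<Rightarrow> 'c::real_normed_vector" and L :: "'a::euclidean_space \<Rightarrow> 'b"
  assumes "open S" "open T" "bounded_linear L" "\<And>x. x \<in> T \<Longrightarrow> a + L x \<in> S" "Ck k S f"
  shows "Ck k T (\<lambda>x. f (a + L x))"
  using assms(5)
proof (induction k arbitrary: f)
  case 0
  have "continuous_on T (\<lambda>x. a + L x)"
    by (intro continuous_on_add continuous_on_const bounded_linear.continuous_on[OF assms(3)] continuous_on_id)
  then show ?case using 0 assms(4)
    by (simp add: continuous_on_compose2[of S f T "\<lambda>x. a + L x"] image_subset_iff)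
next
  case (Suc k)
  show ?case
  proof (rule Ck_SucI[OF assms(2)])
    fix x assume x: "x \<in> T"
    have L: "((\<lambda>x. a + L x) has_derivative L) (at x)"
      using has_derivative_add[OF has_derivative_const bounded_linear_imp_has_derivative[OF assms(3)]]
      by simp
    show "((\<lambda>x. f (a + L x)) has_derivative (\<lambda>v. frechet_derivative f (at (a + L x)) (L v))) (at x)"
      using has_derivative_compose[OF L] Ck_Suc_has_derivative[OF Suc.prems assms(4)[OF x]] by blast
  next
    fix v
    show "Ck k T (\<lambda>x. frechet_derivative f (at (a + L x)) (L v))"
      using Suc.IH[of "\<lambda>x. frechet_derivative f (at x) (L v)"] Suc.prems by simp
  qed
qed

lemma smooth_onD: "smooth_on S f \<Longrightarrow> x \<in> S \<Longrightarrow> (f has_derivative frechet_derivative f (at x)) (at x)"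
  by (meson Ck_Suc_has_derivative smooth_on_def)

lemma smooth_on_differentiable: "smooth_on S f \<Longrightarrow> x \<in> S \<Longrightarrow> f differentiable (at x)"
  using smooth_onD differentiable_def by blast

lemma smooth_on_Ck: "smooth_on S f \<Longrightarrow> Ck k S f"
  by (simp add: smooth_on_def)

lemma smooth_on_deriv: "smooth_on S f \<Longrightarrow> smooth_on S (\<lambda>x. frechet_derivative f (at x) v)"
  unfolding smooth_on_def by (metis Ck.simps(2))

section \<open>Symmetry of second derivatives\<close>

text \<open>The mean value theorem along \<open>u\<close> and then along \<open>v\<close> turns the
  quotient into the mixed derivative at an intermediate point, and continuity of that derivative at
  \<open>x\<close> gives the limit. As the second difference is symmetric in \<open>u\<close> and
  \<open>v\<close>, the symmetry of second derivatives follows.\<close>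

lemma mixed_difference_tendsto:
  fixes f :: "'a::euclidean_space \<Rightarrow> real"
  assumes "open S" "x \<in> S" "Ck 2 S f"
  shows "((\<lambda>t. (f (x + t *\<^sub>R u + t *\<^sub>R v) - f (x + t *\<^sub>R u) - f (x + t *\<^sub>R v) + f x) / t\<^sup>2) \<longlongrightarrow>
    frechet_derivative (\<lambda>y. frechet_derivative f (at y) u) (at x) v) (at_right 0)"
proof -
  define D where "D y = frechet_derivative f (at y)" for y
  define E where "E y = frechet_derivative (\<lambda>y. D y u) (at y) v" for y
  have dD: "(f has_derivative D y) (at y)" if "y \<in> S" for y
    unfolding D_def using assms(3) that by (intro Ck_Suc_has_derivative[of 1]) (simp_all add: eval_nat_numeral)
  have dE: "((\<lambda>y. D y u) has_derivative frechet_derivative (\<lambda>y. D y u) (at y)) (at y)" if "y \<in> S" for y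
    unfolding D_def using assms(3) that by (intro Ck_Suc_has_derivative[of 0]) (simp_all add: eval_nat_numeral)
  have "continuous_on S E"
    unfolding D_def E_def using assms(3) by (simp add: eval_nat_numeral)
  then have E: "isCont E x" using assms continuous_on_eq_continuous_at by blast
  obtain r where r: "r > 0" "ball x r \<subseteq> S" using assms openE by blast
  \<comment> \<open>All points \<open>x + s u + t v\<close> with \<open>s\<close> and
    \<open>t\<close> in \<open>[0, a]\<close> lie within \<open>a K\<close> of \<open>x\<close>; the
    summand 1 makes \<open>K\<close> positive even if both vectors vanish.\<close>
  define K where "K = norm u + norm v + 1"
  have K: "K > 0" unfolding K_def by (smt (verit) norm_ge_zero)
  have near: "norm (s *\<^sub>R u + t *\<^sub>R v) < \<delta>"
    if "0 \<le> s" "s \<le> a" "0 \<le> t" "t \<le> a" "0 < a" "a < \<delta> / K" for s t a \<delta>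
  proof -
    have "norm (s *\<^sub>R u + t *\<^sub>R v) \<le> s * norm u + t * norm v"
      using that by (metis abs_of_nonneg norm_scaleR norm_triangle_ineq)
    also have "\<dots> \<le> a * norm u + a * norm v"
      using that by (intro add_mono mult_right_mono) auto
    also have "\<dots> < a * K" using that by (simp add: K_def algebra_simps)
    also have "\<dots> < \<delta>" using that K by (simp add: field_simps)
    finally show ?thesis .
  qed
  have inS: "x + s *\<^sub>R u + t *\<^sub>R v \<in> S"
    if "0 \<le> s" "s \<le> a" "0 \<le> t" "t \<le> a" "0 < a" "a < r / K" for s t a
    using near[OF that] r by (metis add.assoc add_diff_cancel_left' dist_norm mem_ball dist_commute subsetD)
  show ?thesis
  proof (rule tendstoI)
    fix e :: real assume "e > 0"
    with E obtain d where d: "d > 0" "\<And>y. dist y x < d \<Longrightarrow> dist (E y) (E x) < e"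
      unfolding continuous_at_eps_delta by blast
    define m where "m = min r d / K"
    have m: "m > 0" using r d K by (simp add: m_def)
    have "dist ((f (x + t *\<^sub>R u + t *\<^sub>R v) - f (x + t *\<^sub>R u) - f (x + t *\<^sub>R v) + f x) / t\<^sup>2) (E x) < e"
      if t: "0 < t" "t < m" for t
    proof -
      have tr: "t < r / K" "t < d / K" using t K by (auto simp: m_def field_simps)
      have inS': "x + s *\<^sub>R u + q *\<^sub>R v \<in> S" if "0 \<le> s" "s \<le> t" "0 \<le> q" "q \<le> t" for s q
        using inS[OF that t(1) tr(1)] .
      have inS0: "x + s *\<^sub>R u \<in> S" if "0 \<le> s" "s \<le> t" for s
        using inS'[OF that, of 0] t by simp
      have "\<exists>\<xi>>0. \<xi> < t \<and> (f (x + t *\<^sub>R u + t *\<^sub>R v) - f (x + t *\<^sub>R u)) - (f (x + 0 *\<^sub>R u + t *\<^sub>R v) - f (x + 0 *\<^sub>R u))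
         = (t - 0) * (D (x + \<xi> *\<^sub>R u + t *\<^sub>R v) u - D (x + \<xi> *\<^sub>R u) u)"
      proof (rule MVT2[OF t(1)])
        fix s assume s: "0 \<le> s" "s \<le> t"
        have "((\<lambda>s. f (x + s *\<^sub>R u + t *\<^sub>R v) - f (x + s *\<^sub>R u)) has_derivative
          (\<lambda>h. D (x + s *\<^sub>R u + t *\<^sub>R v) (h *\<^sub>R u) - D (x + s *\<^sub>R u) (h *\<^sub>R u))) (at s)"
        proof (rule has_derivative_diff)
          have "((\<lambda>s. x + s *\<^sub>R u + t *\<^sub>R v) has_derivative (\<lambda>h. h *\<^sub>R u)) (at s)"
            by (auto intro!: derivative_eq_intros)
          then show "((\<lambda>s. f (x + s *\<^sub>R u + t *\<^sub>R v)) has_derivative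
              (\<lambda>h. D (x + s *\<^sub>R u + t *\<^sub>R v) (h *\<^sub>R u))) (at s)"
            by (rule has_derivative_compose) (use dD inS' s t in auto)
          have "((\<lambda>s. x + s *\<^sub>R u) has_derivative (\<lambda>h. h *\<^sub>R u)) (at s)"
            by (auto intro!: derivative_eq_intros)
          then show "((\<lambda>s. f (x + s *\<^sub>R u)) has_derivative (\<lambda>h. D (x + s *\<^sub>R u) (h *\<^sub>R u))) (at s)"
            by (rule has_derivative_compose) (use dD inS0 s in auto)
        qed
        moreover have "D (x + s *\<^sub>R u + t *\<^sub>R v) (h *\<^sub>R u) - D (x + s *\<^sub>R u) (h *\<^sub>R u)
            = (D (x + s *\<^sub>R u + t *\<^sub>R v) u - D (x + s *\<^sub>R u) u) * h" for h
          using linear_scale[OF has_derivative_linear[OF dD]] inS' inS0 s t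
          by (simp add: algebra_simps)
        ultimately show "((\<lambda>s. f (x + s *\<^sub>R u + t *\<^sub>R v) - f (x + s *\<^sub>R u)) has_field_derivative
          (D (x + s *\<^sub>R u + t *\<^sub>R v) u - D (x + s *\<^sub>R u) u)) (at s)"
          by (simp add: has_field_derivative_def)
      qed
      then obtain \<xi> where xi: "0 < \<xi>" "\<xi> < t"
        and 1: "f (x + t *\<^sub>R u + t *\<^sub>R v) - f (x + t *\<^sub>R u) - f (x + t *\<^sub>R v) + f x
         = t * (D (x + \<xi> *\<^sub>R u + t *\<^sub>R v) u - D (x + \<xi> *\<^sub>R u) u)" by auto
      have "\<exists>\<eta>>0. \<eta> < t \<and> D (x + \<xi> *\<^sub>R u + t *\<^sub>R v) u - D (x + \<xi> *\<^sub>R u + 0 *\<^sub>R v) u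
         = (t - 0) * E (x + \<xi> *\<^sub>R u + \<eta> *\<^sub>R v)"
      proof (rule MVT2[OF t(1)])
        fix s assume s: "0 \<le> s" "s \<le> t"
        have *: "x + \<xi> *\<^sub>R u + s *\<^sub>R v \<in> S" using s xi inS' by auto
        have "((\<lambda>s. D (x + \<xi> *\<^sub>R u + s *\<^sub>R v) u) has_derivative
          (\<lambda>h. frechet_derivative (\<lambda>y. D y u) (at (x + \<xi> *\<^sub>R u + s *\<^sub>R v)) (h *\<^sub>R v))) (at s)"
          by (rule has_derivative_compose[of "\<lambda>s. x + \<xi> *\<^sub>R u + s *\<^sub>R v" _ _ _ "\<lambda>y. D y u", OF _ dE[OF *]])
            (auto intro!: derivative_eq_intros)
        moreover have "frechet_derivative (\<lambda>y. D y u) (at (x + \<xi> *\<^sub>R u + s *\<^sub>R v)) (h *\<^sub>R v)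
          = E (x + \<xi> *\<^sub>R u + s *\<^sub>R v) * h" for h
          using linear_scale[OF has_derivative_linear[OF dE[OF *]]] by (simp add: E_def)
        ultimately show "((\<lambda>s. D (x + \<xi> *\<^sub>R u + s *\<^sub>R v) u) has_field_derivative
            E (x + \<xi> *\<^sub>R u + s *\<^sub>R v)) (at s)"
          by (simp add: has_field_derivative_def)
      qed
      then obtain \<eta> where eta: "0 < \<eta>" "\<eta> < t"
        and 2: "D (x + \<xi> *\<^sub>R u + t *\<^sub>R v) u - D (x + \<xi> *\<^sub>R u) u = t * E (x + \<xi> *\<^sub>R u + \<eta> *\<^sub>R v)" by auto
      have "(f (x + t *\<^sub>R u + t *\<^sub>R v) - f (x + t *\<^sub>R u) - f (x + t *\<^sub>R v) + f x) / t\<^sup>2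
        = E (x + \<xi> *\<^sub>R u + \<eta> *\<^sub>R v)"
        using 1 2 t by (simp add: power2_eq_square)
      moreover have "dist (x + \<xi> *\<^sub>R u + \<eta> *\<^sub>R v) x < d"
        using near[of \<xi> t \<eta> d] xi eta t tr by (simp add: dist_norm add.assoc)
      ultimately show ?thesis using d by simp
    qed
    then have "\<forall>\<^sub>F t in at_right 0. dist ((f (x + t *\<^sub>R u + t *\<^sub>R v) - f (x + t *\<^sub>R u)
        - f (x + t *\<^sub>R v) + f x) / t\<^sup>2) (E x) < e"
      using m by (auto simp: eventually_at_right_field)
    then show "\<forall>\<^sub>F t in at_right 0. dist ((f (x + t *\<^sub>R u + t *\<^sub>R v) - f (x + t *\<^sub>R u)
        - f (x + t *\<^sub>R v) + f x) / t\<^sup>2)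
        (frechet_derivative (\<lambda>y. frechet_derivative f (at y) u) (at x) v) < e"
      by (simp add: E_def D_def)
  qed
qed

lemma second_derivative_symmetric_real:
  fixes f :: "'a::euclidean_space \<Rightarrow> real"
  assumes "open S" "x \<in> S" "Ck 2 S f"
  shows "frechet_derivative (\<lambda>y. frechet_derivative f (at y) u) (at x) v
       = frechet_derivative (\<lambda>y. frechet_derivative f (at y) v) (at x) u"
proof -
  have "((\<lambda>t. (f (x + t *\<^sub>R u + t *\<^sub>R v) - f (x + t *\<^sub>R u) - f (x + t *\<^sub>R v) + f x) / t\<^sup>2) \<longlongrightarrow>
    frechet_derivative (\<lambda>y. frechet_derivative f (at y) v) (at x) u) (at_right 0)"
    using mixed_difference_tendsto[OF assms, of v u] by (simp add: algebra_simps)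
  with mixed_difference_tendsto[OF assms, of u v] show ?thesis
    using tendsto_unique trivial_limit_at_right_real by blast
qed

lemma second_derivative_symmetric:
  fixes f :: "'a::euclidean_space \<Rightarrow> 'b::euclidean_space"
  assumes "open S" "x \<in> S" "Ck 2 S f"
  shows "frechet_derivative (\<lambda>y. frechet_derivative f (at y) u) (at x) v
       = frechet_derivative (\<lambda>y. frechet_derivative f (at y) v) (at x) u"
proof (rule euclidean_eqI)
  fix b :: 'b
  have Ck1: "Ck (Suc (Suc 0)) S f" using assms(3) by (simp add: eval_nat_numeral)
  have g: "frechet_derivative (\<lambda>y. f y \<bullet> b) (at y) w = frechet_derivative f (at y) w \<bullet> b" if "y \<in> S" for y w
    using has_derivative_inner_left[OF Ck_Suc_has_derivative[OF Ck1 that], of b]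
    by (metis frechet_derivative_eq)
  have gg: "frechet_derivative (\<lambda>y. frechet_derivative (\<lambda>y. f y \<bullet> b) (at y) w) (at x) w'
    = frechet_derivative (\<lambda>y. frechet_derivative f (at y) w) (at x) w' \<bullet> b" for w w'
  proof -
    have "((\<lambda>y. frechet_derivative f (at y) w) has_derivative
        frechet_derivative (\<lambda>y. frechet_derivative f (at y) w) (at x)) (at x)"
      using Ck1 assms(2) by (intro Ck_Suc_has_derivative[of 0]) auto
    then have "((\<lambda>y. frechet_derivative f (at y) w \<bullet> b) has_derivative
       (\<lambda>w'. frechet_derivative (\<lambda>y. frechet_derivative f (at y) w) (at x) w' \<bullet> b)) (at x)"
      by (rule has_derivative_inner_left)
    then have "((\<lambda>y. frechet_derivative (\<lambda>y. f y \<bullet> b) (at y) w) has_derivative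
       (\<lambda>w'. frechet_derivative (\<lambda>y. frechet_derivative f (at y) w) (at x) w' \<bullet> b)) (at x)"
      by (rule has_derivative_transform_within_open[OF _ assms(1,2)]) (simp add: g)
    then show ?thesis by (metis frechet_derivative_eq)
  qed
  have "Ck 2 S (\<lambda>y. f y \<bullet> b)"
    by (rule Ck_bounded_linear[OF assms(1) bounded_linear_inner_left assms(3)])
  from second_derivative_symmetric_real[OF assms(1,2) this, of u v]
  show "frechet_derivative (\<lambda>y. frechet_derivative f (at y) u) (at x) v \<bullet> b
    = frechet_derivative (\<lambda>y. frechet_derivative f (at y) v) (at x) u \<bullet> b"
    by (simp add: gg)
qed

section \<open>Differentiating families of bilinear maps\<close>

lemma bilinear_expand:
  fixes B :: "'e::euclidean_space \<Rightarrow> 'f::euclidean_space \<Rightarrow> 'b::real_normed_vector"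
  assumes "bilinear B"
  shows "B u v = (\<Sum>i\<in>Basis. \<Sum>j\<in>Basis. ((u \<bullet> i) * (v \<bullet> j)) *\<^sub>R B i j)"
proof -
  have "B u v = B (\<Sum>i\<in>Basis. (u \<bullet> i) *\<^sub>R i) (\<Sum>j\<in>Basis. (v \<bullet> j) *\<^sub>R j)"
    by (simp add: euclidean_representation)
  also have "\<dots> = (\<Sum>i\<in>Basis. \<Sum>j\<in>Basis. ((u \<bullet> i) * (v \<bullet> j)) *\<^sub>R B i j)"
    by (simp add: bilinear_sum[OF assms] sum.cartesian_product bilinear_lmul[OF assms]
        bilinear_rmul[OF assms] mult_ac)
  finally show ?thesis .
qed

text \<open>Treats together the metric, the Christoffel map and, with a dummy scalar argument, the
  endomorphism \<open>S\<close>. Differentiability is required for fixed vectors only; finite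
  dimension upgrades it to joint differentiability.\<close>

locale bilinear_family =
  fixes U :: "'x::euclidean_space set"
    and B :: "'x \<Rightarrow> 'e::euclidean_space \<Rightarrow> 'f::euclidean_space \<Rightarrow> 'b::real_normed_vector"
  assumes open_U: "open U"
    and bil: "\<And>x. x \<in> U \<Longrightarrow> bilinear (B x)"
    and diff: "\<And>x u v. x \<in> U \<Longrightarrow> (\<lambda>x. B x u v) differentiable (at x)"
begin

definition DB where "DB x a u v = frechet_derivative (\<lambda>x. B x u v) (at x) a"

lemma has_derivative_DB: "x \<in> U \<Longrightarrow> ((\<lambda>x. B x u v) has_derivative (\<lambda>a. DB x a u v)) (at x)"
  unfolding DB_def using diff has_derivative_frechet by blast

lemma DB_eqI: "((\<lambda>x. B x u v) has_derivative f') (at x) \<Longrightarrow> DB x a u v = f' a"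
  unfolding DB_def by (metis frechet_derivative_at)

lemma DB_linear: "x \<in> U \<Longrightarrow> linear (\<lambda>a. DB x a u v)"
  using has_derivative_DB has_derivative_linear by blast

lemma DB_expand:
  assumes "x \<in> U"
  shows "DB x a u v = (\<Sum>i\<in>Basis. \<Sum>j\<in>Basis. ((u \<bullet> i) * (v \<bullet> j)) *\<^sub>R DB x a i j)"
proof (rule DB_eqI)
  have "((\<lambda>x. \<Sum>i\<in>Basis. \<Sum>j\<in>Basis. ((u \<bullet> i) * (v \<bullet> j)) *\<^sub>R B x i j) has_derivative
    (\<lambda>a. \<Sum>i\<in>Basis. \<Sum>j\<in>Basis. ((u \<bullet> i) * (v \<bullet> j)) *\<^sub>R DB x a i j)) (at x)"
    by (intro has_derivative_sum has_derivative_scaleR_right has_derivative_DB assms)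
  then show "((\<lambda>x. B x u v) has_derivative
    (\<lambda>a. \<Sum>i\<in>Basis. \<Sum>j\<in>Basis. ((u \<bullet> i) * (v \<bullet> j)) *\<^sub>R DB x a i j)) (at x)"
    by (rule has_derivative_transform_within_open[OF _ open_U assms]) (rule bilinear_expand[OF bil, symmetric])
qed

lemma DB_bilinear:
  assumes "x \<in> U"
  shows "bilinear (DB x a)"
  unfolding bilinear_def
proof (intro conjI allI linearI)
  fix u u' v v' and c :: real
  note tr = has_derivative_transform_within_open[OF _ open_U assms]
  show "DB x a u (v + v') = DB x a u v + DB x a u v'"
    by (rule DB_eqI, rule tr, rule has_derivative_add[OF has_derivative_DB[OF assms] has_derivative_DB[OF assms]])
      (metis bil bilinear_radd)
  show "DB x a (u + u') v = DB x a u v + DB x a u' v"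
    by (rule DB_eqI, rule tr, rule has_derivative_add[OF has_derivative_DB[OF assms] has_derivative_DB[OF assms]])
      (metis bil bilinear_ladd)
  show "DB x a u (c *\<^sub>R v) = c *\<^sub>R DB x a u v"
    by (rule DB_eqI, rule tr, rule has_derivative_scaleR_right[OF has_derivative_DB[OF assms]])
      (metis bil bilinear_rmul)
  show "DB x a (c *\<^sub>R u) v = c *\<^sub>R DB x a u v"
    by (rule DB_eqI, rule tr, rule has_derivative_scaleR_right[OF has_derivative_DB[OF assms]])
      (metis bil bilinear_lmul)
qed

text \<open>Expanding in a basis leaves a finite sum of scalar coefficients times functions of the
  base point, to which the ordinary product and chain rules apply.\<close>

lemma has_derivative_family:
  fixes t :: "'t::real_normed_vector"
  assumes "(X has_derivative X') (at t)" "(u has_derivative u') (at t)" "(v has_derivative v') (at t)"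
    and "X t \<in> U"
  shows "((\<lambda>t. B (X t) (u t) (v t)) has_derivative
    (\<lambda>d. DB (X t) (X' d) (u t) (v t) + B (X t) (u' d) (v t) + B (X t) (u t) (v' d))) (at t)"
proof -
  have "((\<lambda>t. \<Sum>i\<in>Basis. \<Sum>j\<in>Basis. ((u t \<bullet> i) * (v t \<bullet> j)) *\<^sub>R B (X t) i j) has_derivative
    (\<lambda>d. \<Sum>i\<in>Basis. \<Sum>j\<in>Basis. ((u t \<bullet> i) * (v t \<bullet> j)) *\<^sub>R DB (X t) (X' d) i j
      + ((u t \<bullet> i) * (v' d \<bullet> j) + (u' d \<bullet> i) * (v t \<bullet> j)) *\<^sub>R B (X t) i j)) (at t)"
    by (intro has_derivative_sum has_derivative_scaleR has_derivative_mult has_derivative_inner_left assms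
        has_derivative_compose[OF assms(1) has_derivative_DB])
  moreover have "(\<Sum>i\<in>Basis. \<Sum>j\<in>Basis. ((u t \<bullet> i) * (v t \<bullet> j)) *\<^sub>R DB (X t) (X' d) i j
      + ((u t \<bullet> i) * (v' d \<bullet> j) + (u' d \<bullet> i) * (v t \<bullet> j)) *\<^sub>R B (X t) i j)
    = DB (X t) (X' d) (u t) (v t) + B (X t) (u' d) (v t) + B (X t) (u t) (v' d)" for d
    unfolding scaleR_add_left sum.distrib DB_expand[OF assms(4), symmetric]
      bilinear_expand[OF bil[OF assms(4)], symmetric] by simp
  ultimately have deriv: "((\<lambda>t. \<Sum>i\<in>Basis. \<Sum>j\<in>Basis. ((u t \<bullet> i) * (v t \<bullet> j)) *\<^sub>R B (X t) i j) has_derivative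
    (\<lambda>d. DB (X t) (X' d) (u t) (v t) + B (X t) (u' d) (v t) + B (X t) (u t) (v' d))) (at t)"
    by simp
  \<comment> \<open>\<open>X\<close> is differentiable at \<open>t\<close> only, so the preimage of
    \<open>U\<close> need not be open; the basis expansion is therefore compared with
    \<open>B\<close> eventually near \<open>t\<close>.\<close>
  have "\<forall>\<^sub>F s in at t. X s \<in> U"
    using has_derivative_continuous[OF assms(1)] open_U assms(4) unfolding continuous_within
    by (rule topological_tendstoD)
  then have "\<forall>\<^sub>F s in at t. (\<Sum>i\<in>Basis. \<Sum>j\<in>Basis. ((u s \<bullet> i) * (v s \<bullet> j)) *\<^sub>R B (X s) i j)
      = B (X s) (u s) (v s)"
    by eventually_elim (rule bilinear_expand[OF bil, symmetric])
  then show ?thesis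
    by (rule has_derivative_transform_eventually[OF deriv])
      (use bilinear_expand[OF bil[OF assms(4)], symmetric] in auto)
qed

end

section \<open>Traces and matrices\<close>

definition tr :: "(real ^ 'n \<Rightarrow> real ^ 'n::finite) \<Rightarrow> real" where
  "tr T = (\<Sum>i\<in>UNIV. T (axis i 1) $ i)"

lemma tr_add: "tr (\<lambda>v. f v + g v) = tr f + tr g"
  by (simp add: tr_def sum.distrib)

lemma tr_diff: "tr (\<lambda>v. f v - g v) = tr f - tr g"
  by (simp add: tr_def sum_subtractf)

lemma tr_minus: "tr (\<lambda>v. - f v) = - tr f"
  by (simp add: tr_def sum_negf)

lemma tr_scaleR: "tr (\<lambda>v. c *\<^sub>R f v) = c * tr f"
  by (simp add: tr_def sum_distrib_left)

lemma linear_axis_expand: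
  fixes f :: "real ^ 'n::finite \<Rightarrow> 'b::real_vector"
  assumes "linear f"
  shows "f v = (\<Sum>i\<in>UNIV. v $ i *\<^sub>R f (axis i 1))"
proof -
  have "f v = f (\<Sum>i\<in>UNIV. v $ i *s axis i 1)" by (simp only: basis_expansion)
  also have "\<dots> = (\<Sum>i\<in>UNIV. v $ i *\<^sub>R f (axis i 1))"
    using assms by (simp add: linear_sum linear_scale scalar_mult_eq_scaleR)
  finally show ?thesis .
qed

lemma tr_comp_commute:
  fixes f g :: "real ^ 'n::finite \<Rightarrow> real ^ 'n"
  assumes "linear f" "linear g"
  shows "tr (\<lambda>v. f (g v)) = tr (\<lambda>v. g (f v))"
proof -
  have *: "tr (\<lambda>v. f (g v)) = (\<Sum>i\<in>UNIV. \<Sum>j\<in>UNIV. g (axis i 1) $ j * f (axis j 1) $ i)"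
    if "linear f" for f g :: "real ^ 'n \<Rightarrow> real ^ 'n"
    unfolding tr_def by (subst linear_axis_expand[OF that]) simp
  show ?thesis unfolding *[OF assms(1)] *[OF assms(2)]
    by (subst sum.swap) (simp add: mult.commute)
qed

lemma tr_rank_one:
  assumes "linear \<phi>"
  shows "tr (\<lambda>v. \<phi> v *\<^sub>R a) = \<phi> a"
  by (subst linear_axis_expand[OF assms, of a]) (simp add: tr_def mult.commute)

lemma has_derivative_tr:
  assumes "\<And>v. ((\<lambda>t. T t v) has_derivative T' v) (at t)"
  shows "((\<lambda>t. tr (T t)) has_derivative (\<lambda>d. tr (\<lambda>v. T' v d))) (at t)"
  unfolding tr_def
  by (intro has_derivative_sum bounded_linear.has_derivative[OF bounded_linear_vec_nth] assms)

lemma det_differentiable: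
  fixes M :: "'x::real_normed_vector \<Rightarrow> real ^ 'n ^ 'n::finite"
  assumes "\<And>i j. (\<lambda>x. M x $ i $ j) differentiable (at x)"
  shows "(\<lambda>x. det (M x)) differentiable (at x)"
proof -
  have "\<forall>i j. \<exists>D. ((\<lambda>x. M x $ i $ j) has_derivative D) (at x)"
    using assms unfolding differentiable_def by blast
  then obtain D where D: "\<And>i j. ((\<lambda>x. M x $ i $ j) has_derivative D i j) (at x)" by metis
  have "((\<lambda>x. det (M x)) has_derivative (\<lambda>d. \<Sum>p | p permutes UNIV. of_int (sign p) *
      (\<Sum>i\<in>UNIV. D i (p i) d * (\<Prod>j\<in>UNIV - {i}. M x $ j $ p j)))) (at x)"
    unfolding det_def
    by (intro has_derivative_sum has_derivative_mult_right has_derivative_prod D)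
  then show ?thesis unfolding differentiable_def by blast
qed

text \<open>Cramer's rule writes the solution as a quotient of determinants. This yields
  differentiability of the Christoffel symbols without differentiating a matrix inverse.\<close>

lemma solve_differentiable:
  fixes M :: "'x::real_normed_vector \<Rightarrow> real ^ 'n ^ 'n::finite"
  assumes "open U" "x \<in> U"
    and "\<And>i j. (\<lambda>x. M x $ i $ j) differentiable (at x)" "\<And>i. (\<lambda>x. c x $ i) differentiable (at x)"
    and "\<And>x. x \<in> U \<Longrightarrow> det (M x) \<noteq> 0" "\<And>x. x \<in> U \<Longrightarrow> M x *v s x = c x"
  shows "s differentiable (at x)"
proof -
  define e where "e k y = det (\<chi> i j. if j = k then c y $ i else M y $ i $ j) / det (M y)" for k y
  have eq: "s y = (\<chi> k. e k y)" if "y \<in> U" for y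
    using cramer[OF assms(5)[OF that]] assms(6)[OF that] unfolding e_def by blast
  have "e k differentiable (at x)" for k
    unfolding e_def
  proof (rule differentiable_divide)
    show "(\<lambda>y. det (\<chi> i j. if j = k then c y $ i else M y $ i $ j)) differentiable (at x)"
    proof (rule det_differentiable)
      show "(\<lambda>y. (\<chi> i j. if j = k then c y $ i else M y $ i $ j) $ i $ j) differentiable (at x)" for i j
        using assms(3)[of i j] assms(4)[of i] by (cases "j = k") simp_all
    qed
    show "(\<lambda>y. det (M y)) differentiable (at x)" by (rule det_differentiable) (rule assms(3))
    show "det (M x) \<noteq> 0" using assms by blast
  qed
  then have D: "(e k has_derivative frechet_derivative (e k) (at x)) (at x)" for k
    by (rule has_derivative_frechet)
  have "((\<lambda>y. (\<chi> k. e k y)) has_derivative (\<lambda>d. \<chi> k. frechet_derivative (e k) (at x) d)) (at x)"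
    using D by (subst has_derivative_componentwise_within) (auto simp: Basis_vec_def inner_axis)
  then have "(s has_derivative (\<lambda>d. \<chi> k. frechet_derivative (e k) (at x) d)) (at x)"
    by (rule has_derivative_transform_within_open[OF _ assms(1,2)]) (simp add: eq)
  then show ?thesis unfolding differentiable_def by blast
qed

lemma pos_def_imp_det_nonzero:
  fixes g :: "real ^ 'n ^ 'n::finite"
  assumes "\<And>u. u \<noteq> 0 \<Longrightarrow> u \<bullet> (g *v u) > 0"
  shows "det g \<noteq> 0"
proof -
  have "g *v u = 0 \<Longrightarrow> u = 0" for u using assms[of u] by (metis inner_zero_right less_irrefl)
  then have "invertible g"
    using matrix_left_invertible_ker invertible_left_inverse by metis
  then show ?thesis using invertible_det_nz by blast
qed

lemma matrix_inv_inverse: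
  fixes g :: "real ^ 'n ^ 'n::finite"
  assumes "invertible g"
  shows "matrix_inv g ** g = mat 1" "g ** matrix_inv g = mat 1"
proof -
  have "\<exists>g'. g ** g' = mat 1 \<and> g' ** g = mat 1" using assms by (simp add: invertible_def)
  then have "g ** matrix_inv g = mat 1 \<and> matrix_inv g ** g = mat 1"
    unfolding matrix_inv_def by (rule someI_ex)
  then show "matrix_inv g ** g = mat 1" "g ** matrix_inv g = mat 1" by auto
qed

section \<open>Sprays and Ricci curvature from derivatives\<close>

lemma dx_eq: "(f has_derivative f') (at z) \<Longrightarrow> dx i f z = f' (axis i 1, 0)"
  by (simp add: dx_def frechet_derivative_eq)

lemma dy_eq: "(f has_derivative f') (at z) \<Longrightarrow> dy i f z = f' (0, axis i 1)"
  by (simp add: dy_def frechet_derivative_eq)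

text \<open>\<open>L\<close> plays the role of the energy \<open>F\<^sup>2\<close>. The spray
  involves its first derivatives and those second derivatives that have a vertical direction, which
  is why \<open>M\<close> differentiates \<open>L'\<close> along \<open>(0, v)\<close> only. The
  instances are the Riemannian and the Kropina energy.\<close>

locale energy_derivatives =
  fixes \<Omega> :: "((real ^ 'n::finite) \<times> (real ^ 'n)) set"
    and L :: "(real ^ 'n) \<times> (real ^ 'n) \<Rightarrow> real"
    and L' :: "(real ^ 'n) \<times> (real ^ 'n) \<Rightarrow> (real ^ 'n) \<times> (real ^ 'n) \<Rightarrow> real"
    and M :: "(real ^ 'n) \<times> (real ^ 'n) \<Rightarrow> real ^ 'n \<Rightarrow> (real ^ 'n) \<times> (real ^ 'n) \<Rightarrow> real"
  assumes open_\<Omega>: "open \<Omega>"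
    and L': "\<And>w. w \<in> \<Omega> \<Longrightarrow> (L has_derivative L' w) (at w)"
    and M: "\<And>w v. w \<in> \<Omega> \<Longrightarrow> ((\<lambda>w. L' w (0, v)) has_derivative M w v) (at w)"
begin

text \<open>Linearity of \<open>M\<close> in \<open>v\<close> is inherited from \<open>L' w\<close>
  by uniqueness of derivatives.\<close>

lemma M_expand:
  assumes "w \<in> \<Omega>"
  shows "M w v d = (\<Sum>j\<in>UNIV. v $ j * M w (axis j 1) d)"
proof -
  have lin: "linear (\<lambda>v. L' w (0, v))" if "w \<in> \<Omega>" for w
  proof -
    have "linear (L' w)" using has_derivative_linear[OF L'[OF that]] .
    then show ?thesis by (simp add: linear_iff) (metis add.right_neutral add_Pair scaleR_Pair scaleR_zero_right)
  qed
  have "((\<lambda>w. \<Sum>j\<in>UNIV. v $ j * L' w (0, axis j 1)) has_derivative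
      (\<lambda>d. \<Sum>j\<in>UNIV. v $ j * M w (axis j 1) d)) (at w)"
    by (intro has_derivative_sum has_derivative_mult_right M assms)
  then have "((\<lambda>w. L' w (0, v)) has_derivative (\<lambda>d. \<Sum>j\<in>UNIV. v $ j * M w (axis j 1) d)) (at w)"
    by (rule has_derivative_transform_within_open[OF _ open_\<Omega> assms])
      (use linear_axis_expand[OF lin] in simp)
  from has_derivative_unique[OF M[OF assms] this] show ?thesis by metis
qed

lemma M_linear: "w \<in> \<Omega> \<Longrightarrow> linear (M w v)"
  by (rule has_derivative_linear[OF M])

context
  fixes F :: "(real ^ 'n) \<times> (real ^ 'n) \<Rightarrow> real" and z :: "(real ^ 'n) \<times> (real ^ 'n)"
  assumes F: "\<And>w. w \<in> \<Omega> \<Longrightarrow> (F w)\<^sup>2 = L w" and z: "z \<in> \<Omega>"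
begin

lemma has_derivative_F2: "w \<in> \<Omega> \<Longrightarrow> ((\<lambda>w. (F w)\<^sup>2) has_derivative L' w) (at w)"
  by (rule has_derivative_transform_within_open[OF L' open_\<Omega>]) (auto simp: F)

lemma has_derivative_dy_F2: "(dy l (\<lambda>w. (F w)\<^sup>2) has_derivative M z (axis l 1)) (at z)"
  by (rule has_derivative_transform_within_open[OF M[OF z] open_\<Omega> z])
    (simp add: dy_eq[OF has_derivative_F2])

lemma fundamental_tensor_eq: "fundamental_tensor F z = (\<chi> i j. 1/2 * M z (axis j 1) (0, axis i 1))"
  unfolding fundamental_tensor_def by (simp add: dy_eq[OF has_derivative_dy_F2])

lemma fundamental_tensor_inner: "u \<bullet> (fundamental_tensor F z *v v) = 1/2 * M z v (0, u)"
proof -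
  have lin: "linear (\<lambda>u. M z v (0, u))" for v
    using M_linear[OF z, of v] by (simp add: linear_iff) (metis add.right_neutral add_Pair scaleR_Pair scaleR_zero_right)
  have "M z v (0, u) = (\<Sum>i\<in>UNIV. u $ i * M z v (0, axis i 1))"
    using linear_axis_expand[OF lin, of v u] by simp
  also have "\<dots> = (\<Sum>i\<in>UNIV. u $ i * (\<Sum>j\<in>UNIV. v $ j * M z (axis j 1) (0, axis i 1)))"
    by (simp add: M_expand[OF z, of v])
  finally show ?thesis
    by (simp add: fundamental_tensor_eq inner_vec_def matrix_vector_mult_def sum_distrib_left mult_ac)
qed

text \<open>Replaces the inverse of the fundamental tensor \<open>g\<close> by a test on a candidate
  \<open>V\<close>: assumption \<open>V\<close> is the Euler-Lagrange system paired with an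
  arbitrary \<open>v\<close>, and positivity makes \<open>g\<close> invertible.\<close>

lemma spray_coeff_eqI:
  assumes pos: "\<And>u. u \<noteq> 0 \<Longrightarrow> M z u (0, u) > 0"
    and V: "\<And>v. 2 * M z v (0, V) = M z v (snd z, 0) - L' z (v, 0)"
    and sym: "\<And>u v. M z u (0, v) = M z v (0, u)"
  shows "spray_coeff F i z = V $ i"
proof -
  let ?g = "fundamental_tensor F z"
  define r :: "real ^ 'n" where "r = (\<chi> l. (\<Sum>k\<in>UNIV. dx k (dy l (\<lambda>w. (F w)\<^sup>2)) z * snd z $ k) - dx l (\<lambda>w. (F w)\<^sup>2) z)"
  have "det ?g \<noteq> 0"
    by (rule pos_def_imp_det_nonzero) (use pos in \<open>auto simp: fundamental_tensor_inner\<close>)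
  then have inv: "invertible ?g" using invertible_det_nz by blast
  have lin: "linear (\<lambda>y. M z v (y, 0))" for v
    using M_linear[OF z, of v] by (simp add: linear_iff) (metis add.right_neutral add_Pair scaleR_Pair scaleR_zero_right)
  \<comment> \<open>\<open>M\<close> is twice the fundamental tensor and assumption \<open>V\<close>
    carries another factor 2; the resulting 4 cancels the 1/4 in \<open>spray_coeff\<close>.\<close>
  have "r $ l = 4 * (?g *v V) $ l" for l
  proof -
    have "(\<Sum>k\<in>UNIV. dx k (dy l (\<lambda>w. (F w)\<^sup>2)) z * snd z $ k) = M z (axis l 1) (snd z, 0)"
      using linear_axis_expand[OF lin, of "axis l 1" "snd z"]
      by (simp add: dx_eq[OF has_derivative_dy_F2] mult.commute)
    then have "r $ l = M z (axis l 1) (snd z, 0) - L' z (axis l 1, 0)"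
      by (simp add: r_def dx_eq[OF has_derivative_F2[OF z]])
    also have "\<dots> = 2 * M z (axis l 1) (0, V)" using V by simp
    also have "\<dots> = 4 * (axis l 1 \<bullet> (?g *v V))"
      using sym by (simp add: fundamental_tensor_inner)
    finally show ?thesis by (simp add: inner_axis' )
  qed
  then have "r = 4 *\<^sub>R (?g *v V)" by (simp add: vec_eq_iff)
  then have "matrix_inv ?g *v r = 4 *\<^sub>R V"
    using matrix_inv_inverse(1)[OF inv]
    by (simp add: matrix_vector_mult_scaleR matrix_vector_mul_assoc)
  moreover have "spray_coeff F i z = 1/4 * (matrix_inv ?g *v r) $ i"
    by (simp add: spray_coeff_def r_def matrix_vector_mult_def)
  ultimately show ?thesis by simp
qed

end

end

text \<open>In the trace of the Riemann curvature, second derivatives of the spray enter only as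
  derivatives of its fibre divergence \<open>tr (\<lambda>v. V' w (0, v))\<close>. So beyond
  differentiability a single scalar derivative \<open>T\<close> has to be computed.\<close>

lemma ricci_curvature_eqI:
  fixes z :: "(real ^ 'n::finite) \<times> (real ^ 'n)"
  assumes \<Omega>: "open \<Omega>" "z \<in> \<Omega>"
    and spray: "\<And>w i. w \<in> \<Omega> \<Longrightarrow> spray_coeff F i w = V w $ i"
    and V': "\<And>w. w \<in> \<Omega> \<Longrightarrow> (V has_derivative V' w) (at w)"
    and V'': "\<And>v. (\<lambda>w. V' w (0, v)) differentiable (at z)"
    and T: "((\<lambda>w. tr (\<lambda>v. V' w (0, v))) has_derivative T) (at z)"
  shows "ricci_curvature F z = 2 * tr (\<lambda>v. V' z (v, 0)) - T (snd z, 0) + 2 * T (0, V z)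
    - tr (\<lambda>v. V' z (0, V' z (0, v)))"
proof -
  have d1: "(spray_coeff F i has_derivative (\<lambda>d. V' w d $ i)) (at w)" if "w \<in> \<Omega>" for w i
    by (rule has_derivative_transform_within_open[OF
          bounded_linear.has_derivative[OF bounded_linear_vec_nth V'[OF that]] \<Omega>(1) that])
      (simp add: spray)
  define V2 where "V2 v = frechet_derivative (\<lambda>w. V' w (0, v)) (at z)" for v
  have V2: "((\<lambda>w. V' w (0, v)) has_derivative V2 v) (at z)" for v
    unfolding V2_def by (rule has_derivative_frechet[OF V''])
  have d2: "(dy k (spray_coeff F i) has_derivative (\<lambda>d. V2 (axis k 1) d $ i)) (at z)" for k i
    by (rule has_derivative_transform_within_open[OF
          bounded_linear.has_derivative[OF bounded_linear_vec_nth V2] \<Omega>])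
      (simp add: dy_eq[OF d1])
  have T_eq: "T = (\<lambda>d. tr (\<lambda>v. V2 v d))"
    by (rule has_derivative_unique[OF T has_derivative_tr[OF V2]])
  have pair: "linear (\<lambda>a. f (a, 0))" "linear (\<lambda>a. f (0, a))" if "linear f"
    for f :: "(real ^ 'n) \<times> (real ^ 'n) \<Rightarrow> 'b::real_vector"
    using that by (auto simp: linear_iff) (metis add.right_neutral add_Pair scaleR_Pair scaleR_zero_right)+
  have lin2: "linear (V2 v)" and lin1: "linear (V' z)" for v
    using has_derivative_linear[OF V2] has_derivative_linear[OF V'[OF \<Omega>(2)]] by auto
  have e1: "(\<Sum>j\<in>UNIV. snd z $ j * V2 v (axis j 1, 0) $ i) = V2 v (snd z, 0) $ i" for v i
    using linear_axis_expand[OF pair(1)[OF lin2], of v "snd z"] by simp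
  have e2: "(\<Sum>j\<in>UNIV. V z $ j * V2 v (0, axis j 1) $ i) = V2 v (0, V z) $ i" for v i
    using linear_axis_expand[OF pair(2)[OF lin2], of v "V z"] by simp
  have e3: "(\<Sum>j\<in>UNIV. V' z (0, axis j 1) $ i * V' z (0, v) $ j) = V' z (0, V' z (0, v)) $ i" for v i
    using linear_axis_expand[OF pair(2)[OF lin1], of "V' z (0, v)"] by (simp add: mult.commute)
  show ?thesis
    unfolding ricci_curvature_def trace_def riemann_curvature_def T_eq tr_def
    by (simp add: dx_eq[OF d1[OF \<Omega>(2)]] dy_eq[OF d1[OF \<Omega>(2)]] dx_eq[OF d2] dy_eq[OF d2] spray[OF \<Omega>(2)]
        e1 e2 e3 sum.distrib sum_subtractf sum_distrib_left)
qed

section \<open>Riemannian geometry in a chart\<close>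

locale metric_chart =
  fixes U :: "(real ^ 'n::finite) set"
    and H :: "real ^ 'n \<Rightarrow> real ^ 'n \<Rightarrow> real ^ 'n \<Rightarrow> real"
  assumes open_U: "open U"
    and H_bil: "\<And>x. x \<in> U \<Longrightarrow> bilinear (H x)"
    and H_sym: "\<And>x u v. x \<in> U \<Longrightarrow> H x u v = H x v u"
    and H_pos: "\<And>x u. x \<in> U \<Longrightarrow> u \<noteq> 0 \<Longrightarrow> H x u u > 0"
    and H_smooth: "\<And>u v. smooth_on U (\<lambda>x. H x u v)"
begin

sublocale H: bilinear_family U H
  by unfold_locales (simp_all add: open_U H_bil smooth_on_differentiable[OF H_smooth])

abbreviation "DH \<equiv> H.DB"

lemmas H_simps = bilinear_ladd[OF H_bil] bilinear_radd[OF H_bil] bilinear_lsub[OF H_bil]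
  bilinear_rsub[OF H_bil] bilinear_lmul[OF H_bil] bilinear_rmul[OF H_bil]
  bilinear_lneg[OF H_bil] bilinear_rneg[OF H_bil] bilinear_lzero[OF H_bil] bilinear_rzero[OF H_bil]

lemmas DH_simps = bilinear_ladd[OF H.DB_bilinear] bilinear_radd[OF H.DB_bilinear]
  bilinear_lmul[OF H.DB_bilinear] bilinear_rmul[OF H.DB_bilinear]
  linear_add[OF H.DB_linear] linear_scale[OF H.DB_linear]

lemma DH_sym: "x \<in> U \<Longrightarrow> DH x a u v = DH x a v u"
  by (rule H.DB_eqI, rule has_derivative_transform_within_open[OF H.has_derivative_DB open_U])
    (auto simp: H_sym)

lemma DH_smooth: "smooth_on U (\<lambda>x. DH x a u v)"
  unfolding H.DB_def by (rule smooth_on_deriv[OF H_smooth])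

definition "D2H x b a u v = frechet_derivative (\<lambda>x. DH x a u v) (at x) b"

lemma has_derivative_DH: "x \<in> U \<Longrightarrow> ((\<lambda>x. DH x a u v) has_derivative (\<lambda>b. D2H x b a u v)) (at x)"
  unfolding D2H_def by (rule smooth_onD[OF DH_smooth])

lemma D2H_sym: "x \<in> U \<Longrightarrow> D2H x b a u v = D2H x a b u v"
  unfolding D2H_def H.DB_def
  by (rule second_derivative_symmetric[OF open_U]) (simp_all add: smooth_on_Ck[OF H_smooth])

lemma D2H_sym': "x \<in> U \<Longrightarrow> D2H x b a u v = D2H x b a v u"
  unfolding D2H_def
  by (subst frechet_derivative_transform_within_open[OF _ open_U, of "\<lambda>x. DH x a u v" x "\<lambda>x. DH x a v u"])
    (simp_all add: smooth_on_differentiable[OF DH_smooth] DH_sym)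

lemma H_eqI:
  assumes "x \<in> U" "\<And>w. H x a w = H x b w"
  shows "a = b"
proof (rule ccontr)
  assume "a \<noteq> b"
  then have "H x (a - b) (a - b) > 0" using H_pos[OF assms(1)] by simp
  then show False using assms(2)[of "a - b"] by (simp add: H_simps(3)[OF assms(1)])
qed

definition Hm :: "real ^ 'n \<Rightarrow> real ^ 'n ^ 'n" where
  "Hm x = (\<chi> i j. H x (axis i 1) (axis j 1))"

lemma Hm_inner:
  assumes "x \<in> U"
  shows "u \<bullet> (Hm x *v v) = H x u v"
proof -
  have l: "linear (\<lambda>u. H x u v)" "linear (\<lambda>v. H x u v)" for u v
    using H_bil[OF assms] by (simp_all add: bilinear_def)
  have "H x u v = (\<Sum>i\<in>UNIV. u $ i * (\<Sum>j\<in>UNIV. v $ j * H x (axis i 1) (axis j 1)))"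
    by (subst linear_axis_expand[OF l(1)], subst linear_axis_expand[OF l(2)]) simp
  then show ?thesis
    by (simp add: Hm_def inner_vec_def matrix_vector_mult_def sum_distrib_left mult_ac)
qed

lemma Hm_det: "x \<in> U \<Longrightarrow> det (Hm x) \<noteq> 0"
  by (rule pos_def_imp_det_nonzero) (simp add: Hm_inner H_pos)

lemma Hm_inv: "x \<in> U \<Longrightarrow> matrix_inv (Hm x) ** Hm x = mat 1" "x \<in> U \<Longrightarrow> Hm x ** matrix_inv (Hm x) = mat 1"
  using matrix_inv_inverse Hm_det invertible_det_nz by blast+

text \<open>Skewness reads \<open>Hm A = - A\<^sup>T Hm\<close> for the matrix \<open>A\<close> of
  \<open>T\<close>. Hence \<open>A\<close> is conjugate to \<open>- A\<^sup>T\<close>, and its trace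
  equals its own negative.\<close>

lemma tr_skew:
  assumes x: "x \<in> U" and T: "linear T" "\<And>u v. H x (T u) v = - H x u (T v)"
  shows "tr T = 0"
proof -
  define A where "A = matrix T"
  have A: "A *v v = T v" for v using T(1) by (simp add: A_def)
  have "u \<bullet> ((Hm x ** A) *v v) = u \<bullet> ((- (transpose A ** Hm x)) *v v)" for u v
  proof -
    have "u \<bullet> ((Hm x ** A) *v v) = H x u (T v)"
      by (simp add: matrix_vector_mul_assoc[symmetric] A Hm_inner[OF x])
    moreover have "u \<bullet> ((transpose A ** Hm x) *v v) = H x (T u) v"
      by (simp add: matrix_vector_mul_assoc[symmetric] Hm_inner[OF x, symmetric] A[symmetric] del: transpose_matrix_vector)
        (metis dot_lmul_matrix inner_commute transpose_matrix_vector)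
    moreover have "(- (transpose A ** Hm x)) *v v = - ((transpose A ** Hm x) *v v)"
      by (simp add: matrix_vector_mult_def vec_eq_iff sum_negf)
    ultimately show ?thesis using T(2)[of u v] by simp
  qed
  then have "Hm x ** A = - (transpose A ** Hm x)"
    by (subst matrix_eq) (metis vector_eq_ldot)
  then have "matrix_inv (Hm x) ** (Hm x ** A) = matrix_inv (Hm x) ** (- (transpose A ** Hm x))" by simp
  moreover have "matrix_inv (Hm x) ** (Hm x ** A) = A" by (simp add: matrix_mul_assoc Hm_inv[OF x])
  moreover have "K ** (- L) = - (K ** L)" for K L :: "real ^ 'n ^ 'n"
    by (simp add: matrix_matrix_mult_def vec_eq_iff sum_negf)
  ultimately have "A = - (matrix_inv (Hm x) ** (transpose A ** Hm x))" by simp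
  then have "trace A = - trace (matrix_inv (Hm x) ** (transpose A ** Hm x))"
    by (metis trace_sub trace_0 diff_0 mat_0)
  also have "trace (matrix_inv (Hm x) ** (transpose A ** Hm x)) = trace ((transpose A ** Hm x) ** matrix_inv (Hm x))"
    by (rule trace_mul_sym)
  also have "\<dots> = trace (transpose A)"
    by (simp add: matrix_mul_assoc[symmetric] Hm_inv[OF x])
  also have "\<dots> = trace A" by (simp add: trace_def transpose_def)
  finally have "trace A = 0" by simp
  then show ?thesis by (simp add: trace_def A_def matrix_def tr_def)
qed

section \<open>Levi-Civita connection: Christoffel symbols from the Koszul formula\<close>

definition \<Gamma> :: "real ^ 'n \<Rightarrow> real ^ 'n \<Rightarrow> real ^ 'n \<Rightarrow> real ^ 'n" where
  "\<Gamma> x u v = matrix_inv (Hm x) *v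
     (\<chi> l. (DH x u v (axis l 1) + DH x v u (axis l 1) - DH x (axis l 1) u v) / 2)"

lemma Hm_\<Gamma>:
  "x \<in> U \<Longrightarrow> Hm x *v \<Gamma> x u v = (\<chi> l. (DH x u v (axis l 1) + DH x v u (axis l 1) - DH x (axis l 1) u v) / 2)"
  by (simp add: \<Gamma>_def matrix_vector_mul_assoc Hm_inv)

lemma H_\<Gamma>:
  assumes "x \<in> U"
  shows "H x (\<Gamma> x u v) w = (DH x u v w + DH x v u w - DH x w u v) / 2"
proof -
  have lin: "linear (\<lambda>w. (DH x u v w + DH x v u w - DH x w u v) / 2)"
    by (rule linearI) (simp_all add: DH_simps[OF assms] algebra_simps add_divide_distrib diff_divide_distrib)
  have "H x (\<Gamma> x u v) w = w \<bullet> (Hm x *v \<Gamma> x u v)"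
    using assms by (simp add: Hm_inner H_sym)
  also have "\<dots> = (\<Sum>l\<in>UNIV. w $ l *\<^sub>R ((DH x u v (axis l 1) + DH x v u (axis l 1) - DH x (axis l 1) u v) / 2))"
    by (simp add: Hm_\<Gamma>[OF assms] inner_vec_def)
  also have "\<dots> = (DH x u v w + DH x v u w - DH x w u v) / 2"
    by (rule linear_axis_expand[OF lin, symmetric])
  finally show ?thesis .
qed

lemma \<Gamma>_sym: "x \<in> U \<Longrightarrow> \<Gamma> x u v = \<Gamma> x v u"
proof (rule H_eqI)
  show "H x (\<Gamma> x u v) w = H x (\<Gamma> x v u) w" if "x \<in> U" for w
    using that DH_sym[OF that, of w u v] by (simp add: H_\<Gamma>)
qed

lemma metric_compat: "x \<in> U \<Longrightarrow> DH x a u v = H x (\<Gamma> x a u) v + H x u (\<Gamma> x a v)"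
  by (simp add: H_sym[of x u] H_\<Gamma> DH_sym[of x a v u] DH_sym[of x v u a] DH_sym[of x u v a] field_simps)

lemma \<Gamma>_differentiable: "x \<in> U \<Longrightarrow> (\<lambda>x. \<Gamma> x u v) differentiable (at x)"
proof (rule solve_differentiable[OF open_U _ _ _ Hm_det Hm_\<Gamma>])
  assume x: "x \<in> U"
  show "(\<lambda>x. Hm x $ i $ j) differentiable (at x)" for i j
    using H.diff[OF x] by (simp add: Hm_def)
  have "(\<lambda>x. DH x a u v) differentiable (at x)" for a u v
    using has_derivative_DH[OF x] differentiable_def by blast
  then show "(\<lambda>x. (\<chi> l. (DH x u v (axis l 1) + DH x v u (axis l 1) - DH x (axis l 1) u v) / 2) $ l) differentiable (at x)" for l
    by (simp add: differentiable_add differentiable_diff differentiable_divide)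
qed

sublocale G: bilinear_family U \<Gamma>
proof (unfold_locales)
  fix x assume x: "x \<in> U"
  show "bilinear (\<Gamma> x)"
    unfolding bilinear_def
    by (intro conjI allI linearI; rule H_eqI[OF x])
      (simp_all add: H_\<Gamma>[OF x] DH_simps[OF x] H_simps[OF x] field_simps)
qed (use open_U \<Gamma>_differentiable in auto)

abbreviation "D\<Gamma> \<equiv> G.DB"

lemmas \<Gamma>_simps = bilinear_ladd[OF G.bil] bilinear_radd[OF G.bil] bilinear_lsub[OF G.bil]
  bilinear_rsub[OF G.bil] bilinear_lmul[OF G.bil] bilinear_rmul[OF G.bil]
  bilinear_lneg[OF G.bil] bilinear_rneg[OF G.bil] bilinear_lzero[OF G.bil] bilinear_rzero[OF G.bil]

lemmas D\<Gamma>_simps = bilinear_ladd[OF G.DB_bilinear] bilinear_radd[OF G.DB_bilinear]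
  bilinear_lmul[OF G.DB_bilinear] bilinear_rmul[OF G.DB_bilinear]
  linear_add[OF G.DB_linear] linear_scale[OF G.DB_linear]

lemma D\<Gamma>_sym: "x \<in> U \<Longrightarrow> D\<Gamma> x a u v = D\<Gamma> x a v u"
  by (rule G.DB_eqI, rule has_derivative_transform_within_open[OF G.has_derivative_DB open_U])
    (auto simp: \<Gamma>_sym)

text \<open>Obtained by differentiating the Koszul formula \<open>H_\<Gamma>\<close> along
  \<open>y\<close>. It exposes second derivatives of the metric, whose symmetries make the curvature
  skew in \<open>B_sym\<close>.\<close>

lemma H_D\<Gamma>:
  assumes x: "x \<in> U"
  shows "H x (D\<Gamma> x y u v) w = (D2H x y u v w + D2H x y v u w - D2H x y w u v) / 2
    - H x (\<Gamma> x y (\<Gamma> x u v)) w - H x (\<Gamma> x u v) (\<Gamma> x y w)"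
proof -
  have "((\<lambda>x. H x (\<Gamma> x u v) w) has_derivative
      (\<lambda>y. DH x y (\<Gamma> x u v) w + H x (D\<Gamma> x y u v) w + H x (\<Gamma> x u v) 0)) (at x)"
    using H.has_derivative_family[OF has_derivative_ident G.has_derivative_DB[OF x] has_derivative_const x] .
  moreover have "((\<lambda>x. H x (\<Gamma> x u v) w) has_derivative
      (\<lambda>y. (D2H x y u v w + D2H x y v u w - D2H x y w u v) / 2)) (at x)"
    by (rule has_derivative_transform_within_open[OF _ open_U x,
          where f = "\<lambda>x. (DH x u v w + DH x v u w - DH x w u v) / 2"])
      (use x in \<open>auto intro!: derivative_eq_intros has_derivative_DH simp: H_\<Gamma>\<close>)
  ultimately have "(\<lambda>y. DH x y (\<Gamma> x u v) w + H x (D\<Gamma> x y u v) w + H x (\<Gamma> x u v) 0)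
     = (\<lambda>y. (D2H x y u v w + D2H x y v u w - D2H x y w u v) / 2)"
    by (rule has_derivative_unique)
  from fun_cong[OF this, of y]
  have "DH x y (\<Gamma> x u v) w + H x (D\<Gamma> x y u v) w = (D2H x y u v w + D2H x y v u w - D2H x y w u v) / 2"
    by (simp add: H_simps[OF x])
  then show ?thesis using metric_compat[OF x, of y "\<Gamma> x u v" w] by linarith
qed

text \<open>The Ricci tensor, as a trace that is not visibly symmetric in \<open>y\<close> and \<open>w\<close>.\<close>

definition B :: "real ^ 'n \<Rightarrow> real ^ 'n \<Rightarrow> real ^ 'n \<Rightarrow> real" where
  "B x y w = tr (\<lambda>v. D\<Gamma> x v y w - D\<Gamma> x y v w - \<Gamma> x y (\<Gamma> x v w) + \<Gamma> x v (\<Gamma> x y w))"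

text \<open>The difference \<open>B x y w - B x w y\<close> is the trace of the curvature endomorphism \<open>R(w, y)\<close>, which is skew.\<close>

lemma B_sym:
  assumes x: "x \<in> U"
  shows "B x y w = B x w y"
proof -
  define T where "T v = D\<Gamma> x y v w - D\<Gamma> x w v y + \<Gamma> x y (\<Gamma> x w v) - \<Gamma> x w (\<Gamma> x y v)" for v
  have "tr T = 0"
  proof (rule tr_skew[OF x])
    show "linear T" unfolding T_def
      by (rule linearI) (simp_all add: D\<Gamma>_simps[OF x] \<Gamma>_simps[OF x] algebra_simps)
    \<comment> \<open>With the index lowered, exchanging \<open>u\<close> and \<open>v\<close> pairs
      up terms of opposite sign, by the symmetry of \<open>D2H\<close> in its last two
      arguments.\<close>
    have T1: "H x (T u) v = (D2H x y u w v - D2H x y v u w - D2H x w u y v + D2H x w v u y) / 2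
        - H x (\<Gamma> x w u) (\<Gamma> x y v) + H x (\<Gamma> x y u) (\<Gamma> x w v)" for u v
      by (simp add: T_def H_simps[OF x] H_D\<Gamma>[OF x] \<Gamma>_sym[OF x, of u] D2H_sym[OF x, of w y] field_simps)
    show "H x (T u) v = - H x u (T v)" for u v
      unfolding H_sym[OF x, of u] T1
      by (simp add: D2H_sym'[OF x, of _ _ w] D2H_sym'[OF x, of _ _ y]
         H_sym[OF x, of "\<Gamma> x w v"] H_sym[OF x, of "\<Gamma> x y v"] field_simps)
  qed
  have "B x y w - B x w y = tr (\<lambda>v. - T v)"
    unfolding B_def tr_diff[symmetric]
  proof (rule arg_cong[of _ _ tr], rule ext)
    show "D\<Gamma> x v y w - D\<Gamma> x y v w - \<Gamma> x y (\<Gamma> x v w) + \<Gamma> x v (\<Gamma> x y w)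
      - (D\<Gamma> x v w y - D\<Gamma> x w v y - \<Gamma> x w (\<Gamma> x v y) + \<Gamma> x v (\<Gamma> x w y)) = - T v" for v
      unfolding T_def \<Gamma>_sym[OF x, of v w] \<Gamma>_sym[OF x, of v y] \<Gamma>_sym[OF x, of w y] D\<Gamma>_sym[OF x, of v w y]
      by simp
  qed
  then show ?thesis using \<open>tr T = 0\<close> by (simp add: tr_minus)
qed

lemma B_add: "x \<in> U \<Longrightarrow> B x (y + y') w = B x y w + B x y' w"
  unfolding B_def tr_add[symmetric]
  by (rule arg_cong[of _ _ tr]) (simp add: fun_eq_iff D\<Gamma>_simps \<Gamma>_simps algebra_simps)

text \<open>Given \<open>B_sym\<close>, additivity in the first argument is enough to recover the
  mixed values from the diagonal.\<close>

lemma B_polarization: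
  assumes x: "x \<in> U" and "\<And>y. B x y y = s * H x y y"
  shows "B x y w = s * H x y w"
proof -
  have "B x (y + w) (y + w) = B x y y + B x w w + 2 * B x y w"
    unfolding B_add[OF x] B_sym[OF x, of y "y + w"] B_sym[OF x, of w "y + w"] B_sym[OF x, of w y] by simp
  then show ?thesis unfolding assms(2)
    by (simp add: H_simps[OF x] H_sym[OF x, of w y] algebra_simps)
qed

section \<open>Spray and Ricci curvature of the Riemannian metric\<close>

lemma energy_derivatives_H:
  "energy_derivatives (U \<times> UNIV) (\<lambda>z. H (fst z) (snd z) (snd z))
    (\<lambda>z d. DH (fst z) (fst d) (snd z) (snd z) + 2 * H (fst z) (snd z) (snd d))
    (\<lambda>z v d. 2 * (DH (fst z) (fst d) (snd z) v + H (fst z) (snd d) v))"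
proof
  show "open (U \<times> (UNIV :: (real ^ 'n) set))" by (simp add: open_Times open_U)
  fix z :: "(real ^ 'n) \<times> (real ^ 'n)" assume "z \<in> U \<times> UNIV"
  then have z: "fst z \<in> U" by auto
  show "((\<lambda>z. H (fst z) (snd z) (snd z)) has_derivative
      (\<lambda>d. DH (fst z) (fst d) (snd z) (snd z) + 2 * H (fst z) (snd z) (snd d))) (at z)"
    using H.has_derivative_family[OF has_derivative_fst[OF has_derivative_ident]
        has_derivative_snd[OF has_derivative_ident] has_derivative_snd[OF has_derivative_ident] z]
    by (simp add: H_sym[OF z, of _ "snd z"] add.assoc)
  fix v
  have *: "\<forall>\<^sub>F w in at z. 2 * H (fst w) (snd w) v =
    DH (fst w) (fst (0::real^'n, v)) (snd w) (snd w) + 2 * H (fst w) (snd w) (snd (0::real^'n, v))"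
  proof -
    have "\<forall>\<^sub>F w in nhds z. w \<in> U \<times> (UNIV :: (real ^ 'n) set)"
      using z by (intro eventually_nhds_in_open) (auto simp: open_Times open_U mem_Times_iff)
    then have "\<forall>\<^sub>F w in at z. w \<in> U \<times> (UNIV :: (real ^ 'n) set)"
      by (rule filter_leD[OF at_within_le_nhds])
    then show ?thesis by eventually_elim (auto simp: linear_0[OF H.DB_linear])
  qed
  have "((\<lambda>w. 2 * H (fst w) (snd w) v) has_derivative
      (\<lambda>d. 2 * (DH (fst z) (fst d) (snd z) v + H (fst z) (snd d) v))) (at z)"
    using has_derivative_mult_right[OF H.has_derivative_family[OF has_derivative_fst[OF has_derivative_ident]
        has_derivative_snd[OF has_derivative_ident] has_derivative_const z], of 2 v]
    by (simp add: H_simps[OF z])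
  then show "((\<lambda>w. DH (fst w) (fst (0::real^'n, v)) (snd w) (snd w) + 2 * H (fst w) (snd w) (snd (0::real^'n, v)))
     has_derivative (\<lambda>d. 2 * (DH (fst z) (fst d) (snd z) v + H (fst z) (snd d) v))) (at z)"
    by (rule has_derivative_transform_eventually[OF _ *]) (auto simp: linear_0[OF H.DB_linear[OF z]])
qed

lemma spray_coeff_H:
  assumes N: "\<And>w. fst w \<in> U \<Longrightarrow> (N w)\<^sup>2 = H (fst w) (snd w) (snd w)" and z: "fst z \<in> U"
  shows "spray_coeff N i z = ((1/2) *\<^sub>R \<Gamma> (fst z) (snd z) (snd z)) $ i"
proof (rule energy_derivatives.spray_coeff_eqI[OF energy_derivatives_H])
  show "(N w)\<^sup>2 = H (fst w) (snd w) (snd w)" if "w \<in> U \<times> UNIV" for w using N that by auto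
  show "z \<in> U \<times> UNIV" using z by (simp add: mem_Times_iff)
  show "2 * (DH (fst z) (fst (0::real^'n, u)) (snd z) u + H (fst z) (snd (0::real^'n, u)) u) > 0" if "u \<noteq> 0" for u
    using z that by (simp add: linear_0[OF H.DB_linear] H_pos)
  show "2 * (DH (fst z) (fst (0::real^'n, v)) (snd z) u + H (fst z) (snd (0::real^'n, v)) u)
    = 2 * (DH (fst z) (fst (0::real^'n, u)) (snd z) v + H (fst z) (snd (0::real^'n, u)) v)" for u v
    using z by (simp add: linear_0[OF H.DB_linear] H_sym[of _ u])
  show "2 * (2 * (DH (fst z) (fst (0::real^'n, (1/2) *\<^sub>R \<Gamma> (fst z) (snd z) (snd z))) (snd z) v
        + H (fst z) (snd (0::real^'n, (1/2) *\<^sub>R \<Gamma> (fst z) (snd z) (snd z))) v))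
    = 2 * (DH (fst z) (fst (snd z, 0::real^'n)) (snd z) v + H (fst z) (snd (snd z, 0::real^'n)) v)
      - (DH (fst z) (fst (v, 0::real^'n)) (snd z) (snd z) + 2 * H (fst z) (snd z) (snd (v, 0::real^'n)))" for v
    using z by (simp add: linear_0[OF H.DB_linear] H_simps H_\<Gamma>)
qed

lemma has_derivative_spray_H:
  assumes "fst z \<in> U"
  shows "((\<lambda>z. (1/2) *\<^sub>R \<Gamma> (fst z) (snd z) (snd z)) has_derivative
    (\<lambda>d. (1/2) *\<^sub>R D\<Gamma> (fst z) (fst d) (snd z) (snd z) + \<Gamma> (fst z) (snd z) (snd d))) (at z)"
proof -
  have "(\<lambda>d. (1/2) *\<^sub>R (D\<Gamma> (fst z) (fst d) (snd z) (snd z) + \<Gamma> (fst z) (snd d) (snd z) + \<Gamma> (fst z) (snd z) (snd d)))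
    = (\<lambda>d. (1/2) *\<^sub>R D\<Gamma> (fst z) (fst d) (snd z) (snd z) + \<Gamma> (fst z) (snd z) (snd d))"
    by (simp add: fun_eq_iff \<Gamma>_sym[OF assms, of _ "snd z"] scaleR_add_right scaleR_half_double add.assoc
        flip: scaleR_2)
  then show ?thesis
    using has_derivative_scaleR_right[OF G.has_derivative_family[OF has_derivative_fst[OF has_derivative_ident]
        has_derivative_snd[OF has_derivative_ident] has_derivative_snd[OF has_derivative_ident] assms], of "1/2"]
    by simp
qed

lemma has_derivative_\<Gamma>_fibre:
  assumes "fst z \<in> U"
  shows "((\<lambda>z. \<Gamma> (fst z) (snd z) v) has_derivative
    (\<lambda>d. D\<Gamma> (fst z) (fst d) (snd z) v + \<Gamma> (fst z) (snd d) v)) (at z)"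
  using G.has_derivative_family[OF has_derivative_fst[OF has_derivative_ident]
        has_derivative_snd[OF has_derivative_ident] has_derivative_const assms, of v]
  by (simp add: \<Gamma>_simps[OF assms])

text \<open>The left side is what the Ricci formula produces for the spray
  \<open>1/2 \<Gamma> y y\<close>; the same block reappears in the curvature of the Kropina
  metric.\<close>

lemma B_diag:
  assumes x: "x \<in> U"
  shows "tr (\<lambda>v. D\<Gamma> x v y y) - tr (\<lambda>v. D\<Gamma> x y y v) + tr (\<lambda>v. \<Gamma> x (\<Gamma> x y y) v) - tr (\<lambda>v. \<Gamma> x y (\<Gamma> x y v))
    = B x y y"
  unfolding B_def tr_add[symmetric] tr_diff[symmetric]
  proof (rule arg_cong[of _ _ tr], rule ext)
  show "D\<Gamma> x v y y - D\<Gamma> x y y v + \<Gamma> x (\<Gamma> x y y) v - \<Gamma> x y (\<Gamma> x y v)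
      = D\<Gamma> x v y y - D\<Gamma> x y v y - \<Gamma> x y (\<Gamma> x v y) + \<Gamma> x v (\<Gamma> x y y)" for v
    unfolding D\<Gamma>_sym[OF x, of y y v] \<Gamma>_sym[OF x, of "\<Gamma> x y y" v] \<Gamma>_sym[OF x, of y v] by simp
  qed

text \<open>Only \<open>N\<^sup>2\<close> is prescribed. So the square root in
  \<open>norm_of\<close> is never differentiated, \<open>y = 0\<close> is included, and the same
  \<open>B\<close> serves for a chart and for its left translate.\<close>

lemma ricci_curvature_H:
  assumes N: "\<And>w. fst w \<in> U \<Longrightarrow> (N w)\<^sup>2 = H (fst w) (snd w) (snd w)" and x: "x \<in> U"
  shows "ricci_curvature N (x, y) = B x y y"
proof -
  have op: "open (U \<times> (UNIV :: (real ^ 'n) set))" by (simp add: open_Times open_U)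
  have mem: "(x, y) \<in> U \<times> UNIV" using x by simp
  have "ricci_curvature N (x, y) = 2 * tr (\<lambda>v. (1/2) *\<^sub>R D\<Gamma> x v y y + \<Gamma> x y 0)
     - tr (\<lambda>v. D\<Gamma> x y y v + \<Gamma> x 0 v) + 2 * tr (\<lambda>v. D\<Gamma> x 0 y v + \<Gamma> x ((1/2) *\<^sub>R \<Gamma> x y y) v)
     - tr (\<lambda>v. (1/2) *\<^sub>R D\<Gamma> x 0 y y + \<Gamma> x y ((1/2) *\<^sub>R D\<Gamma> x 0 y y + \<Gamma> x y v))"
    (is "_ = ?R")
  proof -
    have d0: "((\<lambda>w. (1/2) *\<^sub>R D\<Gamma> (fst w) (fst (0::real^'n, v)) (snd w) (snd w) + \<Gamma> (fst w) (snd w) (snd (0::real^'n, v))) has_derivative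
        (\<lambda>d. D\<Gamma> x (fst d) y v + \<Gamma> x (snd d) v)) (at (x, y))" for v
      by (rule has_derivative_transform_within_open[OF has_derivative_\<Gamma>_fibre[of "(x, y)" v, simplified, OF x] op mem])
        (auto simp: linear_0[OF G.DB_linear])
    have d1: "(\<lambda>w. (1/2) *\<^sub>R D\<Gamma> (fst w) (fst (0::real^'n, v)) (snd w) (snd w) + \<Gamma> (fst w) (snd w) (snd (0::real^'n, v)))
        differentiable (at (x, y))" for v
      using d0 unfolding differentiable_def by blast
    have s1: "spray_coeff N i w = ((1/2) *\<^sub>R \<Gamma> (fst w) (snd w) (snd w)) $ i" if "w \<in> U \<times> UNIV" for w i
    proof (rule spray_coeff_H)
      show "fst w \<in> U" using that by (simp add: mem_Times_iff)
    qed (rule N)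
    have s2: "((\<lambda>z. (1/2) *\<^sub>R \<Gamma> (fst z) (snd z) (snd z)) has_derivative
      (\<lambda>d. (1/2) *\<^sub>R D\<Gamma> (fst w) (fst d) (snd w) (snd w) + \<Gamma> (fst w) (snd w) (snd d))) (at w)"
      if "w \<in> U \<times> UNIV" for w
      by (rule has_derivative_spray_H) (use that in \<open>simp add: mem_Times_iff\<close>)
    show ?thesis
      by (rule ricci_curvature_eqI[OF op mem, where F = N and V = "\<lambda>z. (1/2) *\<^sub>R \<Gamma> (fst z) (snd z) (snd z)"
        and V' = "\<lambda>z d. (1/2) *\<^sub>R D\<Gamma> (fst z) (fst d) (snd z) (snd z) + \<Gamma> (fst z) (snd z) (snd d)",
        OF s1 s2 d1 has_derivative_tr[OF d0], unfolded fst_conv snd_conv])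
  qed
  also have "?R = tr (\<lambda>v. D\<Gamma> x v y y) - tr (\<lambda>v. D\<Gamma> x y y v) + tr (\<lambda>v. \<Gamma> x (\<Gamma> x y y) v) - tr (\<lambda>v. \<Gamma> x y (\<Gamma> x y v))"
    by (simp add: linear_0[OF G.DB_linear[OF x]] \<Gamma>_simps[OF x] tr_scaleR)
  also have "\<dots> = B x y y" by (rule B_diag[OF x])
  finally show ?thesis .
qed

end

section \<open>Kropina metrics of unit Killing fields in a chart\<close>

text \<open>\<open>W_killing\<close> is the vanishing of the Lie derivative of \<open>H\<close>
  along \<open>W\<close>, written with coordinate derivatives alone.\<close>

locale killing_chart = metric_chart U H
  for U :: "(real ^ 'n::finite) set" and H +
  fixes W :: "real ^ 'n \<Rightarrow> real ^ 'n"
  assumes W_smooth: "smooth_on U W"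
    and W_unit: "\<And>x. x \<in> U \<Longrightarrow> H x (W x) (W x) = 1"
    and W_killing: "\<And>x u v. x \<in> U \<Longrightarrow>
      frechet_derivative (\<lambda>x. H x u v) (at x) (W x)
      + H x (frechet_derivative W (at x) u) v + H x u (frechet_derivative W (at x) v) = 0"
begin

definition "DW x v = frechet_derivative W (at x) v"

lemma has_derivative_W: "x \<in> U \<Longrightarrow> (W has_derivative DW x) (at x)"
  unfolding DW_def by (rule smooth_onD[OF W_smooth])

lemma DW_linear: "x \<in> U \<Longrightarrow> linear (DW x)"
  by (rule has_derivative_linear[OF has_derivative_W])

definition "D2W x a v = frechet_derivative (\<lambda>x. DW x v) (at x) a"

lemma has_derivative_DW: "x \<in> U \<Longrightarrow> ((\<lambda>x. DW x v) has_derivative (\<lambda>a. D2W x a v)) (at x)"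
  unfolding DW_def D2W_def by (rule smooth_onD[OF smooth_on_deriv[OF W_smooth]])

lemma D2W_sym: "x \<in> U \<Longrightarrow> D2W x a v = D2W x v a"
  unfolding D2W_def DW_def
  by (rule second_derivative_symmetric[OF open_U]) (simp_all add: smooth_on_Ck[OF W_smooth])

text \<open>The endomorphism \<open>v \<mapsto> \<nabla>\<^sub>v W\<close>.\<close>

definition S :: "real ^ 'n \<Rightarrow> real ^ 'n \<Rightarrow> real ^ 'n" where
  "S x v = DW x v + \<Gamma> x v (W x)"

lemma S_linear: "x \<in> U \<Longrightarrow> linear (S x)"
  unfolding S_def
  by (rule linearI) (simp_all add: linear_add[OF DW_linear] linear_scale[OF DW_linear] \<Gamma>_simps algebra_simps)

lemmas S_simps = linear_add[OF S_linear] linear_scale[OF S_linear] linear_0[OF S_linear]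
  linear_diff[OF S_linear] linear_neg[OF S_linear]

text \<open>The plain coordinate derivative of \<open>S\<close> along \<open>a\<close>, not the
  covariant one; \<open>divergence_S\<close> adds the Christoffel terms.\<close>

definition "DS x a v = D2W x a v + D\<Gamma> x a v (W x) + \<Gamma> x v (DW x a)"

lemma has_derivative_S: "x \<in> U \<Longrightarrow> ((\<lambda>x. S x v) has_derivative (\<lambda>a. DS x a v)) (at x)"
proof -
  assume x: "x \<in> U"
  have "((\<lambda>x. DW x v + \<Gamma> x v (W x)) has_derivative
    (\<lambda>a. D2W x a v + (D\<Gamma> x a v (W x) + \<Gamma> x 0 (W x) + \<Gamma> x v (DW x a)))) (at x)"
    by (rule has_derivative_add[OF has_derivative_DW[OF x]
          G.has_derivative_family[OF has_derivative_ident has_derivative_const has_derivative_W[OF x] x]])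
  then show ?thesis by (simp add: S_def DS_def \<Gamma>_simps[OF x] add.assoc)
qed

text \<open>\<open>metric_compat\<close> splits the derivative of \<open>H\<close> along
  \<open>W\<close> into the two Christoffel terms that complete \<open>DW\<close> to
  \<open>S\<close>.\<close>

lemma S_skew: "x \<in> U \<Longrightarrow> H x (S x u) v = - H x u (S x v)"
proof -
  assume x: "x \<in> U"
  have "DH x (W x) u v + H x (DW x u) v + H x u (DW x v) = 0"
    using W_killing[OF x] by (simp add: H.DB_def DW_def)
  then show ?thesis
    by (simp add: S_def H_simps[OF x] metric_compat[OF x] \<Gamma>_sym[OF x, of "W x"])
qed

text \<open>Differentiating \<open>H W W = 1\<close> along \<open>v\<close> shows that
  \<open>S v\<close> is orthogonal to \<open>W\<close>; skewness then shifts \<open>S\<close> onto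
  \<open>W\<close>.\<close>

lemma S_W: "x \<in> U \<Longrightarrow> S x (W x) = 0"
proof (rule H_eqI)
  assume x: "x \<in> U"
  fix v
  have "((\<lambda>x. H x (W x) (W x)) has_derivative
     (\<lambda>v. DH x v (W x) (W x) + H x (DW x v) (W x) + H x (W x) (DW x v))) (at x)"
    by (rule H.has_derivative_family[OF has_derivative_ident has_derivative_W[OF x] has_derivative_W[OF x] x])
  moreover have "((\<lambda>x. H x (W x) (W x)) has_derivative (\<lambda>v. 0)) (at x)"
    by (rule has_derivative_transform_within_open[OF has_derivative_const open_U x]) (simp add: W_unit)
  ultimately have "(\<lambda>v. DH x v (W x) (W x) + H x (DW x v) (W x) + H x (W x) (DW x v)) = (\<lambda>v. 0)"
    by (rule has_derivative_unique)
  from fun_cong[OF this, of v] have "H x (S x v) (W x) = 0"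
    by (simp add: metric_compat[OF x] S_def H_simps[OF x] H_sym[OF x, of "W x"])
  then show "H x (S x (W x)) v = H x 0 v"
    using S_skew[OF x, of v "W x"] by (simp add: H_simps[OF x] H_sym[OF x, of _ v])
qed

lemma S_orth: "x \<in> U \<Longrightarrow> H x (S x v) (W x) = 0" "x \<in> U \<Longrightarrow> H x (W x) (S x v) = 0"
  by (simp_all add: S_skew S_W H_simps H_sym[of _ "W _"])

lemma S_alt: "x \<in> U \<Longrightarrow> H x (S x v) v = 0" "x \<in> U \<Longrightarrow> H x v (S x v) = 0"
  using S_skew[of x v v] H_sym[of x v "S x v"] by simp_all

lemma DW_eq: "DW x v = S x v - \<Gamma> x v (W x)"
  by (simp add: S_def)

lemma has_derivative_S_compose:
  assumes "(X has_derivative X') (at t)" "(v has_derivative v') (at t)" and X: "X t \<in> U"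
  shows "((\<lambda>t. S (X t) (v t)) has_derivative (\<lambda>d. DS (X t) (X' d) (v t) + S (X t) (v' d))) (at t)"
proof -
  \<comment> \<open>A linear family becomes bilinear with a scalar second argument, which is held at
    1 below.\<close>
  interpret L: bilinear_family U "\<lambda>x v (r::real). r *\<^sub>R S x v"
  proof
    show "bilinear (\<lambda>v (r::real). r *\<^sub>R S x v)" if "x \<in> U" for x
      unfolding bilinear_def using that by (auto intro!: linearI simp: S_simps algebra_simps)
    show "(\<lambda>x. r *\<^sub>R S x v) differentiable (at x)" if "x \<in> U" for x v and r :: real
      using has_derivative_scaleR_right[OF has_derivative_S[OF that]] unfolding differentiable_def by blast
  qed (rule open_U)
  have "((\<lambda>x. (1::real) *\<^sub>R S x u) has_derivative (\<lambda>a. DS (X t) a u)) (at (X t))" for u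
    using has_derivative_S[OF X] by simp
  note DB = L.DB_eqI[OF this]
  show ?thesis
    using L.has_derivative_family[OF assms(1,2) has_derivative_const[of 1] X] by (simp add: DB)
qed

lemma DS_W:
  assumes x: "x \<in> U"
  shows "DS x v (W x) = - S x (DW x v)"
proof -
  have "((\<lambda>x. S x (W x)) has_derivative (\<lambda>v. DS x v (W x) + S x (DW x v))) (at x)"
    by (rule has_derivative_S_compose[OF has_derivative_ident has_derivative_W[OF x] x])
  moreover have "((\<lambda>x. S x (W x)) has_derivative (\<lambda>v. 0)) (at x)"
    by (rule has_derivative_transform_within_open[OF has_derivative_const open_U x]) (simp add: S_W)
  ultimately have "(\<lambda>v. DS x v (W x) + S x (DW x v)) = (\<lambda>v. 0)"
    by (rule has_derivative_unique)
  from fun_cong[OF this, of v] show ?thesis by (simp add: eq_neg_iff_add_eq_0)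
qed

lemma tr_S: "x \<in> U \<Longrightarrow> tr (S x) = 0"
  by (rule tr_skew) (auto simp: S_linear S_skew)

lemma tr_DS:
  assumes x: "x \<in> U"
  shows "tr (\<lambda>v. DS x a v) = 0"
proof -
  have "((\<lambda>x. tr (S x)) has_derivative (\<lambda>a. tr (\<lambda>v. DS x a v))) (at x)"
    by (rule has_derivative_tr) (rule has_derivative_S[OF x])
  moreover have "((\<lambda>x. tr (S x)) has_derivative (\<lambda>a. 0)) (at x)"
    by (rule has_derivative_transform_within_open[OF has_derivative_const open_U x]) (simp add: tr_S)
  ultimately show ?thesis using has_derivative_unique by metis
qed

text \<open>Since \<open>W\<close> is divergence free, the divergence of \<open>S\<close> is the Ricci tensor applied to \<open>W\<close>.\<close>

lemma divergence_S:
  assumes x: "x \<in> U"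
  shows "tr (\<lambda>v. DS x v y + \<Gamma> x v (S x y) - \<Gamma> x y (S x v)) = B x y (W x)"
proof -
  have "tr (\<lambda>v. DS x v y + \<Gamma> x v (S x y) - \<Gamma> x y (S x v)) =
    tr (\<lambda>v. (DS x v y + \<Gamma> x v (S x y) - \<Gamma> x y (S x v)) - DS x y v)"
    by (simp add: tr_diff tr_DS[OF x])
  also have "\<dots> = B x y (W x)"
    unfolding B_def
  proof (rule arg_cong[of _ _ tr], rule ext)
    show "(DS x v y + \<Gamma> x v (S x y) - \<Gamma> x y (S x v)) - DS x y v =
      D\<Gamma> x v y (W x) - D\<Gamma> x y v (W x) - \<Gamma> x y (\<Gamma> x v (W x)) + \<Gamma> x v (\<Gamma> x y (W x))" for v
      unfolding DS_def DW_eq D2W_sym[OF x, of y v] by (simp add: \<Gamma>_simps[OF x])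
  qed
  finally show ?thesis .
qed

text \<open>This is \<open>divergence_S\<close> at \<open>y = W\<close>, where
  \<open>DS v W = - S (DW v)\<close>. Writing \<open>DW\<close> as \<open>S\<close> minus its
  Christoffel part leaves \<open>- S (S v)\<close> plus the commutator of \<open>S\<close> with
  \<open>\<Gamma> W\<close>, which has trace zero.\<close>

lemma tr_S_squared:
  assumes x: "x \<in> U"
  shows "tr (\<lambda>v. S x (S x v)) = - B x (W x) (W x)"
proof -
  have G: "linear (\<Gamma> x (W x))" using G.bil[OF x] by (simp add: bilinear_def)
  have c: "tr (\<lambda>v. S x (\<Gamma> x (W x) v)) = tr (\<lambda>v. \<Gamma> x (W x) (S x v))"
    by (rule tr_comp_commute[OF S_linear[OF x] G])
  have "B x (W x) (W x) = tr (\<lambda>v. - S x (S x v) + S x (\<Gamma> x (W x) v) - \<Gamma> x (W x) (S x v))"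
    unfolding divergence_S[OF x, symmetric]
    by (simp add: DS_W[OF x] S_W[OF x] DW_eq S_simps[OF x] \<Gamma>_simps[OF x] \<Gamma>_sym[OF x, of _ "W x"])
  also have "\<dots> = - tr (\<lambda>v. S x (S x v))"
    by (simp add: tr_diff tr_add tr_minus c)
  finally show ?thesis by simp
qed

section \<open>The Kropina function and its derivatives\<close>

definition dom :: "((real ^ 'n) \<times> (real ^ 'n)) set" where
  "dom = {z. fst z \<in> U \<and> H (fst z) (W (fst z)) (snd z) > 0}"

abbreviation \<beta> :: "(real ^ 'n) \<times> (real ^ 'n) \<Rightarrow> real" where
  "\<beta> z \<equiv> H (fst z) (W (fst z)) (snd z)"

definition K :: "(real ^ 'n) \<times> (real ^ 'n) \<Rightarrow> real" where
  "K z = H (fst z) (snd z) (snd z) / (2 * \<beta> z)"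

text \<open>\<open>dK z v\<close> is the derivative of \<open>K\<close> in the fibre direction \<open>v\<close>.\<close>

definition dK :: "(real ^ 'n) \<times> (real ^ 'n) \<Rightarrow> real ^ 'n \<Rightarrow> real" where
  "dK z v = (H (fst z) (snd z) v - K z * H (fst z) (W (fst z)) v) / \<beta> z"

text \<open>The full derivative of \<open>K\<close>. Here \<open>snd d + \<Gamma> y (fst d)\<close>,
  with \<open>y = snd z\<close>, is the vertical part of \<open>d\<close> for the Levi-Civita
  connection. In horizontal directions \<open>H\<close> is parallel, so \<open>K\<close> varies only
  through \<open>\<nabla>W = S\<close> in its denominator.\<close>

definition DK :: "(real ^ 'n) \<times> (real ^ 'n) \<Rightarrow> (real ^ 'n) \<times> (real ^ 'n) \<Rightarrow> real" where
  "DK z d = dK z (snd d + \<Gamma> (fst z) (snd z) (fst d)) - K z * H (fst z) (S (fst z) (fst d)) (snd z) / \<beta> z"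

text \<open>The derivative of \<open>dK z v\<close> in \<open>z\<close>. The vector \<open>v\<close>
  is constant in coordinates but not parallel, which accounts for the terms
  \<open>\<Gamma> (fst d) v\<close>.\<close>

definition DdK :: "(real ^ 'n) \<times> (real ^ 'n) \<Rightarrow> real ^ 'n \<Rightarrow> (real ^ 'n) \<times> (real ^ 'n) \<Rightarrow> real" where
  "DdK z v d = (H (fst z) (snd d + \<Gamma> (fst z) (snd z) (fst d)) v + H (fst z) (snd z) (\<Gamma> (fst z) (fst d) v)
     - DK z d * H (fst z) (W (fst z)) v
     - K z * (H (fst z) (S (fst z) (fst d)) v + H (fst z) (W (fst z)) (\<Gamma> (fst z) (fst d) v))
     - dK z v * (H (fst z) (W (fst z)) (snd d + \<Gamma> (fst z) (snd z) (fst d)) + H (fst z) (S (fst z) (fst d)) (snd z))) / \<beta> z"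

lemma domD: "z \<in> dom \<Longrightarrow> fst z \<in> U" "z \<in> dom \<Longrightarrow> \<beta> z > 0"
  by (auto simp: dom_def)

lemma has_derivative_HWv:
  assumes "fst z \<in> U"
  shows "((\<lambda>z. H (fst z) (W (fst z)) v) has_derivative
    (\<lambda>d. H (fst z) (S (fst z) (fst d)) v + H (fst z) (W (fst z)) (\<Gamma> (fst z) (fst d) v))) (at z)"
  using H.has_derivative_family[OF has_derivative_fst[OF has_derivative_ident]
     has_derivative_compose[OF has_derivative_fst[OF has_derivative_ident] has_derivative_W[OF assms]]
     has_derivative_const assms, of v]
  by (simp add: metric_compat[OF assms] H_simps[OF assms] S_def algebra_simps)

lemma has_derivative_\<beta>:
  assumes "fst z \<in> U"
  shows "(\<beta> has_derivative (\<lambda>d. H (fst z) (W (fst z)) (snd d + \<Gamma> (fst z) (snd z) (fst d))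
     + H (fst z) (S (fst z) (fst d)) (snd z))) (at z)"
  using H.has_derivative_family[OF has_derivative_fst[OF has_derivative_ident]
     has_derivative_compose[OF has_derivative_fst[OF has_derivative_ident] has_derivative_W[OF assms]]
     has_derivative_snd[OF has_derivative_ident] assms]
  by (simp add: metric_compat[OF assms] H_simps[OF assms] S_def \<Gamma>_sym[OF assms, of "snd z"] algebra_simps)

lemma has_derivative_Hyv:
  assumes "fst z \<in> U"
  shows "((\<lambda>z. H (fst z) (snd z) v) has_derivative
    (\<lambda>d. H (fst z) (snd d + \<Gamma> (fst z) (snd z) (fst d)) v + H (fst z) (snd z) (\<Gamma> (fst z) (fst d) v))) (at z)"
  using H.has_derivative_family[OF has_derivative_fst[OF has_derivative_ident]
     has_derivative_snd[OF has_derivative_ident] has_derivative_const assms, of v]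
  by (simp add: metric_compat[OF assms] H_simps[OF assms] \<Gamma>_sym[OF assms, of "snd z"] algebra_simps)

lemma has_derivative_Hyy:
  assumes "fst z \<in> U"
  shows "((\<lambda>z. H (fst z) (snd z) (snd z)) has_derivative
    (\<lambda>d. 2 * H (fst z) (snd z) (snd d + \<Gamma> (fst z) (snd z) (fst d)))) (at z)"
  using H.has_derivative_family[OF has_derivative_fst[OF has_derivative_ident]
     has_derivative_snd[OF has_derivative_ident] has_derivative_snd[OF has_derivative_ident] assms]
  by (simp add: metric_compat[OF assms] H_simps[OF assms] \<Gamma>_sym[OF assms, of "snd z"]
      H_sym[OF assms, of _ "snd z"] algebra_simps)

lemma open_dom: "open dom"
proof -
  have "open (U \<times> (UNIV :: (real ^ 'n) set))" by (simp add: open_Times open_U)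
  moreover have "continuous_on (U \<times> (UNIV :: (real ^ 'n) set)) \<beta>"
  proof (intro continuous_at_imp_continuous_on ballI)
    show "isCont \<beta> z" if "z \<in> U \<times> (UNIV :: (real ^ 'n) set)" for z
      by (rule has_derivative_continuous[OF has_derivative_\<beta>]) (use that in \<open>simp add: mem_Times_iff\<close>)
  qed
  ultimately have "open ((U \<times> (UNIV :: (real ^ 'n) set)) \<inter> \<beta> -` {0<..})"
    by (intro continuous_open_preimage open_greaterThan)
  moreover have "(U \<times> (UNIV :: (real ^ 'n) set)) \<inter> \<beta> -` {0<..} = dom"
    by (auto simp: dom_def)
  ultimately show ?thesis by simp
qed

lemma has_derivative_K:
  assumes z: "z \<in> dom"
  shows "(K has_derivative DK z) (at z)"
proof -
  note x = domD(1)[OF z]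
  have b: "2 * \<beta> z \<noteq> 0" "\<beta> z \<noteq> 0" using domD(2)[OF z] by auto
  have "((\<lambda>z. H (fst z) (snd z) (snd z) / (2 * \<beta> z)) has_derivative
    (\<lambda>d. (2 * H (fst z) (snd z) (snd d + \<Gamma> (fst z) (snd z) (fst d)) * (2 * \<beta> z) -
      H (fst z) (snd z) (snd z) * (2 * (H (fst z) (W (fst z)) (snd d + \<Gamma> (fst z) (snd z) (fst d))
     + H (fst z) (S (fst z) (fst d)) (snd z)))) / ((2 * \<beta> z) * (2 * \<beta> z)))) (at z)"
    by (rule has_derivative_divide'[OF has_derivative_Hyy[OF x] has_derivative_mult_right[OF has_derivative_\<beta>[OF x]] b(1)])
  moreover have "(2 * h * (2 * b) - q * (2 * (w + s))) / ((2 * b) * (2 * b)) = (h - q / (2 * b) * w) / b - q / (2 * b) * s / b"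
    if "b \<noteq> 0" for h b q w s :: real
    using that by (simp add: divide_simps) (simp add: algebra_simps)
  ultimately show ?thesis unfolding K_def[abs_def] DK_def[abs_def] dK_def using b(2) by (simp add: K_def)
qed

lemma has_derivative_dK:
  assumes z: "z \<in> dom"
  shows "((\<lambda>z. dK z v) has_derivative DdK z v) (at z)"
proof -
  note x = domD(1)[OF z]
  have b: "\<beta> z \<noteq> 0" using domD(2)[OF z] by auto
  let ?B = "\<lambda>d. H (fst z) (W (fst z)) (snd d + \<Gamma> (fst z) (snd z) (fst d)) + H (fst z) (S (fst z) (fst d)) (snd z)"
  let ?Y = "\<lambda>d. H (fst z) (snd d + \<Gamma> (fst z) (snd z) (fst d)) v + H (fst z) (snd z) (\<Gamma> (fst z) (fst d) v)"
  let ?Z = "\<lambda>d. H (fst z) (S (fst z) (fst d)) v + H (fst z) (W (fst z)) (\<Gamma> (fst z) (fst d) v)"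
  have "((\<lambda>z. (H (fst z) (snd z) v - K z * H (fst z) (W (fst z)) v) / \<beta> z) has_derivative
    (\<lambda>d. ((?Y d - (K z * ?Z d + DK z d * H (fst z) (W (fst z)) v)) * \<beta> z
        - (H (fst z) (snd z) v - K z * H (fst z) (W (fst z)) v) * ?B d) / (\<beta> z * \<beta> z))) (at z)"
    by (rule has_derivative_divide'[OF has_derivative_diff[OF has_derivative_Hyv[OF x]
          has_derivative_mult[OF has_derivative_K[OF z] has_derivative_HWv[OF x]]] has_derivative_\<beta>[OF x] b])
  moreover have "((Y - (k * Z + D * w)) * b - r * B) / (b * b) = (Y - D * w - k * Z - r / b * B) / b"
    if "b \<noteq> 0" for Y k Z D w b r B :: real
    using that by (simp add: divide_simps)
  ultimately show ?thesis unfolding DdK_def[abs_def] dK_def[abs_def] using b by simp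
qed

lemma DK_vertical: "z \<in> dom \<Longrightarrow> DK z (0, v) = dK z v"
  by (simp add: DK_def \<Gamma>_simps S_simps H_simps domD)

lemma energy_derivatives_K:
  "energy_derivatives dom (\<lambda>z. (K z)\<^sup>2) (\<lambda>z d. 2 * K z * DK z d)
    (\<lambda>z v d. 2 * (DK z d * dK z v + K z * DdK z v d))"
proof
  fix z v assume z: "z \<in> dom"
  show "((\<lambda>z. (K z)\<^sup>2) has_derivative (\<lambda>d. 2 * K z * DK z d)) (at z)"
    unfolding power2_eq_square
    using has_derivative_mult[OF has_derivative_K[OF z] has_derivative_K[OF z]] by (simp add: mult_ac)
  have "((\<lambda>z. 2 * (K z * dK z v)) has_derivative (\<lambda>d. 2 * (K z * DdK z v d + DK z d * dK z v))) (at z)"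
    by (intro has_derivative_mult_right has_derivative_mult has_derivative_K has_derivative_dK z)
  then have "((\<lambda>z. 2 * K z * DK z (0, v)) has_derivative (\<lambda>d. 2 * (K z * DdK z v d + DK z d * dK z v))) (at z)"
    by (rule has_derivative_transform_within_open[OF _ open_dom z]) (simp add: DK_vertical)
  then show "((\<lambda>z. 2 * K z * DK z (0, v)) has_derivative (\<lambda>d. 2 * (DK z d * dK z v + K z * DdK z v d))) (at z)"
    by (simp add: add.commute)
qed (rule open_dom)

lemma DdK_vertical:
  assumes z: "z \<in> dom"
  shows "DdK z v (0, u) = (H (fst z) u v - dK z u * H (fst z) (W (fst z)) v - dK z v * H (fst z) (W (fst z)) u) / \<beta> z"
  using z by (simp add: DdK_def DK_vertical \<Gamma>_simps S_simps H_simps domD)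

lemma K_pos:
  assumes z: "z \<in> dom"
  shows "K z > 0"
proof -
  have "snd z \<noteq> 0" using domD[OF z] by (auto simp: H_simps)
  then show ?thesis using domD[OF z] by (simp add: K_def H_pos)
qed

text \<open>
  With \<open>f = dK z u\<close> and \<open>r = u - f W\<close>, the form is \<open>f\<^sup>2 + (K / \<beta>) (\<bar>r\<bar>\<^sup>2 - f\<^sup>2)\<close>, and \<open>f\<close> is the inner product of
  \<open>r\<close> with the unit vector \<open>y / K - W\<close>.
\<close>

lemma vertical_hessian_pos:
  assumes z: "z \<in> dom" and u: "u \<noteq> 0"
  shows "DK z (0, u) * dK z u + K z * DdK z u (0, u) > 0"
proof -
  note x = domD(1)[OF z] and b = domD(2)[OF z] and k = K_pos[OF z]
  define y where "y = snd z"
  define w where "w = W (fst z)"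
  define f where "f = dK z u"
  define r where "r = u - f *\<^sub>R w"
  define \<xi> where "\<xi> = (1 / K z) *\<^sub>R y - w"
  let ?h = "H (fst z)"
  have bw: "\<beta> z = ?h w y" by (simp add: w_def y_def)
  have q: "?h y y = 2 * ?h w y * K z" using b by (simp add: K_def y_def w_def)
  have ww: "?h w w = 1" using W_unit[OF x] by (simp add: w_def)
  have fb: "f * ?h w y = ?h y u - K z * ?h w u" using b by (simp add: f_def dK_def y_def w_def)
  note s = H_sym[OF x]
  \<comment> \<open>The navigation equation: \<open>y / K\<close> lies on the unit sphere centred at
    \<open>w\<close>.\<close>
  have \<xi>\<xi>: "?h \<xi> \<xi> = 1"
    using k q ww unfolding \<xi>_def by (simp add: H_simps[OF x] s[of y w] field_simps)
  have r\<xi>: "?h r \<xi> = f"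
  proof -
    have "?h r \<xi> = (?h y u - K z * ?h w u - f * ?h w y) / K z + f"
      using k ww unfolding \<xi>_def r_def by (simp add: H_simps[OF x] s[of u] field_simps)
    then show ?thesis using fb by simp
  qed
  have rr: "?h r r = ?h u u - 2 * f * ?h w u + f\<^sup>2"
    using ww unfolding r_def by (simp add: H_simps[OF x] s[of u w] field_simps power2_eq_square)
  \<comment> \<open>Cauchy-Schwarz for \<open>r\<close> and the unit vector \<open>\<xi>\<close>:
    the left side is the squared length of the part of \<open>r\<close> orthogonal to
    \<open>\<xi>\<close>.\<close>
  have "?h (r - f *\<^sub>R \<xi>) (r - f *\<^sub>R \<xi>) = ?h r r - f\<^sup>2"
    using \<xi>\<xi> r\<xi> by (simp add: H_simps[OF x] s[of \<xi> r] power2_eq_square)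
  moreover have "?h a a \<ge> 0" for a using H_pos[OF x, of a] by (cases "a = 0") (auto simp: H_simps[OF x])
  ultimately have le: "?h r r - f\<^sup>2 \<ge> 0" by metis
  have eq: "DK z (0, u) * dK z u + K z * DdK z u (0, u) = f\<^sup>2 + K z / \<beta> z * (?h r r - f\<^sup>2)"
    unfolding DdK_vertical[OF z] DK_vertical[OF z] rr f_def[symmetric] w_def[symmetric] y_def[symmetric]
    by (simp add: power2_eq_square)
  show ?thesis
  proof (cases "f = 0")
    case True
    then have "?h r r > 0" using u by (simp add: r_def H_pos[OF x])
    then show ?thesis unfolding eq using True k b by simp
  next
    case False
    then show ?thesis unfolding eq using le k b by (intro add_pos_nonneg) auto
  qed
qed

section \<open>Spray of the Kropina metric\<close>

definition V :: "(real ^ 'n) \<times> (real ^ 'n) \<Rightarrow> real ^ 'n" where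
  "V z = (1/2) *\<^sub>R \<Gamma> (fst z) (snd z) (snd z) - K z *\<^sub>R S (fst z) (snd z)"

lemma dK_linear: "z \<in> dom \<Longrightarrow> linear (dK z)"
  unfolding dK_def
  by (rule linearI) (simp_all add: H_simps domD algebra_simps add_divide_distrib diff_divide_distrib)

lemma dK_Sy: "z \<in> dom \<Longrightarrow> dK z (S (fst z) (snd z)) = 0"
  by (simp add: dK_def S_alt S_orth domD)

text \<open>Since \<open>dK z (S y) = 0\<close>, the correction in \<open>V\<close> is felt only by
  \<open>DdK\<close>. On the right, \<open>DdK z v (y, 0)\<close> and \<open>DK z (v, 0)\<close>
  each produce one term \<open>K H (S y) v / \<beta>\<close> up to sign, the latter by skewness, and
  together they balance the correction. The terms in \<open>\<Gamma> y v\<close> cancel.\<close>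

lemma spray_equation:
  assumes z: "z \<in> dom"
  shows "2 * (2 * (DK z (0, V z) * dK z v + K z * DdK z v (0, V z)))
    = 2 * (DK z (snd z, 0) * dK z v + K z * DdK z v (snd z, 0)) - 2 * K z * DK z (v, 0)"
proof -
  note x = domD(1)[OF z] and b = domD(2)[OF z]
  let ?x = "fst z" and ?y = "snd z"
  have b0: "\<beta> z \<noteq> 0" using b by simp
  note dl = linear_add[OF dK_linear[OF z]] linear_diff[OF dK_linear[OF z]] linear_scale[OF dK_linear[OF z]] linear_0[OF dK_linear[OF z]]
  have V: "dK z (V z) = dK z (\<Gamma> ?x ?y ?y) / 2"
    by (simp add: V_def dl dK_Sy[OF z])
  have 1: "DK z (snd z, 0) = dK z (\<Gamma> ?x ?y ?y)"
    by (simp add: DK_def S_alt[OF x])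
  have 2: "DK z (v, 0) = dK z (\<Gamma> ?x ?y v) - K z * H ?x (S ?x v) ?y / \<beta> z"
    by (simp add: DK_def)
  have 3: "2 * DdK z v (0, V z) = DdK z v (0, \<Gamma> ?x ?y ?y) - 2 * K z * H ?x (S ?x ?y) v / \<beta> z"
    unfolding DdK_vertical[OF z] V
    using b0 by (simp add: V_def H_simps[OF x] S_orth[OF x] field_simps)
  have 4: "DdK z v (snd z, 0) - DdK z v (0, \<Gamma> ?x ?y ?y) =
     (H ?x ?y (\<Gamma> ?x ?y v) - K z * (H ?x (S ?x ?y) v + H ?x (W ?x) (\<Gamma> ?x ?y v))) / \<beta> z"
    unfolding DdK_vertical[OF z] unfolding DdK_def 1
    by (simp add: S_alt[OF x] diff_divide_distrib[symmetric])
  have 5: "dK z (\<Gamma> ?x ?y v) = (H ?x ?y (\<Gamma> ?x ?y v) - K z * H ?x (W ?x) (\<Gamma> ?x ?y v)) / \<beta> z"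
    by (simp add: dK_def)
  have 6: "H ?x (S ?x v) ?y = - H ?x (S ?x ?y) v"
    using S_skew[OF x, of v ?y] H_sym[OF x, of v] by simp
  have "DdK z v (snd z, 0) = DdK z v (0, \<Gamma> ?x ?y ?y) + dK z (\<Gamma> ?x ?y v) - K z * H ?x (S ?x ?y) v / \<beta> z"
    using 4 5 by (simp add: diff_divide_distrib algebra_simps add_divide_distrib)
  \<comment> \<open>The remaining scalar identity: \<open>D0\<close>, \<open>d\<close> and
    \<open>h\<close> stand for \<open>DdK z v (0, \<Gamma> y y)\<close>,
    \<open>dK z (\<Gamma> y v)\<close> and \<open>H (S y) v\<close>, while \<open>g\<close> and
    \<open>e\<close> are \<open>dK z (\<Gamma> y y)\<close> and \<open>dK z v\<close>.\<close>
  moreover have "2 * (2 * (g / 2 * e + k * Q)) = 2 * (g * e + k * P) - 2 * k * (d - k * (- h) / b)"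
    if "P = D0 + d - k * h / b" "2 * Q = D0 - 2 * k * h / b" for g e k Q P d h b D0 :: real
  proof -
    have Q: "Q = D0 / 2 - k * h / b" using that by simp
    show ?thesis unfolding Q that(1) by (simp add: algebra_simps)
  qed
  ultimately show ?thesis
    unfolding 1 2 6 DK_vertical[OF z] V using 3 by blast
qed

lemma spray_coeff_K:
  assumes F: "\<And>w. w \<in> dom \<Longrightarrow> F w = K w" and z: "z \<in> dom"
  shows "spray_coeff F i z = V z $ i"
proof (rule energy_derivatives.spray_coeff_eqI[OF energy_derivatives_K])
  show "(F w)\<^sup>2 = (K w)\<^sup>2" if "w \<in> dom" for w using F that by simp
  show "2 * (DK z (0, u) * dK z u + K z * DdK z u (0, u)) > 0" if "u \<noteq> 0" for u
    using vertical_hessian_pos[OF z that] by simp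
  show "2 * (DK z (0, v) * dK z u + K z * DdK z u (0, v)) = 2 * (DK z (0, u) * dK z v + K z * DdK z v (0, u))" for u v
    unfolding DdK_vertical[OF z] DK_vertical[OF z] using H_sym[OF domD(1)[OF z], of u v] by simp
qed (use z spray_equation[OF z] in auto)

lemma fundamental_tensor_K_pos:
  assumes F: "\<And>w. w \<in> dom \<Longrightarrow> F w = K w" and z: "z \<in> dom" and u: "u \<noteq> 0"
  shows "u \<bullet> (fundamental_tensor F z *v u) > 0"
  using energy_derivatives.fundamental_tensor_inner[OF energy_derivatives_K, of F z u u] F z
    vertical_hessian_pos[OF z u] by simp

section \<open>Ricci curvature of the Kropina metric\<close>

definition DV :: "(real ^ 'n) \<times> (real ^ 'n) \<Rightarrow> (real ^ 'n) \<times> (real ^ 'n) \<Rightarrow> real ^ 'n" where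
  "DV z d = ((1/2) *\<^sub>R D\<Gamma> (fst z) (fst d) (snd z) (snd z) + \<Gamma> (fst z) (snd z) (snd d))
     - (K z *\<^sub>R (DS (fst z) (fst d) (snd z) + S (fst z) (snd d)) + DK z d *\<^sub>R S (fst z) (snd z))"

lemma has_derivative_V:
  assumes z: "z \<in> dom"
  shows "(V has_derivative DV z) (at z)"
  unfolding V_def[abs_def] DV_def[abs_def]
  by (intro has_derivative_diff has_derivative_scaleR has_derivative_spray_H has_derivative_K
      has_derivative_S_compose has_derivative_fst has_derivative_snd has_derivative_ident z domD(1)[OF z])

lemma DS_0: "x \<in> U \<Longrightarrow> DS x 0 v = 0"
  using linear_0[OF has_derivative_linear[OF has_derivative_S]] by blast

lemma DV_vertical:
  "z \<in> dom \<Longrightarrow> DV z (0, v) = \<Gamma> (fst z) (snd z) v - (K z *\<^sub>R S (fst z) v + dK z v *\<^sub>R S (fst z) (snd z))"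
  by (simp add: DV_def DK_vertical DS_0 domD linear_0[OF G.DB_linear])

lemma DV_vertical_differentiable:
  assumes z: "z \<in> dom"
  shows "(\<lambda>w. DV w (0, v)) differentiable (at z)"
proof -
  note x = domD(1)[OF z]
  have "((\<lambda>w. \<Gamma> (fst w) (snd w) v - (K w *\<^sub>R S (fst w) v + dK w v *\<^sub>R S (fst w) (snd w))) has_derivative
    (\<lambda>d. (D\<Gamma> (fst z) (fst d) (snd z) v + \<Gamma> (fst z) (snd d) v) -
      ((K z *\<^sub>R (DS (fst z) (fst d) v + S (fst z) 0) + DK z d *\<^sub>R S (fst z) v)
       + (dK z v *\<^sub>R (DS (fst z) (fst d) (snd z) + S (fst z) (snd d)) + DdK z v d *\<^sub>R S (fst z) (snd z))))) (at z)"
    by (intro has_derivative_diff has_derivative_add has_derivative_scaleR has_derivative_\<Gamma>_fibre has_derivative_K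
      has_derivative_dK has_derivative_S_compose has_derivative_fst has_derivative_snd has_derivative_ident
      has_derivative_const z x)
  then show ?thesis
    using has_derivative_transform_within_open[OF _ open_dom z] DV_vertical unfolding differentiable_def
    by (metis (no_types, lifting))
qed

text \<open>The correction to the spray has no fibre divergence: \<open>tr S = 0\<close>, and the
  rank one part has trace \<open>dK z (S y) = 0\<close>. Hence the function differentiated by
  \<open>T\<close> in \<open>ricci_curvature_eqI\<close> is that of the Riemannian spray.\<close>

lemma tr_DV_vertical:
  assumes z: "z \<in> dom"
  shows "tr (\<lambda>v. DV z (0, v)) = tr (\<Gamma> (fst z) (snd z))"
  unfolding DV_vertical[OF z]
  by (simp add: tr_diff tr_add tr_scaleR tr_rank_one[OF dK_linear[OF z]] tr_S[OF domD(1)[OF z]] dK_Sy[OF z])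

lemma has_derivative_tr_DV:
  assumes z: "z \<in> dom"
  shows "((\<lambda>w. tr (\<lambda>v. DV w (0, v))) has_derivative
    (\<lambda>d. tr (\<lambda>v. D\<Gamma> (fst z) (fst d) (snd z) v + \<Gamma> (fst z) (snd d) v))) (at z)"
  by (rule has_derivative_transform_within_open[OF has_derivative_tr[OF has_derivative_\<Gamma>_fibre[OF domD(1)[OF z]]] open_dom z])
    (simp add: tr_DV_vertical)

text \<open>With \<open>g = \<Gamma> y\<close> and \<open>s = S\<close>, the vertical derivative is
  \<open>g - K s\<close> minus the rank one map \<open>v \<mapsto> dK v *\<^sub>R s y\<close>.
  Traces involving the latter are values of \<open>dK\<close>, and \<open>dK (s y) = 0\<close>
  removes its square.\<close>

lemma tr_DV_squared:
  assumes z: "z \<in> dom"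
  shows "tr (\<lambda>v. DV z (0, DV z (0, v))) = tr (\<lambda>v. \<Gamma> (fst z) (snd z) (\<Gamma> (fst z) (snd z) v))
    - 2 * dK z (\<Gamma> (fst z) (snd z) (S (fst z) (snd z))) - 2 * K z * tr (\<lambda>v. \<Gamma> (fst z) (snd z) (S (fst z) v))
    + 2 * K z * dK z (S (fst z) (S (fst z) (snd z))) + (K z)\<^sup>2 * tr (\<lambda>v. S (fst z) (S (fst z) v))"
proof -
  note x = domD(1)[OF z]
  define g where "g = \<Gamma> (fst z) (snd z)"
  define s where "s = S (fst z)"
  define y where "y = snd z"
  define A where "A v = DV z (0, v)" for v
  have A: "A v = g v - (K z *\<^sub>R s v + dK z v *\<^sub>R s y)" for v
    by (simp add: A_def DV_vertical[OF z] g_def s_def y_def)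
  have g: "linear g" using G.bil[OF x] by (simp add: g_def bilinear_def)
  have s: "linear s" by (simp add: s_def S_linear[OF x])
  have d: "linear (dK z)" by (rule dK_linear[OF z])
  note l = linear_add[OF g] linear_diff[OF g] linear_scale[OF g] linear_add[OF s] linear_diff[OF s] linear_scale[OF s]
    linear_add[OF d] linear_diff[OF d] linear_scale[OF d]
  have dA: "linear (\<lambda>v. dK z (A v))" unfolding A by (rule linearI) (simp_all add: l algebra_simps)
  have sy: "dK z (s y) = 0" unfolding s_def y_def by (rule dK_Sy[OF z])
  have sg: "tr (\<lambda>v. s (g v)) = tr (\<lambda>v. g (s v))" by (rule tr_comp_commute[OF s g])
  have "(\<lambda>v. A (A v)) = (\<lambda>v. (g (g v) - (K z *\<^sub>R g (s v) + dK z v *\<^sub>R g (s y)))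
     - (K z *\<^sub>R (s (g v) - (K z *\<^sub>R s (s v) + dK z v *\<^sub>R s (s y))) + dK z (A v) *\<^sub>R s y))"
    by (rule ext, subst (1) A) (simp add: A l)
  then have "tr (\<lambda>v. A (A v)) = (tr (\<lambda>v. g (g v)) - (K z * tr (\<lambda>v. g (s v)) + dK z (g (s y))))
     - (K z * (tr (\<lambda>v. s (g v)) - (K z * tr (\<lambda>v. s (s v)) + dK z (s (s y)))) + dK z (A (s y)))"
    by (simp only: tr_diff tr_add tr_scaleR tr_rank_one[OF d] tr_rank_one[OF dA])
  moreover have "dK z (A (s y)) = dK z (g (s y)) - K z * dK z (s (s y))"
    by (simp add: A l sy)
  ultimately have "tr (\<lambda>v. A (A v)) = tr (\<lambda>v. g (g v)) - 2 * dK z (g (s y)) - 2 * K z * tr (\<lambda>v. g (s v))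
    + 2 * K z * dK z (s (s y)) + (K z)\<^sup>2 * tr (\<lambda>v. s (s v))"
    by (simp add: sg algebra_simps power2_eq_square)
  then show ?thesis by (simp add: A_def g_def s_def y_def)
qed

text \<open>The Riemannian block is \<open>s H y y\<close>, which is \<open>2 K s \<beta>\<close> by
  the definition of \<open>K\<close>; this is exactly what \<open>- 2 K\<close> times the divergence
  of \<open>S\<close> at \<open>y\<close>, with value \<open>s \<beta>\<close>, takes away.\<close>

lemma ricci_curvature_K:
  assumes F: "\<And>w. w \<in> dom \<Longrightarrow> F w = K w" and z: "z \<in> dom"
    and ein: "\<And>y. B (fst z) y y = s * H (fst z) y y"
  shows "ricci_curvature F z = s * (F z)\<^sup>2"
proof -
  note x = domD(1)[OF z]
  have b: "\<beta> z \<noteq> 0" using domD(2)[OF z] by simp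
  let ?x = "fst z" and ?y = "snd z" and ?Sy = "S (fst z) (snd z)"
  have DK: "linear (\<lambda>v. DK z (v, 0))"
    using has_derivative_linear[OF has_derivative_K[OF z]]
    by (simp add: linear_iff) (metis add.right_neutral add_Pair scaleR_Pair scaleR_zero_right)
  have "ricci_curvature F z = 2 * tr (\<lambda>v. DV z (v, 0))
    - tr (\<lambda>v. D\<Gamma> ?x (fst (?y, 0::real^'n)) ?y v + \<Gamma> ?x (snd (?y, 0::real^'n)) v)
    + 2 * tr (\<lambda>v. D\<Gamma> ?x (fst (0::real^'n, V z)) ?y v + \<Gamma> ?x (snd (0::real^'n, V z)) v)
    - tr (\<lambda>v. DV z (0, DV z (0, v)))"
    by (rule ricci_curvature_eqI[OF open_dom z spray_coeff_K[OF F] has_derivative_V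
          DV_vertical_differentiable[OF z] has_derivative_tr_DV[OF z]])
  also have "tr (\<lambda>v. D\<Gamma> ?x (fst (?y, 0::real^'n)) ?y v + \<Gamma> ?x (snd (?y, 0::real^'n)) v) = tr (\<lambda>v. D\<Gamma> ?x ?y ?y v)"
    by (simp add: \<Gamma>_simps[OF x])
  also have "tr (\<lambda>v. D\<Gamma> ?x (fst (0::real^'n, V z)) ?y v + \<Gamma> ?x (snd (0::real^'n, V z)) v)
      = 1/2 * tr (\<lambda>v. \<Gamma> ?x (\<Gamma> ?x ?y ?y) v) - K z * tr (\<lambda>v. \<Gamma> ?x ?Sy v)"
    by (simp add: V_def \<Gamma>_simps[OF x] linear_0[OF G.DB_linear[OF x]] tr_diff tr_scaleR)
  also have "tr (\<lambda>v. DV z (v, 0)) = 1/2 * tr (\<lambda>v. D\<Gamma> ?x v ?y ?y) - (K z * tr (\<lambda>v. DS ?x v ?y) + DK z (?Sy, 0))"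
    by (simp add: DV_def \<Gamma>_simps[OF x] S_simps[OF x] tr_diff tr_add tr_scaleR tr_rank_one[OF DK])
  also note tr_DV_squared[OF z]
  finally have "ricci_curvature F z =
      (tr (\<lambda>v. D\<Gamma> ?x v ?y ?y) - tr (\<lambda>v. D\<Gamma> ?x ?y ?y v) + tr (\<lambda>v. \<Gamma> ?x (\<Gamma> ?x ?y ?y) v) - tr (\<lambda>v. \<Gamma> ?x ?y (\<Gamma> ?x ?y v)))
      - 2 * K z * (tr (\<lambda>v. DS ?x v ?y) + tr (\<lambda>v. \<Gamma> ?x ?Sy v) - tr (\<lambda>v. \<Gamma> ?x ?y (S ?x v)))
      - (K z)\<^sup>2 * tr (\<lambda>v. S ?x (S ?x v))
      - 2 * (DK z (?Sy, 0) - dK z (\<Gamma> ?x ?y ?Sy) + K z * dK z (S ?x ?Sy))"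
    by (simp add: algebra_simps)
  also have "tr (\<lambda>v. D\<Gamma> ?x v ?y ?y) - tr (\<lambda>v. D\<Gamma> ?x ?y ?y v) + tr (\<lambda>v. \<Gamma> ?x (\<Gamma> ?x ?y ?y) v) - tr (\<lambda>v. \<Gamma> ?x ?y (\<Gamma> ?x ?y v))
      = s * H ?x ?y ?y"
    by (simp only: B_diag[OF x] ein)
  also have "tr (\<lambda>v. DS ?x v ?y) + tr (\<lambda>v. \<Gamma> ?x ?Sy v) - tr (\<lambda>v. \<Gamma> ?x ?y (S ?x v)) = s * \<beta> z"
  proof -
    have "tr (\<lambda>v. DS ?x v ?y) + tr (\<lambda>v. \<Gamma> ?x ?Sy v) - tr (\<lambda>v. \<Gamma> ?x ?y (S ?x v)) = B ?x ?y (W ?x)"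
      unfolding divergence_S[OF x, symmetric] tr_add tr_diff \<Gamma>_sym[OF x, of _ ?Sy] ..
    then show ?thesis
      by (simp add: B_polarization[OF x ein] H_sym[OF x, of ?y])
  qed
  also have "tr (\<lambda>v. S ?x (S ?x v)) = - s"
    by (simp add: tr_S_squared[OF x] ein W_unit[OF x])
  \<comment> \<open>Besides the Christoffel term, \<open>DK\<close> in the coordinate direction
    \<open>(S y, 0)\<close> contains \<open>- K H (S (S y)) y / \<beta>\<close>; this cancels
    \<open>K dK (S (S y))\<close>, as the image of \<open>S\<close> is orthogonal to
    \<open>W\<close>.\<close>
  also have "DK z (?Sy, 0) - dK z (\<Gamma> ?x ?y ?Sy) + K z * dK z (S ?x ?Sy) = 0"
    by (simp add: DK_def dK_def S_orth[OF x] H_sym[OF x, of ?y "S ?x ?Sy"])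
  also have "s * H ?x ?y ?y = 2 * K z * (s * \<beta> z)"
    using b by (simp add: K_def)
  finally show ?thesis by (simp add: F[OF z])
qed

section \<open>Smoothness of the Kropina metric\<close>

lemma Ck_H_compose:
  assumes "open T" "\<And>z. z \<in> T \<Longrightarrow> fst z \<in> U" "Ck k T a" "Ck k T b"
  shows "Ck k T (\<lambda>z. H (fst z) (a z) (b z))"
proof (rule Ck_cong[OF assms(1)])
  show "(\<Sum>i\<in>Basis. \<Sum>j\<in>Basis. ((a z \<bullet> i) * (b z \<bullet> j)) * H (fst z) i j) = H (fst z) (a z) (b z)"
    if "z \<in> T" for z
    using bilinear_expand[OF H_bil[OF assms(2)[OF that]], of "a z" "b z"] by simp
  have "Ck k T (\<lambda>z. H (0 + fst z) i j)" for i j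
    by (rule Ck_affine_compose[OF open_U assms(1) bounded_linear_fst _ smooth_on_Ck[OF H_smooth]])
      (use assms(2) in simp)
  then show "Ck k T (\<lambda>z. \<Sum>i\<in>Basis. \<Sum>j\<in>Basis. ((a z \<bullet> i) * (b z \<bullet> j)) * H (fst z) i j)"
    by (intro Ck_sum Ck_mult Ck_bounded_linear[OF _ bounded_linear_inner_left] assms) simp
qed

lemma smooth_K: "smooth_on dom K"
  unfolding smooth_on_def
proof
  fix k
  have "Ck k UNIV (\<lambda>x :: real ^ 'n. x)"
  proof (cases k)
    case (Suc m)
    show ?thesis unfolding Suc
      by (rule Ck_SucI[OF open_UNIV has_derivative_ident]) (rule Ck_const[OF open_UNIV])
  qed simp
  then have y: "Ck k dom snd"
    using Ck_affine_compose[OF open_UNIV open_dom bounded_linear_snd, of 0 k "\<lambda>x. x"] by simp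
  have "Ck k dom (\<lambda>z. W (0 + fst z))"
    by (rule Ck_affine_compose[OF open_U open_dom bounded_linear_fst _ smooth_on_Ck[OF W_smooth]])
      (use domD in simp)
  then have w: "Ck k dom (\<lambda>z. W (fst z))" by simp
  have "Ck k dom \<beta>"
    by (rule Ck_H_compose[OF open_dom _ w y]) (rule domD(1))
  then have "Ck k dom (\<lambda>z. 2 * \<beta> z)"
    by (rule Ck_mult[OF open_dom Ck_const[OF open_dom]])
  then have i: "Ck k dom (\<lambda>z. inverse (2 * \<beta> z))"
    by (rule Ck_inverse[OF open_dom]) (drule domD(2), simp)
  have q: "Ck k dom (\<lambda>z. H (fst z) (snd z) (snd z))"
    by (rule Ck_H_compose[OF open_dom _ y y]) (rule domD(1))
  show "Ck k dom K"
  proof (rule Ck_cong[OF open_dom _ Ck_mult[OF open_dom q i]])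
    show "H (fst z) (snd z) (snd z) * inverse (2 * \<beta> z) = K z" for z
      unfolding K_def divide_inverse ..
  qed
qed

end

section \<open>Charts and tangent vectors\<close>

locale smooth_manifold =
  fixes A :: "('m::{t2_space, second_countable_topology}, 'n::finite) chart set"
  assumes smooth_structure: "smooth_structure A"
begin

lemma is_chart: "c \<in> A \<Longrightarrow> is_chart c"
  using smooth_structure by (simp add: smooth_structure_def)

lemma open_chart: "c \<in> A \<Longrightarrow> open (fst c)"
  and open_image: "c \<in> A \<Longrightarrow> open (chart_image c)"
  and homeomorphism: "c \<in> A \<Longrightarrow> homeomorphism (fst c) (chart_image c) (snd c) (chart_inv c)"
  using is_chart by (auto simp: is_chart_def)

lemma chart_inv_chart: "c \<in> A \<Longrightarrow> p \<in> fst c \<Longrightarrow> chart_inv c (snd c p) = p"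
  and chart_chart_inv: "c \<in> A \<Longrightarrow> x \<in> chart_image c \<Longrightarrow> snd c (chart_inv c x) = x"
  and chart_inv_in: "c \<in> A \<Longrightarrow> x \<in> chart_image c \<Longrightarrow> chart_inv c x \<in> fst c"
  and continuous_chart_inv: "c \<in> A \<Longrightarrow> continuous_on (chart_image c) (chart_inv c)"
  and continuous_chart: "c \<in> A \<Longrightarrow> continuous_on (fst c) (snd c)"
  using homeomorphism[of c] by (auto simp: homeomorphism_def chart_image_def)

lemma chart_in: "p \<in> fst c \<Longrightarrow> snd c p \<in> chart_image c"
  by (simp add: chart_image_def)

lemma charts_at_in: "c \<in> A \<Longrightarrow> x \<in> chart_image c \<Longrightarrow> c \<in> charts_at A (chart_inv c x)"
  by (simp add: charts_at_def chart_inv_in)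

lemma charts_atD: "c \<in> charts_at A p \<Longrightarrow> c \<in> A" "c \<in> charts_at A p \<Longrightarrow> p \<in> fst c"
  by (auto simp: charts_at_def)

lemma charts_at_nonempty: "\<exists>c. c \<in> charts_at A p"
proof -
  have "(\<Union>c\<in>A. fst c) = UNIV" using smooth_structure unfolding smooth_structure_def by blast
  then show ?thesis unfolding charts_at_def by blast
qed

text \<open>Presents a chart overlap as a preimage, so that its openness comes from continuity of
  \<open>chart_inv\<close>.\<close>

lemma overlap_eq:
  assumes c: "c \<in> A"
  shows "snd c ` (fst c \<inter> X) = chart_image c \<inter> chart_inv c -` X"
proof
  show "snd c ` (fst c \<inter> X) \<subseteq> chart_image c \<inter> chart_inv c -` X"
    using c by (auto simp: chart_inv_chart chart_in)
  show "chart_image c \<inter> chart_inv c -` X \<subseteq> snd c ` (fst c \<inter> X)"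
  proof
    show "x \<in> snd c ` (fst c \<inter> X)" if "x \<in> chart_image c \<inter> chart_inv c -` X" for x
      using that chart_inv_in[OF c] chart_chart_inv[OF c, symmetric] by auto
  qed
qed

lemma open_overlap: "c \<in> A \<Longrightarrow> open X \<Longrightarrow> open (chart_image c \<inter> chart_inv c -` X)"
  by (rule continuous_open_preimage[OF continuous_chart_inv open_image])

lemma smooth_transition:
  "c \<in> A \<Longrightarrow> d \<in> A \<Longrightarrow> smooth_on (chart_image c \<inter> chart_inv c -` fst d) (transition c d)"
  using smooth_structure unfolding overlap_eq[of c "fst d", symmetric] smooth_structure_def compatible_def
  by blast

lemma has_derivative_transition:
  assumes "c \<in> charts_at A p" "d \<in> charts_at A p"
  shows "(transition c d has_derivative frechet_derivative (transition c d) (at (snd c p))) (at (snd c p))"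
  using assms
  by (intro smooth_onD[OF smooth_transition]) (auto simp: charts_at_def chart_in chart_inv_chart)

text \<open>A chain rule with two uses: taking \<open>snd e\<close> for \<open>f\<close> gives the
  cocycle law of the transition maps, and taking \<open>snd d \<circ> f\<close> gives the chart
  independence of \<open>tangent_map\<close>.\<close>

lemma frechet_derivative_change_chart:
  fixes f :: "'m \<Rightarrow> 'b::real_normed_vector"
  assumes c: "c \<in> charts_at A p" and d: "d \<in> charts_at A p"
    and f: "(f \<circ> chart_inv d) differentiable (at (snd d p))"
  shows "frechet_derivative (f \<circ> chart_inv d) (at (snd d p)) (frechet_derivative (transition c d) (at (snd c p)) y)
    = frechet_derivative (f \<circ> chart_inv c) (at (snd c p)) y"
proof -
  note c' = charts_atD[OF c] and d' = charts_atD[OF d]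
  have td: "transition c d (snd c p) = snd d p"
    using c' by (simp add: transition_def chart_inv_chart)
  have "((f \<circ> chart_inv d) has_derivative frechet_derivative (f \<circ> chart_inv d) (at (snd d p)))
      (at (transition c d (snd c p)))"
    unfolding td by (rule has_derivative_frechet[OF f])
  from has_derivative_compose[OF has_derivative_transition[OF c d] this]
  have "((\<lambda>x. (f \<circ> chart_inv d) (transition c d x)) has_derivative
     (\<lambda>y. frechet_derivative (f \<circ> chart_inv d) (at (snd d p)) (frechet_derivative (transition c d) (at (snd c p)) y)))
      (at (snd c p))" .
  then have "((f \<circ> chart_inv c) has_derivative
     (\<lambda>y. frechet_derivative (f \<circ> chart_inv d) (at (snd d p)) (frechet_derivative (transition c d) (at (snd c p)) y)))
      (at (snd c p))"
  proof (rule has_derivative_transform_within_open)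
    show "open (chart_image c \<inter> chart_inv c -` fst d)"
      by (rule open_overlap[OF c'(1) open_chart[OF d'(1)]])
    show "snd c p \<in> chart_image c \<inter> chart_inv c -` fst d"
      using c' d' by (simp add: chart_in chart_inv_chart)
    show "(f \<circ> chart_inv d) (transition c d x) = (f \<circ> chart_inv c) x"
      if "x \<in> chart_image c \<inter> chart_inv c -` fst d" for x
      using that d' by (simp add: transition_def chart_inv_chart)
  qed
  then show ?thesis by (simp add: frechet_derivative_eq)
qed

lemma transition_cocycle:
  assumes c: "c \<in> charts_at A p" and d: "d \<in> charts_at A p" and e: "e \<in> charts_at A p"
  shows "frechet_derivative (transition d e) (at (snd d p)) (frechet_derivative (transition c d) (at (snd c p)) y)
    = frechet_derivative (transition c e) (at (snd c p)) y"
  using frechet_derivative_change_chart[OF c d, of "snd e" y] has_derivative_transition[OF d e]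
  unfolding transition_def differentiable_def by blast

lemma transition_self:
  assumes c: "c \<in> charts_at A p"
  shows "frechet_derivative (transition c c) (at (snd c p)) y = y"
proof -
  note c' = charts_atD[OF c]
  have "(transition c c has_derivative (\<lambda>y. y)) (at (snd c p))"
    by (rule has_derivative_transform_within_open[OF has_derivative_ident open_image[OF c'(1)] chart_in[OF c'(2)]])
      (simp add: transition_def chart_chart_inv[OF c'(1)])
  then show ?thesis by (simp add: frechet_derivative_eq)
qed

lemma tvec_of_component:
  "d \<in> charts_at A p \<Longrightarrow> tvec_of A c p y d = frechet_derivative (transition c d) (at (snd c p)) y"
  by (simp add: tvec_of_def)

lemma tvec_of_self: "c \<in> charts_at A p \<Longrightarrow> tvec_of A c p y c = y"
  by (simp add: tvec_of_component transition_self)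

lemma tvec_of_in: "c \<in> charts_at A p \<Longrightarrow> tvec_of A c p y \<in> tangent_space A p"
  by (simp add: tangent_space_def tvec_of_def transition_cocycle)

lemma tvec_of_eq:
  assumes "v \<in> tangent_space A p" "c \<in> charts_at A p"
  shows "tvec_of A c p (v c) = v"
proof
  fix d
  have "d \<notin> charts_at A p \<Longrightarrow> v d = 0"
    and "d \<in> charts_at A p \<Longrightarrow> v d = frechet_derivative (transition c d) (at (snd c p)) (v c)"
    using assms unfolding tangent_space_def by blast+
  then show "tvec_of A c p (v c) d = v d" unfolding tvec_of_def by presburger
qed

lemma tvec_of_linear: "c \<in> charts_at A p \<Longrightarrow> linear (\<lambda>y. tvec_of A c p y d)"
  unfolding tvec_of_def
  using has_derivative_linear[OF has_derivative_transition, of c p d]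
  by (cases "d \<in> charts_at A p") (simp_all add: linear_iff)

lemma tangent_space_scaleR:
  assumes v: "v \<in> tangent_space A p"
  shows "(\<lambda>c. t *\<^sub>R v c) \<in> tangent_space A p"
proof -
  obtain c where c: "c \<in> charts_at A p" using charts_at_nonempty by blast
  have "(\<lambda>d. t *\<^sub>R v d) = tvec_of A c p (t *\<^sub>R v c)"
  proof
    show "t *\<^sub>R v d = tvec_of A c p (t *\<^sub>R v c) d" for d
      by (simp add: linear_scale[OF tvec_of_linear[OF c]] tvec_of_eq[OF v c])
  qed
  then show ?thesis using tvec_of_in[OF c] by simp
qed

text \<open>Removes the arbitrary chart hidden in \<open>tangent_map\<close>. Differentiability is
  asked in every chart at \<open>p\<close> because the chosen one is unknown.\<close>

lemma tangent_map_tvec_of: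
  assumes c: "c \<in> charts_at A p" and d: "d \<in> charts_at A (f p)"
    and f: "\<And>c. c \<in> charts_at A p \<Longrightarrow> (snd d \<circ> f \<circ> chart_inv c) differentiable (at (snd c p))"
  shows "tangent_map A f p (tvec_of A c p y) d = frechet_derivative (snd d \<circ> f \<circ> chart_inv c) (at (snd c p)) y"
proof -
  define c0 where "c0 = (SOME c. c \<in> charts_at A p)"
  have c0: "c0 \<in> charts_at A p" unfolding c0_def using charts_at_nonempty by (rule someI_ex)
  have "tangent_map A f p (tvec_of A c p y) d = frechet_derivative ((snd d \<circ> f) \<circ> chart_inv c0) (at (snd c0 p))
    (frechet_derivative (transition c c0) (at (snd c p)) y)"
    using d by (simp add: tangent_map_def Let_def c0_def[symmetric] tvec_of_component[OF c0])
  also have "\<dots> = frechet_derivative ((snd d \<circ> f) \<circ> chart_inv c) (at (snd c p)) y"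
    by (rule frechet_derivative_change_chart[OF c c0 f[OF c0]])
  finally show ?thesis .
qed

lemma metric_eq_local:
  assumes "c \<in> charts_at A p" "u \<in> tangent_space A p" "v \<in> tangent_space A p"
  shows "h p u v = local_metric A h c (snd c p) (u c) (v c)"
  using assms by (simp add: local_metric_def chart_inv_chart charts_atD tvec_of_eq)

lemma metric_chart:
  assumes "riemannian_metric A h" "c \<in> A"
  shows "metric_chart (chart_image c) (local_metric A h c)"
  using assms by unfold_locales (auto simp: riemannian_metric_def open_image)

lemma norm_of_local:
  assumes h: "riemannian_metric A h" and c: "c \<in> A" and w: "fst w \<in> chart_image c"
  shows "(local_finsler A (norm_of h) c w)\<^sup>2 = local_metric A h c (fst w) (snd w) (snd w)"
proof -
  interpret metric_chart "chart_image c" "local_metric A h c" by (rule metric_chart[OF h c])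
  have "local_metric A h c (fst w) (snd w) (snd w) \<ge> 0"
    using H_pos[OF w, of "snd w"] by (cases "snd w = 0") (auto simp: H_simps[OF w])
  then show ?thesis by (simp add: local_finsler_def tangent_point_def norm_of_def local_metric_def)
qed

lemma slit_local_domain:
  assumes c: "c \<in> A" and x: "x \<in> chart_image c" and y: "y \<noteq> 0"
  shows "(x, y) \<in> local_domain A (slit_tangent_bundle A) c"
proof -
  note ca = charts_at_in[OF c x]
  have "tvec_of A c (chart_inv c x) y \<noteq> (\<lambda>_. 0)"
    using tvec_of_self[OF ca, of y] y by (metis (full_types))
  then show ?thesis
    using x tvec_of_in[OF ca] by (simp add: local_domain_def tangent_point_def slit_tangent_bundle_def)
qed

lemma kropina_local_domain:
  assumes c: "c \<in> A" and W: "smooth_vector_field A W"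
  shows "local_domain A (kropina_domain A h W) c =
    {z. fst z \<in> chart_image c \<and> local_metric A h c (fst z) (W (chart_inv c (fst z)) c) (snd z) > 0}"
  using tvec_of_in[OF charts_at_in[OF c]] tvec_of_eq[OF _ charts_at_in[OF c]] W
  by (auto simp: local_domain_def tangent_point_def kropina_domain_def local_metric_def smooth_vector_field_def)

lemma kropina_local:
  assumes c: "c \<in> A" and W: "smooth_vector_field A W" and z: "fst z \<in> chart_image c"
  shows "local_finsler A (kropina h W) c z = local_metric A h c (fst z) (snd z) (snd z) /
    (2 * local_metric A h c (fst z) (W (chart_inv c (fst z)) c) (snd z))"
  using tvec_of_eq[OF _ charts_at_in[OF c z]] W
  by (simp add: local_finsler_def tangent_point_def kropina_def local_metric_def smooth_vector_field_def)

end

section \<open>Translations in a Lie group\<close>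

locale lie_manifold =
  fixes G :: "'g::{t2_space, second_countable_topology} monoid" (structure)
    and A :: "('g, 'n::finite) chart set"
  assumes lie_group: "lie_group G A"
begin

sublocale group G using lie_group by (simp add: lie_group_def)

sublocale smooth_manifold A using lie_group by unfold_locales (simp add: lie_group_def)

lemma carrier [simp]: "x \<in> carrier G"
  using lie_group by (simp add: lie_group_def)

lemma continuous_mult: "continuous_on UNIV (\<lambda>(p, q). p \<otimes> q)"
  using lie_group by (simp add: lie_group_def)

lemma continuous_translation: "continuous_on S (\<lambda>q. g \<otimes> q)"
proof -
  have "continuous_on S (\<lambda>q. (g, q))" by (intro continuous_intros)
  from continuous_on_compose2[OF continuous_mult this] show ?thesis by simp
qed

definition mult_dom :: "('g, 'n) chart \<Rightarrow> ('g, 'n) chart \<Rightarrow> ('g, 'n) chart \<Rightarrow> ((real ^ 'n) \<times> (real ^ 'n)) set" where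
  "mult_dom a b c = {(x, y). x \<in> chart_image a \<and> y \<in> chart_image b \<and> chart_inv a x \<otimes> chart_inv b y \<in> fst c}"

definition mult_loc :: "('g, 'n) chart \<Rightarrow> ('g, 'n) chart \<Rightarrow> ('g, 'n) chart \<Rightarrow> (real ^ 'n) \<times> (real ^ 'n) \<Rightarrow> real ^ 'n" where
  "mult_loc a b c = (\<lambda>(x, y). snd c (chart_inv a x \<otimes> chart_inv b y))"

lemma smooth_mult: "a \<in> A \<Longrightarrow> b \<in> A \<Longrightarrow> c \<in> A \<Longrightarrow> smooth_on (mult_dom a b c) (mult_loc a b c)"
  using lie_group unfolding lie_group_def mult_dom_def mult_loc_def by blast

lemma open_mult_dom:
  assumes a: "a \<in> A" and b: "b \<in> A" and c: "c \<in> A"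
  shows "open (mult_dom a b c)"
proof -
  have "continuous_on (chart_image a \<times> chart_image b) (\<lambda>z. (chart_inv a (fst z), chart_inv b (snd z)))"
    by (intro continuous_on_Pair continuous_on_compose2[OF continuous_chart_inv[OF a]]
        continuous_on_compose2[OF continuous_chart_inv[OF b]] continuous_on_fst continuous_on_snd continuous_on_id) auto
  from continuous_on_compose2[OF continuous_mult this]
  have "continuous_on (chart_image a \<times> chart_image b) (\<lambda>z. chart_inv a (fst z) \<otimes> chart_inv b (snd z))"
    by simp
  then have "open ((chart_image a \<times> chart_image b) \<inter> (\<lambda>z. chart_inv a (fst z) \<otimes> chart_inv b (snd z)) -` fst c)"
    by (rule continuous_open_preimage) (auto intro: open_Times open_image a b open_chart c)
  moreover have "(chart_image a \<times> chart_image b) \<inter> (\<lambda>z. chart_inv a (fst z) \<otimes> chart_inv b (snd z)) -` fst c = mult_dom a b c"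
    by (auto simp: mult_dom_def)
  ultimately show ?thesis by simp
qed

lemma smooth_translation:
  assumes c: "c \<in> A" and d: "d \<in> A"
  shows "smooth_on (chart_image c \<inter> chart_inv c -` ((\<lambda>q. g \<otimes> q) -` fst d)) (\<lambda>x. snd d (g \<otimes> chart_inv c x))"
  unfolding smooth_on_def
proof
  fix k
  obtain a where a: "a \<in> charts_at A g" using charts_at_nonempty by blast
  note a' = charts_atD[OF a]
  let ?T = "chart_image c \<inter> chart_inv c -` ((\<lambda>q. g \<otimes> q) -` fst d)"
  have T: "open ?T"
    by (rule open_overlap[OF c]) (use continuous_open_vimage continuous_translation[of UNIV g] open_chart[OF d] in
      \<open>auto simp: continuous_on_open_vimage\<close>)
  have lin: "bounded_linear (\<lambda>y::real^'n. (0::real^'n, y))"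
    by (intro bounded_linear_Pair bounded_linear_zero bounded_linear_ident)
  \<comment> \<open>The first factor is frozen at the coordinates of \<open>g\<close>, an affine
    substitution into the smooth multiplication.\<close>
  have "Ck k ?T (\<lambda>y. mult_loc a c d ((snd a g, 0) + (0, y)))"
  proof (rule Ck_affine_compose[OF open_mult_dom[OF a'(1) c d] T lin _ smooth_on_Ck[OF smooth_mult[OF a'(1) c d]]])
    show "(snd a g, 0) + (0, y) \<in> mult_dom a c d" if "y \<in> ?T" for y
      using that a' by (simp add: mult_dom_def chart_in chart_inv_chart)
  qed
  then show "Ck k ?T (\<lambda>x. snd d (g \<otimes> chart_inv c x))"
    using a' by (simp add: mult_loc_def chart_inv_chart)
qed

text \<open>The chart \<open>c\<close> transported by left translation: near
  \<open>g \<otimes> p\<close> it assigns the coordinates that \<open>c\<close> assigns near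
  \<open>p\<close>, so that translation by \<open>g\<close> is the identity between the two
  charts.\<close>

definition tchart :: "'g \<Rightarrow> ('g, 'n) chart \<Rightarrow> ('g, 'n) chart" where
  "tchart g c = ((\<lambda>q. g \<otimes> q) ` fst c, \<lambda>q. snd c (inv g \<otimes> q))"

lemma snd_tchart: "snd (tchart g c) q = snd c (inv g \<otimes> q)"
  by (simp add: tchart_def)

lemma inv_mult_cancel [simp]: "inv g \<otimes> (g \<otimes> q) = q" "g \<otimes> (inv g \<otimes> q) = q"
  by (simp_all add: m_assoc[symmetric])

lemma translate_image: "(\<lambda>q. g \<otimes> q) ` X = (\<lambda>q. inv g \<otimes> q) -` X"
  by (auto simp: image_iff) (metis inv_mult_cancel(2))

lemma chart_image_tchart: "chart_image (tchart g c) = chart_image c"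
  by (auto simp: chart_image_def tchart_def image_iff)

lemma chart_inv_tchart:
  assumes c: "c \<in> A" and x: "x \<in> chart_image c"
  shows "chart_inv (tchart g c) x = g \<otimes> chart_inv c x"
proof -
  have "inj_on (snd (tchart g c)) (fst (tchart g c))"
    unfolding tchart_def by (rule inj_onI) (auto, metis c chart_inv_chart)
  moreover have "g \<otimes> chart_inv c x \<in> fst (tchart g c)"
    using chart_inv_in[OF c x] by (simp add: tchart_def)
  moreover have "snd (tchart g c) (g \<otimes> chart_inv c x) = x"
    using chart_chart_inv[OF c x] by (simp add: tchart_def)
  ultimately show ?thesis unfolding chart_inv_def[of "tchart g c"] by (metis inv_into_f_f)
qed

lemma open_vimage_translation: "open X \<Longrightarrow> open ((\<lambda>q. g \<otimes> q) -` X)"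
  using continuous_translation[of UNIV g] by (simp add: continuous_on_open_vimage)

lemma is_chart_tchart:
  assumes c: "c \<in> A"
  shows "is_chart (tchart g c)"
  unfolding is_chart_def chart_image_tchart
proof (intro conjI)
  show "open (fst (tchart g c))"
    unfolding tchart_def fst_conv translate_image
    by (rule open_vimage_translation[OF open_chart[OF c]])
  show "open (chart_image c)" by (rule open_image[OF c])
  show "homeomorphism (fst (tchart g c)) (chart_image c) (snd (tchart g c)) (chart_inv (tchart g c))"
    unfolding homeomorphism_def
  proof (intro conjI ballI)
    show "snd (tchart g c) ` fst (tchart g c) = chart_image c"
      using chart_image_tchart[of g c] by (simp add: chart_image_def)
    show "continuous_on (fst (tchart g c)) (snd (tchart g c))"
      unfolding tchart_def fst_conv snd_conv
      by (rule continuous_on_compose2[OF continuous_chart[OF c] continuous_translation]) auto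
    have "continuous_on (chart_image c) (\<lambda>x. g \<otimes> chart_inv c x)"
      by (rule continuous_on_compose2[OF continuous_translation[of UNIV] continuous_chart_inv[OF c]]) auto
    then show "continuous_on (chart_image c) (chart_inv (tchart g c))"
      by (simp add: chart_inv_tchart[OF c] cong: continuous_on_cong)
    show "chart_inv (tchart g c) (snd (tchart g c) q) = q" if "q \<in> fst (tchart g c)" for q
      using that by (auto simp: tchart_def chart_inv_tchart[OF c, unfolded tchart_def] chart_in chart_inv_chart[OF c])
    show "snd (tchart g c) (chart_inv (tchart g c) x) = x" if "x \<in> chart_image c" for x
      by (simp add: chart_inv_tchart[OF c that] snd_tchart chart_chart_inv[OF c that])
    show "chart_inv (tchart g c) ` chart_image c = fst (tchart g c)"
    proof -
      have "chart_inv (tchart g c) ` chart_image c = (\<lambda>q. g \<otimes> q) ` (chart_inv c ` chart_image c)"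
        by (auto simp: chart_inv_tchart[OF c] image_iff)
      also have "chart_inv c ` chart_image c = fst c"
        using homeomorphism[OF c] by (simp add: homeomorphism_def)
      finally show ?thesis by (simp add: tchart_def)
    qed
  qed
qed

text \<open>Transitions with the translated chart are coordinate forms of left translations by
  \<open>g\<close> and \<open>inv g\<close>, hence smooth; maximality of the atlas then admits the
  chart.\<close>

lemma tchart_in:
  assumes c: "c \<in> A"
  shows "tchart g c \<in> A"
proof -
  have "compatible (tchart g c) d" if d: "d \<in> A" for d
    unfolding compatible_def
  proof
    have e1: "snd (tchart g c) ` (fst (tchart g c) \<inter> fst d) = chart_image c \<inter> chart_inv c -` ((\<lambda>q. g \<otimes> q) -` fst d)"
    proof -
      have "fst (tchart g c) \<inter> fst d = (\<lambda>q. g \<otimes> q) ` (fst c \<inter> (\<lambda>q. g \<otimes> q) -` fst d)"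
        by (auto simp: tchart_def)
      then show ?thesis
        unfolding overlap_eq[OF c, symmetric] by (simp add: image_image snd_tchart)
    qed
    show "smooth_on (snd (tchart g c) ` (fst (tchart g c) \<inter> fst d)) (transition (tchart g c) d)"
      unfolding e1 smooth_on_def
    proof (rule allI, rule Ck_cong)
      show "open (chart_image c \<inter> chart_inv c -` ((\<lambda>q. g \<otimes> q) -` fst d))"
        by (rule open_overlap[OF c open_vimage_translation[OF open_chart[OF d]]])
      show "snd d (g \<otimes> chart_inv c x) = transition (tchart g c) d x"
        if "x \<in> chart_image c \<inter> chart_inv c -` ((\<lambda>q. g \<otimes> q) -` fst d)" for x
        using that by (simp add: transition_def chart_inv_tchart[OF c])
      show "Ck k (chart_image c \<inter> chart_inv c -` ((\<lambda>q. g \<otimes> q) -` fst d)) (\<lambda>x. snd d (g \<otimes> chart_inv c x))" for k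
        by (rule smooth_on_Ck[OF smooth_translation[OF c d]])
    qed
    have e2: "snd d ` (fst (tchart g c) \<inter> fst d) = chart_image d \<inter> chart_inv d -` ((\<lambda>q. inv g \<otimes> q) -` fst c)"
      unfolding overlap_eq[OF d, symmetric] tchart_def fst_conv translate_image by (simp add: Int_commute)
    show "smooth_on (snd d ` (fst (tchart g c) \<inter> fst d)) (transition d (tchart g c))"
    proof -
      have "transition d (tchart g c) = (\<lambda>x. snd c (inv g \<otimes> chart_inv d x))"
        by (simp add: fun_eq_iff transition_def snd_tchart)
      then show ?thesis unfolding e2 using smooth_translation[OF d c] by simp
    qed
  qed
  then show ?thesis
    using is_chart_tchart[OF c] smooth_structure unfolding smooth_structure_def by blast
qed

lemma translation_differentiable:
  assumes "c \<in> charts_at A p" "d \<in> charts_at A (g \<otimes> p)"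
  shows "(snd d \<circ> (\<lambda>q. g \<otimes> q) \<circ> chart_inv c) differentiable (at (snd c p))"
  unfolding o_def
  by (rule smooth_on_differentiable[OF smooth_translation[of c d g]])
    (use assms in \<open>auto simp: charts_at_def chart_in chart_inv_chart\<close>)

text \<open>Read in \<open>c\<close> and \<open>tchart g c\<close>, the translation is the identity,
  so its differential keeps the components \<open>y\<close>.\<close>

lemma tangent_map_translation:
  assumes c: "c \<in> charts_at A p"
  shows "tangent_map A (\<lambda>q. g \<otimes> q) p (tvec_of A c p y) = tvec_of A (tchart g c) (g \<otimes> p) y"
proof
  note c' = charts_atD[OF c]
  have tc: "tchart g c \<in> charts_at A (g \<otimes> p)"
    using tchart_in[OF c'(1)] c'(2) by (simp add: charts_at_def tchart_def)
  have x: "snd (tchart g c) (g \<otimes> p) = snd c p" by (simp add: tchart_def)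
  fix d
  show "tangent_map A (\<lambda>q. g \<otimes> q) p (tvec_of A c p y) d = tvec_of A (tchart g c) (g \<otimes> p) y d"
  proof (cases "d \<in> charts_at A (g \<otimes> p)")
    case True
    have "tangent_map A (\<lambda>q. g \<otimes> q) p (tvec_of A c p y) d
      = frechet_derivative (snd d \<circ> (\<lambda>q. g \<otimes> q) \<circ> chart_inv c) (at (snd c p)) y"
      by (rule tangent_map_tvec_of[OF c True translation_differentiable[OF _ True]])
    also have "frechet_derivative (snd d \<circ> (\<lambda>q. g \<otimes> q) \<circ> chart_inv c) (at (snd c p))
      = frechet_derivative (transition (tchart g c) d) (at (snd c p))"
      by (rule frechet_derivative_transform_within_open[OF translation_differentiable[OF c True] open_image[OF c'(1)]])
        (use c' in \<open>simp_all add: chart_in transition_def chart_inv_tchart\<close>)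
    finally show ?thesis by (simp add: tvec_of_component[OF True] x)
  next
    case False
    then show ?thesis by (simp add: tangent_map_def tvec_of_def Let_def)
  qed
qed

lemma left_invariant_tchart:
  assumes h: "left_invariant_metric G A h" and c: "c \<in> A" and x: "x \<in> chart_image c"
  shows "local_metric A h (tchart g c) x u v = local_metric A h c x u v"
proof -
  note ca = charts_at_in[OF c x]
  show ?thesis
    using h tvec_of_in[OF ca]
    unfolding left_invariant_metric_def local_metric_def chart_inv_tchart[OF c x] tangent_map_translation[OF ca, symmetric]
    by blast
qed

text \<open>Transfers the Einstein condition to the bilinear expression \<open>B\<close>. The slit
  tangent bundle leaves out \<open>y = 0\<close>, which is treated separately because polarization
  uses all \<open>y\<close>.\<close>

lemma einstein_B:
  assumes h: "riemannian_metric A h" and e: "riemannian_einstein A h \<sigma>"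
    and c: "c \<in> A" and x: "x \<in> chart_image c"
  shows "metric_chart.B (local_metric A h c) x y y = \<sigma> (chart_inv c x) * local_metric A h c x y y"
proof -
  interpret metric_chart "chart_image c" "local_metric A h c" by (rule metric_chart[OF h c])
  show ?thesis
  proof (cases "y = 0")
    case True
    have "B x 0 0 = 0" using B_add[OF x, of 0 0 0] by simp
    then show ?thesis by (simp add: True H_simps[OF x])
  next
    case False
    have "ricci_curvature (local_finsler A (norm_of h) c) (x, y) = B x y y"
      by (rule ricci_curvature_H[OF norm_of_local[OF h c] x])
    moreover have "ricci_curvature (local_finsler A (norm_of h) c) (x, y)
      = \<sigma> (chart_inv c x) * (local_finsler A (norm_of h) c (x, y))\<^sup>2"
      using e slit_local_domain[OF c x False] c unfolding riemannian_einstein_def einstein_def by fastforce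
    ultimately show ?thesis using norm_of_local[OF h c, of "(x, y)"] x by simp
  qed
qed

lemma einstein_scalar_constant:
  assumes h: "riemannian_metric A h" and l: "left_invariant_metric G A h" and e: "riemannian_einstein A h \<sigma>"
  shows "\<sigma> g = \<sigma> \<one>"
proof -
  obtain c where ca: "c \<in> charts_at A \<one>" using charts_at_nonempty by blast
  note c = charts_atD[OF ca]
  define x where "x = snd c \<one>"
  have x: "x \<in> chart_image c" "chart_inv c x = \<one>"
    using c by (simp_all add: x_def chart_in chart_inv_chart)
  \<comment> \<open>Any nonzero vector serves; \<open>undefined\<close> merely names some
    index.\<close>
  define y :: "real ^ 'n" where "y = axis undefined 1"
  have y: "y \<noteq> 0" by (simp add: y_def axis_eq_0_iff)
  interpret metric_chart "chart_image c" "local_metric A h c" by (rule metric_chart[OF h c(1)])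
  let ?N = "local_finsler A (norm_of h) (tchart g c)"
  note tc = tchart_in[OF c(1), of g]
  have N: "(?N w)\<^sup>2 = local_metric A h c (fst w) (snd w) (snd w)" if "fst w \<in> chart_image c" for w
    using norm_of_local[OF h tc] that by (simp add: chart_image_tchart left_invariant_tchart[OF l c(1)])
  have "\<sigma> \<one> * local_metric A h c x y y = B x y y"
    using einstein_B[OF h e c(1) x(1)] by (simp add: x(2))
  \<comment> \<open>The norm in the translated chart has the square \<open>H\<close> of the original
    chart, so \<open>ricci_curvature_H\<close> returns the same \<open>B\<close>.\<close>
  also have "\<dots> = ricci_curvature ?N (x, y)"
    by (rule ricci_curvature_H[OF N x(1), symmetric])
  also have "\<dots> = \<sigma> (chart_inv (tchart g c) x) * (?N (x, y))\<^sup>2"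
    using e slit_local_domain[OF tc _ y] tc x(1) chart_image_tchart
    unfolding riemannian_einstein_def einstein_def by fastforce
  also have "\<dots> = \<sigma> g * local_metric A h c x y y"
    using N[of "(x, y)"] x by (simp add: chart_inv_tchart[OF c(1)])
  finally show ?thesis using H_pos[OF x(1) y] by simp
qed

section \<open>The Killing equation for a right invariant field\<close>

text \<open>Left invariance with the translating element read in coordinates as well. This makes it
  an identity in both components of \<open>z\<close>, which \<open>killing_equation\<close>
  differentiates in the first one.\<close>

lemma mult_loc_left_invariant:
  assumes h: "left_invariant_metric G A h" and a: "a \<in> A" and c: "c \<in> A" and z: "z \<in> mult_dom a c c"
  shows "local_metric A h c (mult_loc a c c z) (frechet_derivative (mult_loc a c c) (at z) (0, u))
      (frechet_derivative (mult_loc a c c) (at z) (0, v)) = local_metric A h c (snd z) u v"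
proof -
  define g where "g = chart_inv a (fst z)"
  define x where "x = snd z"
  define p where "p = chart_inv c x"
  have x: "x \<in> chart_image c" and s: "fst z \<in> chart_image a" and gp: "g \<otimes> p \<in> fst c"
    using z by (auto simp: mult_dom_def g_def p_def x_def)
  have m: "mult_loc a c c z = snd c (g \<otimes> p)"
    by (simp add: mult_loc_def g_def p_def x_def case_prod_beta)
  have ca: "c \<in> charts_at A p" unfolding p_def by (rule charts_at_in[OF c x])
  have cg: "c \<in> charts_at A (g \<otimes> p)" using gp c by (simp add: charts_at_def)
  have sp: "snd c p = x" unfolding p_def by (rule chart_chart_inv[OF c x])
  have fd: "frechet_derivative (snd c \<circ> (\<lambda>q. g \<otimes> q) \<circ> chart_inv c) (at (snd c p)) w
      = frechet_derivative (mult_loc a c c) (at z) (0, w)" for w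
  proof -
    have "((\<lambda>y. (fst z, y)) has_derivative (\<lambda>w. (0, w))) (at x)"
      by (auto intro!: derivative_eq_intros)
    moreover have "(mult_loc a c c has_derivative frechet_derivative (mult_loc a c c) (at z)) (at (fst z, x))"
      using smooth_onD[OF smooth_mult[OF a c c] z] by (simp add: x_def)
    ultimately have "((\<lambda>y. mult_loc a c c (fst z, y)) has_derivative
        (\<lambda>w. frechet_derivative (mult_loc a c c) (at z) (0, w))) (at x)"
      by (rule has_derivative_compose)
    moreover have "(\<lambda>y. mult_loc a c c (fst z, y)) = snd c \<circ> (\<lambda>q. g \<otimes> q) \<circ> chart_inv c"
      by (simp add: fun_eq_iff mult_loc_def g_def)
    ultimately show ?thesis unfolding sp by (simp add: frechet_derivative_eq)
  qed
  have T: "tangent_map A (\<lambda>q. g \<otimes> q) p (tvec_of A c p w)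
      = tvec_of A c (g \<otimes> p) (frechet_derivative (mult_loc a c c) (at z) (0, w))" for w
  proof -
    have e: "tangent_map A (\<lambda>q. g \<otimes> q) p (tvec_of A c p w) c = frechet_derivative (mult_loc a c c) (at z) (0, w)"
      unfolding fd[symmetric]
      by (rule tangent_map_tvec_of[OF ca cg translation_differentiable[OF _ cg]])
    have "tchart g c \<in> charts_at A (g \<otimes> p)"
      using tchart_in[OF c] charts_atD[OF ca] by (simp add: charts_at_def tchart_def)
    then have "tangent_map A (\<lambda>q. g \<otimes> q) p (tvec_of A c p w) \<in> tangent_space A (g \<otimes> p)"
      unfolding tangent_map_translation[OF ca] by (rule tvec_of_in)
    from tvec_of_eq[OF this cg] show ?thesis unfolding e by (rule sym)
  qed
  have "local_metric A h c (mult_loc a c c z) (frechet_derivative (mult_loc a c c) (at z) (0, u))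
      (frechet_derivative (mult_loc a c c) (at z) (0, v))
    = h (g \<otimes> p) (tangent_map A (\<lambda>q. g \<otimes> q) p (tvec_of A c p u)) (tangent_map A (\<lambda>q. g \<otimes> q) p (tvec_of A c p v))"
    unfolding T m local_metric_def by (simp add: chart_inv_chart[OF c gp])
  also have "\<dots> = h p (tvec_of A c p u) (tvec_of A c p v)"
    using h tvec_of_in[OF ca] unfolding left_invariant_metric_def by blast
  also have "\<dots> = local_metric A h c (snd z) u v" by (simp add: local_metric_def p_def x_def)
  finally show ?thesis .
qed

text \<open>Right invariance moves \<open>W \<one>\<close> to \<open>W p\<close> by differentiating
  the product in its first factor. The chart \<open>a\<close> has to be the one that
  \<open>tangent_map\<close> selects at \<open>\<one>\<close>, hence the
  \<open>SOME\<close>.\<close>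

lemma right_invariant_local:
  assumes W: "right_invariant_field G A W" and c: "c \<in> A" and x: "x \<in> chart_image c"
    and a: "a = (SOME a. a \<in> charts_at A \<one>)"
  shows "W (chart_inv c x) c = frechet_derivative (mult_loc a c c) (at (snd a \<one>, x)) (W \<one> a, 0)"
proof -
  define p where "p = chart_inv c x"
  have ca: "c \<in> charts_at A p" unfolding p_def by (rule charts_at_in[OF c x])
  have "a \<in> charts_at A \<one>" unfolding a using charts_at_nonempty by (rule someI_ex)
  note a' = charts_atD[OF this]
  have z: "(snd a \<one>, x) \<in> mult_dom a c c"
    using a' c x by (simp add: mult_dom_def chart_in chart_inv_chart chart_inv_in)
  have "W p = W (\<one> \<otimes> p)" by simp
  also have "\<dots> = tangent_map A (\<lambda>q. q \<otimes> p) \<one> (W \<one>)"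
    using W unfolding right_invariant_field_def by blast
  finally have "W p c = frechet_derivative (snd c \<circ> (\<lambda>q. q \<otimes> p) \<circ> chart_inv a) (at (snd a \<one>)) (W \<one> a)"
    using ca by (simp add: tangent_map_def Let_def a[symmetric])
  also have "snd c \<circ> (\<lambda>q. q \<otimes> p) \<circ> chart_inv a = (\<lambda>s. mult_loc a c c (s, x))"
    by (simp add: fun_eq_iff mult_loc_def p_def)
  also have "frechet_derivative (\<lambda>s. mult_loc a c c (s, x)) (at (snd a \<one>))
      = (\<lambda>w. frechet_derivative (mult_loc a c c) (at (snd a \<one>, x)) (w, 0))"
  proof (rule frechet_derivative_eq)
    have "((\<lambda>s. (s, x)) has_derivative (\<lambda>w. (w, 0))) (at (snd a \<one>))"
      by (auto intro!: derivative_eq_intros)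
    moreover note smooth_onD[OF smooth_mult[OF a'(1) c c] z]
    ultimately show "((\<lambda>s. mult_loc a c c (s, x)) has_derivative
        (\<lambda>w. frechet_derivative (mult_loc a c c) (at (snd a \<one>, x)) (w, 0))) (at (snd a \<one>))"
      by (rule has_derivative_compose)
  qed
  finally show ?thesis by (simp add: p_def)
qed

text \<open>
  Left translation by \<open>g\<close> is an isometry; differentiating this identity at \<open>g = \<one>\<close> in the direction \<open>W \<one>\<close>
  gives the Killing equation, since \<open>W p\<close> is the derivative of \<open>g \<otimes> p\<close> in that direction.
\<close>

lemma killing_equation:
  assumes h: "riemannian_metric A h" and l: "left_invariant_metric G A h"
    and W: "right_invariant_field G A W" and c: "c \<in> A" and x: "x \<in> chart_image c"
  defines "Wc \<equiv> \<lambda>x. W (chart_inv c x) c"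
  shows "frechet_derivative (\<lambda>x. local_metric A h c x u v) (at x) (Wc x)
      + local_metric A h c x (frechet_derivative Wc (at x) u) v
      + local_metric A h c x u (frechet_derivative Wc (at x) v) = 0"
proof -
  interpret metric_chart "chart_image c" "local_metric A h c" by (rule metric_chart[OF h c])
  let ?H = "local_metric A h c"
  define a where "a = (SOME a. a \<in> charts_at A \<one>)"
  have "a \<in> charts_at A \<one>" unfolding a_def using charts_at_nonempty by (rule someI_ex)
  note a' = charts_atD[OF this]
  define m where "m = mult_loc a c c"
  define Om where "Om = mult_dom a c c"
  define D where "D z = frechet_derivative m (at z)" for z
  define s0 where "s0 = snd a \<one>"
  define w0 where "w0 = W \<one> a"
  have Om: "open Om" unfolding Om_def by (rule open_mult_dom[OF a'(1) c c])
  have sm: "smooth_on Om m" unfolding Om_def m_def by (rule smooth_mult[OF a'(1) c c])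
  have zin: "(s0, y) \<in> Om" if "y \<in> chart_image c" for y
    using a' c that by (simp add: Om_def mult_dom_def s0_def chart_in chart_inv_chart chart_inv_in)
  have m0: "m (s0, y) = y" if "y \<in> chart_image c" for y
    using a' c that by (simp add: m_def mult_loc_def s0_def chart_inv_chart chart_chart_inv)
  have Wc: "Wc y = D (s0, y) (w0, 0)" if "y \<in> chart_image c" for y
    unfolding Wc_def D_def m_def s0_def w0_def by (rule right_invariant_local[OF W c that a_def])
  have slice: "((\<lambda>y. (s0, y)) has_derivative (\<lambda>w. (0, w))) (at x)"
    by (auto intro!: derivative_eq_intros)
  have dm: "(m has_derivative D z) (at z)" if "z \<in> Om" for z
    unfolding D_def by (rule smooth_onD[OF sm that])
  have dD: "((\<lambda>z. D z e) has_derivative frechet_derivative (\<lambda>z. D z e) (at z)) (at z)" if "z \<in> Om" for z e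
    unfolding D_def by (rule smooth_onD[OF smooth_on_deriv[OF sm] that])
  have D0: "D (s0, x) (0, w) = w" for w
  proof -
    have "((\<lambda>y. m (s0, y)) has_derivative (\<lambda>w. D (s0, x) (0, w))) (at x)"
      by (rule has_derivative_compose[OF slice dm[OF zin[OF x]]])
    moreover have "((\<lambda>y. m (s0, y)) has_derivative (\<lambda>w. w)) (at x)"
      by (rule has_derivative_transform_within_open[OF has_derivative_ident open_U x]) (simp add: m0)
    ultimately show ?thesis using has_derivative_unique by metis
  qed
  \<comment> \<open>Mixed second derivative of the multiplication: exchanging the order turns the
    variation of the differential of a translation, in the direction \<open>W \<one>\<close>, into
    the derivative of \<open>W\<close>.\<close>
  have DW: "frechet_derivative (\<lambda>z. D z (0, w)) (at (s0, x)) (w0, 0) = frechet_derivative Wc (at x) w" for w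
  proof -
    have "((\<lambda>y. D (s0, y) (w0, 0)) has_derivative
        (\<lambda>w. frechet_derivative (\<lambda>z. D z (w0, 0)) (at (s0, x)) (0, w))) (at x)"
      by (rule has_derivative_compose[OF slice dD[OF zin[OF x]]])
    then have "(Wc has_derivative (\<lambda>w. frechet_derivative (\<lambda>z. D z (w0, 0)) (at (s0, x)) (0, w))) (at x)"
      by (rule has_derivative_transform_within_open[OF _ open_U x]) (simp add: Wc)
    then have "frechet_derivative Wc (at x) w = frechet_derivative (\<lambda>z. D z (w0, 0)) (at (s0, x)) (0, w)"
      by (simp add: frechet_derivative_eq)
    also have "\<dots> = frechet_derivative (\<lambda>z. D z (0, w)) (at (s0, x)) (w0, 0)"
      unfolding D_def by (rule second_derivative_symmetric[OF Om zin[OF x] smooth_on_Ck[OF sm]])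
    finally show ?thesis by simp
  qed
  have mx: "m (s0, x) \<in> chart_image c" using m0 x by simp
  have "((\<lambda>z. ?H (m z) (D z (0, u)) (D z (0, v))) has_derivative
     (\<lambda>d. DH (m (s0, x)) (D (s0, x) d) (D (s0, x) (0, u)) (D (s0, x) (0, v))
        + ?H (m (s0, x)) (frechet_derivative (\<lambda>z. D z (0, u)) (at (s0, x)) d) (D (s0, x) (0, v))
        + ?H (m (s0, x)) (D (s0, x) (0, u)) (frechet_derivative (\<lambda>z. D z (0, v)) (at (s0, x)) d))) (at (s0, x))"
    by (rule H.has_derivative_family[OF dm[OF zin[OF x]] dD[OF zin[OF x]] dD[OF zin[OF x]] mx])
  moreover have "((\<lambda>z. ?H (m z) (D z (0, u)) (D z (0, v))) has_derivative (\<lambda>d. DH x (snd d) u v)) (at (s0, x))"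
  proof (rule has_derivative_transform_within_open[OF _ Om zin[OF x]])
    have "((\<lambda>x. ?H x u v) has_derivative (\<lambda>a. DH x a u v)) (at (snd (s0, x)))"
      using H.has_derivative_DB[OF x] by simp
    from has_derivative_compose[OF has_derivative_snd[OF has_derivative_ident] this]
    show "((\<lambda>z. ?H (snd z) u v) has_derivative (\<lambda>d. DH x (snd d) u v)) (at (s0, x))" .
    show "?H (snd z) u v = ?H (m z) (D z (0, u)) (D z (0, v))" if "z \<in> Om" for z
      using mult_loc_left_invariant[OF l a'(1) c] that unfolding m_def D_def Om_def by simp
  qed
  ultimately have eq: "(\<lambda>d. DH (m (s0, x)) (D (s0, x) d) (D (s0, x) (0, u)) (D (s0, x) (0, v))
        + ?H (m (s0, x)) (frechet_derivative (\<lambda>z. D z (0, u)) (at (s0, x)) d) (D (s0, x) (0, v))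
        + ?H (m (s0, x)) (D (s0, x) (0, u)) (frechet_derivative (\<lambda>z. D z (0, v)) (at (s0, x)) d))
      = (\<lambda>d. DH x (snd d) u v)"
    by (rule has_derivative_unique)
  from fun_cong[OF eq, of "(w0, 0)"]
  have "DH x (Wc x) u v + ?H x (frechet_derivative Wc (at x) u) v + ?H x u (frechet_derivative Wc (at x) v) = 0"
    by (simp add: m0[OF x] D0 DW Wc[OF x] linear_0[OF H.DB_linear[OF x]])
  then show ?thesis by (simp add: H.DB_def)
qed

lemma killing_chart:
  assumes h: "riemannian_metric A h" and l: "left_invariant_metric G A h"
    and S: "smooth_vector_field A W" and W: "right_invariant_field G A W"
    and n: "\<forall>p. norm_of h p (W p) = 1" and c: "c \<in> A"
  shows "killing_chart (chart_image c) (local_metric A h c) (\<lambda>x. W (chart_inv c x) c)"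
proof -
  interpret metric_chart "chart_image c" "local_metric A h c" by (rule metric_chart[OF h c])
  show ?thesis
  proof
    show "smooth_on (chart_image c) (\<lambda>x. W (chart_inv c x) c)"
      using S c unfolding smooth_vector_field_def by blast
    fix x assume x: "x \<in> chart_image c"
    have "W (chart_inv c x) \<in> tangent_space A (chart_inv c x)"
      using S unfolding smooth_vector_field_def by blast
    then have "tvec_of A c (chart_inv c x) (W (chart_inv c x) c) = W (chart_inv c x)"
      by (rule tvec_of_eq[OF _ charts_at_in[OF c x]])
    moreover have "h (chart_inv c x) (W (chart_inv c x)) (W (chart_inv c x)) = 1"
      using n unfolding norm_of_def by simp
    ultimately show "local_metric A h c x (W (chart_inv c x) c) (W (chart_inv c x) c) = 1"
      by (simp add: local_metric_def)
    show "frechet_derivative (\<lambda>x. local_metric A h c x u v) (at x) (W (chart_inv c x) c) +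
       local_metric A h c x (frechet_derivative (\<lambda>x. W (chart_inv c x) c) (at x) u) v +
       local_metric A h c x u (frechet_derivative (\<lambda>x. W (chart_inv c x) c) (at x) v) = 0" for u v
      by (rule killing_equation[OF h l W c x])
  qed
qed

end

section \<open>The Kropina metric\<close>

locale kropina_navigation = lie_manifold G A
  for G :: "'g::{t2_space, second_countable_topology} monoid" (structure)
    and A :: "('g, 'n::finite) chart set" +
  fixes h :: "'g \<Rightarrow> ('g, 'n) tvec \<Rightarrow> ('g, 'n) tvec \<Rightarrow> real"
    and W :: "'g \<Rightarrow> ('g, 'n) tvec"
  assumes h: "riemannian_metric A h" and l: "left_invariant_metric G A h"
    and S: "smooth_vector_field A W" and W: "right_invariant_field G A W"
    and n: "\<forall>p. norm_of h p (W p) = 1"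
begin

abbreviation "D \<equiv> kropina_domain A h W"
abbreviation "F \<equiv> kropina h W"

lemma killing: "c \<in> A \<Longrightarrow> killing_chart (chart_image c) (local_metric A h c) (\<lambda>x. W (chart_inv c x) c)"
  by (rule killing_chart[OF h l S W n])

lemma local_dom:
  assumes c: "c \<in> A"
  shows "local_domain A D c = killing_chart.dom (chart_image c) (local_metric A h c) (\<lambda>x. W (chart_inv c x) c)"
  unfolding kropina_local_domain[OF c S] killing_chart.dom_def[OF killing[OF c]] ..

lemma local_F:
  assumes c: "c \<in> A" and z: "z \<in> local_domain A D c"
  shows "local_finsler A F c z = killing_chart.K (local_metric A h c) (\<lambda>x. W (chart_inv c x) c) z"
proof -
  have x: "fst z \<in> chart_image c" using z by (simp add: kropina_local_domain[OF c S])
  show ?thesis unfolding kropina_local[OF c S x] killing_chart.K_def[OF killing[OF c]] ..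
qed

lemma W_in: "W p \<in> tangent_space A p"
  using S unfolding smooth_vector_field_def by blast

lemma W_W: "h p (W p) (W p) = 1"
  using n unfolding norm_of_def by simp

lemma tangent_scaled:
  assumes v: "v \<in> tangent_space A p"
  shows "h p (W p) (\<lambda>c. t *\<^sub>R v c) = t * h p (W p) v"
    and "h p (\<lambda>c. t *\<^sub>R v c) (\<lambda>c. t *\<^sub>R v c) = t\<^sup>2 * h p v v"
proof -
  obtain c where ca: "c \<in> charts_at A p" using charts_at_nonempty by blast
  note c = charts_atD[OF ca]
  interpret metric_chart "chart_image c" "local_metric A h c" by (rule metric_chart[OF h c(1)])
  note x = chart_in[OF c(2)]
  show "h p (W p) (\<lambda>c. t *\<^sub>R v c) = t * h p (W p) v"
    and "h p (\<lambda>c. t *\<^sub>R v c) (\<lambda>c. t *\<^sub>R v c) = t\<^sup>2 * h p v v"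
    using v tangent_space_scaleR[OF v, of t] W_in[of p]
    by (simp_all add: metric_eq_local[OF ca] H_simps[OF x] power2_eq_square)
qed

lemma F_pos:
  assumes "(p, v) \<in> D"
  shows "F p v > 0"
proof -
  have v: "v \<in> tangent_space A p" and pos: "h p (W p) v > 0"
    using assms by (auto simp: kropina_domain_def)
  obtain c where ca: "c \<in> charts_at A p" using charts_at_nonempty by blast
  note c = charts_atD[OF ca]
  interpret metric_chart "chart_image c" "local_metric A h c" by (rule metric_chart[OF h c(1)])
  note x = chart_in[OF c(2)]
  have "v c \<noteq> 0" using pos by (auto simp: metric_eq_local[OF ca W_in v] H_simps[OF x])
  then have "h p v v > 0" by (simp add: metric_eq_local[OF ca v v] H_pos[OF x])
  then show ?thesis using pos by (simp add: kropina_def)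
qed

lemma conic_finsler: "conic_finsler_metric A D F"
  unfolding conic_finsler_metric_def
proof (intro conjI)
  show "D \<subseteq> (SIGMA p:UNIV. tangent_space A p)" by (auto simp: kropina_domain_def)
  show "\<forall>p. \<exists>v. (p, v) \<in> D" using W_in W_W by (auto simp: kropina_domain_def intro!: exI[of _ "W _"])
  show "\<forall>(p, v)\<in>D. F p v > 0 \<and>
        (\<forall>t>0. (p, \<lambda>c. t *\<^sub>R v c) \<in> D \<and> F p (\<lambda>c. t *\<^sub>R v c) = t * F p v)"
  proof (clarify, intro conjI allI impI)
    fix p v assume D: "(p, v) \<in> D"
    then have v: "v \<in> tangent_space A p" and pos: "h p (W p) v > 0" by (auto simp: kropina_domain_def)
    show "F p v > 0" by (rule F_pos[OF D])
    fix t :: real assume t: "t > 0"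
    show "(p, \<lambda>c. t *\<^sub>R v c) \<in> D"
      using t pos tangent_space_scaleR[OF v, of t] by (simp add: kropina_domain_def tangent_scaled[OF v])
    show "F p (\<lambda>c. t *\<^sub>R v c) = t * F p v"
      using t pos by (simp add: kropina_def tangent_scaled[OF v] power2_eq_square)
  qed
  show "\<forall>c\<in>A. open (local_domain A D c) \<and>
        smooth_on (local_domain A D c) (local_finsler A F c) \<and>
        (\<forall>z\<in>local_domain A D c. \<forall>u. u \<noteq> 0 \<longrightarrow>
           u \<bullet> (fundamental_tensor (local_finsler A F c) z *v u) > 0)"
  proof (intro ballI conjI allI impI)
    fix c assume c: "c \<in> A"
    interpret killing_chart "chart_image c" "local_metric A h c" "\<lambda>x. W (chart_inv c x) c" by (rule killing[OF c])
    show "open (local_domain A D c)" unfolding local_dom[OF c] by (rule open_dom)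
    show "smooth_on (local_domain A D c) (local_finsler A F c)"
      unfolding smooth_on_def
    proof (rule allI, rule Ck_cong)
      show "open (local_domain A D c)" unfolding local_dom[OF c] by (rule open_dom)
      show "K z = local_finsler A F c z" if "z \<in> local_domain A D c" for z
        using local_F[OF c that] by simp
      show "Ck k (local_domain A D c) K" for k
        unfolding local_dom[OF c] by (rule smooth_on_Ck[OF smooth_K])
    qed
    fix z u assume z: "z \<in> local_domain A D c" and u: "u \<noteq> (0 :: real ^ 'n)"
    show "u \<bullet> (fundamental_tensor (local_finsler A F c) z *v u) > 0"
      by (rule fundamental_tensor_K_pos[OF local_F[OF c] _ u]) (use z in \<open>simp_all add: local_dom[OF c]\<close>)
  qed
qed

lemma einstein_F:
  assumes e: "riemannian_einstein A h \<sigma>"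
  shows "einstein A D F \<sigma>"
  unfolding einstein_def
proof (intro ballI)
  fix c z assume c: "c \<in> A" and z: "z \<in> local_domain A D c"
  interpret killing_chart "chart_image c" "local_metric A h c" "\<lambda>x. W (chart_inv c x) c" by (rule killing[OF c])
  have zd: "z \<in> dom" using z by (simp add: local_dom[OF c])
  show "ricci_curvature (local_finsler A F c) z = \<sigma> (chart_inv c (fst z)) * (local_finsler A F c z)\<^sup>2"
    by (rule ricci_curvature_K[OF _ zd einstein_B[OF h e c domD(1)[OF zd]]])
      (simp add: local_F[OF c] local_dom[OF c])
qed

text \<open>
  Near the boundary of the cone \<open>F\<close> is unbounded: for \<open>u\<close> orthogonal to \<open>W\<close> the value of \<open>F\<close> at \<open>u + t W\<close> is
  \<open>(\<bar>u\<bar>\<^sup>2 + t\<^sup>2) / (2 t)\<close>, whereas a Riemannian norm stays bounded as \<open>t\<close> tends to \<open>0\<close>.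
\<close>

lemma not_riemannian:
  assumes dim: "CARD('n) \<ge> 2"
  shows "\<not> is_riemannian A D F"
proof
  assume "is_riemannian A D F"
  then obtain a where a: "riemannian_metric A a" and Fa: "\<And>p v. (p, v) \<in> D \<Longrightarrow> F p v = norm_of a p v"
    unfolding is_riemannian_def by blast
  obtain c where ca: "c \<in> charts_at A \<one>" using charts_at_nonempty by blast
  note c = charts_atD[OF ca]
  define x where "x = snd c \<one>"
  have x: "x \<in> chart_image c" unfolding x_def by (rule chart_in[OF c(2)])
  interpret R: metric_chart "chart_image c" "local_metric A a c" by (rule metric_chart[OF a c(1)])
  interpret killing_chart "chart_image c" "local_metric A h c" "\<lambda>x. W (chart_inv c x) c" by (rule killing[OF c(1)])
  let ?H = "local_metric A h c x" and ?a = "local_metric A a c x"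
  define w where "w = W (chart_inv c x) c"
  have ww: "?H w w = 1" unfolding w_def by (rule W_unit[OF x])
  \<comment> \<open>Dimension at least two provides a direction outside the line of
    \<open>w\<close>; projecting it off \<open>w\<close> gives \<open>u\<close>.\<close>
  have "\<exists>v. v \<notin> span {w}"
  proof (rule ccontr)
    assume "\<not> ?thesis"
    then have "span {w} = (UNIV :: (real ^ 'n) set)" by blast
    then have "dim (UNIV :: (real ^ 'n) set) \<le> card {w}"
      by (metis dim_le_card finite.emptyI finite.insertI subset_refl)
    then show False using dim by simp
  qed
  then obtain v where v: "v \<notin> span {w}" by blast
  define u where "u = v - ?H v w *\<^sub>R w"
  have u: "u \<noteq> 0" using v unfolding u_def span_singleton by auto
  have uw: "?H w u = 0" unfolding u_def using ww H_sym[OF x, of w v] by (simp add: H_simps[OF x])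
  define k where "k = ?H u u"
  have k: "k > 0" unfolding k_def by (rule H_pos[OF x u])
  \<comment> \<open>This is \<open>4 t\<^sup>2 (F\<^sup>2 - a)\<close> at \<open>u + t w\<close>,
    with the denominator cleared. As a polynomial in \<open>t\<close> that vanishes for
    \<open>t > 0\<close>, it vanishes at 0, where its value is \<open>k\<^sup>2\<close>.\<close>
  define f where "f t = (k + t\<^sup>2)\<^sup>2 - 4 * t\<^sup>2 * (?a u u + 2 * t * ?a u w + t\<^sup>2 * ?a w w)" for t
  have f0: "f t = 0" if t: "t > 0" for t
  proof -
    define y where "y = u + t *\<^sub>R w"
    have wy: "?H w y = t" by (simp add: y_def H_simps[OF x] uw ww)
    have yy: "?H y y = k + t\<^sup>2"
      by (simp add: y_def H_simps[OF x] H_sym[OF x, of u w] uw ww k_def power2_eq_square)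
    have ayy: "?a y y = ?a u u + 2 * t * ?a u w + t\<^sup>2 * ?a w w"
      by (simp add: y_def R.H_simps[OF x] R.H_sym[OF x, of w u] power2_eq_square algebra_simps)
    have z: "(x, y) \<in> local_domain A D c"
      using x wy t by (simp add: kropina_local_domain[OF c(1) S] w_def)
    have "local_finsler A F c (x, y) = local_finsler A (norm_of a) c (x, y)"
      using z Fa by (simp add: local_domain_def local_finsler_def tangent_point_def)
    then have "(local_finsler A F c (x, y))\<^sup>2 = ?a y y"
      using norm_of_local[OF a c(1), of "(x, y)"] x by simp
    moreover have "local_finsler A F c (x, y) = (k + t\<^sup>2) / (2 * t)"
      using kropina_local[OF c(1) S, of "(x, y)"] x wy yy by (simp add: w_def)
    ultimately have "(k + t\<^sup>2)\<^sup>2 = 4 * t\<^sup>2 * ?a y y"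
      using t by (simp add: power_divide field_simps power2_eq_square)
    then show ?thesis by (simp add: f_def ayy)
  qed
  have "(f \<longlongrightarrow> f 0) (at_right 0)"
    unfolding f_def by (intro tendsto_intros)
  moreover have "(f \<longlongrightarrow> 0) (at_right 0)"
    by (rule tendsto_eventually) (auto simp: eventually_at_filter f0)
  ultimately have "f 0 = 0"
    using tendsto_unique trivial_limit_at_right_real by blast
  then show False using k by (simp add: f_def)
qed

end

theorem theorem2p1:
  fixes G :: "'g::{t2_space, second_countable_topology} monoid"
    and A :: "('g, 'n::finite) chart set"
    and h :: "'g \<Rightarrow> ('g, 'n) tvec \<Rightarrow> ('g, 'n) tvec \<Rightarrow> real"
    and \<sigma> :: "'g \<Rightarrow> real"
    and W :: "'g \<Rightarrow> ('g, 'n) tvec"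
  assumes "lie_group G A"
    and "connected (UNIV :: 'g set)"
    and "CARD('n) \<ge> 2"
    and "riemannian_metric A h"
    and "left_invariant_metric G A h"
    and "riemannian_einstein A h \<sigma>"
    and "smooth_vector_field A W"
    and "right_invariant_field G A W"
    and "\<forall>p. norm_of h p (W p) = 1"
  shows "conic_finsler_metric A (kropina_domain A h W) (kropina h W) \<and>
     \<not> is_riemannian A (kropina_domain A h W) (kropina h W) \<and>
     einstein A (kropina_domain A h W) (kropina h W) \<sigma> \<and>
     (CARD('n) \<ge> 3 \<longrightarrow> ricci_constant A (kropina_domain A h W) (kropina h W))"
proof -
  interpret kropina_navigation G A h W
    using assms by unfold_locales
  \<comment> \<open>Homogeneity supplies the constant demanded by \<open>ricci_constant\<close>: the
    value of \<open>\<sigma>\<close> at the identity.\<close>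
  have \<sigma>: "\<sigma> = (\<lambda>_. \<sigma> \<one>\<^bsub>G\<^esub>)"
    using einstein_scalar_constant[OF assms(4-6)] by blast
  have "ricci_constant A (kropina_domain A h W) (kropina h W)"
    unfolding ricci_constant_def using einstein_F[OF assms(6)] \<sigma> by metis
  then show ?thesis
    using conic_finsler not_riemannian[OF assms(3)] einstein_F[OF assms(6)] by blast
qed

end
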